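(* Let $\overline\rho>0$, $f\in C^1[0,\overline\rho]$ with $f(0)=0$, $h:=f'$, and let $g\in C[0,\overline\rho]$ satisfy $g(\rho)>0$ for $\rho\in[0,\overline\rho)$ and $g(\overline\rho)=0$. Assume one of the following two conditions: (D) $D\in C^1[0,\overline\rho]$, $D(\overline\rho)=0$ and $D(\rho)>0$ for $\rho\in(0,\overline\rho)$; ($\tilde{\rm D}$) $D\in C[0,\overline\rho]\cap C^1[0,\overline\rho)$, $D(\overline\rho)=0$, $D(\rho)>0$ for $\rho\in(0,\overline\rho)$, $\dot D(\overline\rho)=-\infty$, and the limit $\lim_{\varphi\to\overline\rho^-}\frac{D(\varphi)g(\varphi)}{\varphi-\overline\rho}$ exists in $(-\infty,0]$. Then, for every wave speed $c\in\mathbb R$, the equation $$\rho_t+f(\rho)_x=\left(D(\rho)\rho_x\right)_x+g(\rho),\qquad t\ge 0,\ x\in\mathbb R,$$ has a semi-wavefront solution from $\overline\rho$ and a semi-wavefront solution to $\overline\rho$ with speed $c$; each of them is strict and is unique (up to shifts) in the class of classical and sharp traveling-wave solutions. Moreover, let $\varphi$ denote the wave profile. In case (D): - the profile from $\overline\rho$ is sharp (at $\overline\rho$) if $c<h(\overline\rho)$ and classical if $c>h(\overline\rho)$; - the profile to $\overline\rho$ is classical if $c<h(\overline\rho)$ and sharp (at $\overline\rho$) if $c>h(\overline\rho)$; - if $c=h(\overline\rho)$, the profiles are classical if $\dot D(\overline\rho)<0$, while if $\dot D(\overline\rho)=0$ they can be either classical or sharp (that is, both behaviours occur for suitable data $f,D,g$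 satisfying these hypotheses with $c=h(\overline\rho)$ and $\dot D(\overline\rho)=0$). In case ($\tilde{\rm D}$) the profiles are always classical.
   Context: A dot denotes differentiation with respect to the state variable ($\rho$ or $\varphi$), a prime on profiles denotes differentiation with respect to $\xi$. Traveling waves. Let $I\subseteq\mathbb R$ be an open interval and $\varphi\colon I\to[0,\overline\rho]$ with $\varphi\in C(I)$ and $D(\varphi)\varphi'\in L^1_{\rm loc}(I)$ (in particular $\varphi$ is differentiable a.e.). The function $\rho(x,t)=\varphi(x-ct)$, defined for $x-ct\in I$, is a traveling-wave solution with wave speed $c$ and wave profile $\varphi$ if $$\int_I\left\{\left(D(\varphi(\xi))\varphi'(\xi)-f(\varphi(\xi))+c\varphi(\xi)\right)\psi'(\xi)-g(\varphi(\xi))\psi(\xi)\right\}d\xi=0\quad\text{for every }\psi\in C_0^\infty(I).$$ It is: global if $I=\mathbb R$; strict if $I\ne\mathbb R$ and $\varphi$ is not extendible to $\mathbb R$; classical if $\varphi$ is differentiable, $D(\varphi)\varphi'$ is absolutely continuous and $(D(\varphi)\varphi')'+(c-h(\varphi))\varphi'+g(\varphi)=0$ holds a.e. in $I$; sharp at $\ell$ if $g(\ell)=0$ and there is $\xi_0\in I$ with $\varphi(\xi_0)=\ell$, $\varphi$ classical in $I\setminus\{\xi_0\}$ and $\varphi$ not differentiable at $\xi_0$. The same terminology is used for profiles. Semi-wavefronts. A traveling-wave solution whose profile $\varphi$ is defined in $(-\infty,\varpi)$, $\varpi\in\mathbb R$, is a semi-wavefront solution from $\ell^-\in[0,\overline\rho]$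 if $g(\ell^-)=0$, $\varphi$ is monotonic (in the weak sense) and non-constant, and $\varphi(\xi)\to\ell^-$ as $\xi\to-\infty$. It is a semi-wavefront solution to $\ell^+$ if $\varphi$ is defined in $(\varpi,+\infty)$, $g(\ell^+)=0$, $\varphi$ is monotonic, non-constant, and $\varphi(\xi)\to\ell^+$ as $\xi\to+\infty$. For uniqueness, profiles are understood on their maximal interval of definition (a profile is not distinguished from its restrictions to smaller half-lines), and "up to shifts" means up to translations $\xi\mapsto\xi+\xi_1$. *)

theory Defs
  imports "HOL-Analysis.Analysis"
begin

text \<open>
  The state variable ranges over \<open>{0..R}\<close>, where \<open>R\<close> is the maximal density. The functions
  \<open>f\<close>, \<open>h\<close>, \<open>D\<close>, \<open>g\<close> are total, but only their values on \<open>{0..R}\<close> matter; likewise only the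
  values of a profile \<open>\<phi>\<close> on its (open) interval of definition \<open>I\<close> matter. A traveling wave
  \<open>\<rho>(x,t) = \<phi>(x - c t)\<close> is represented by its profile together with \<open>c\<close> and \<open>I\<close>.
\<close>

text \<open>At the endpoints of \<open>S\<close> the derivative is one-sided.\<close>

definition C1_on :: "real set \<Rightarrow> (real \<Rightarrow> real) \<Rightarrow> (real \<Rightarrow> real) \<Rightarrow> bool" where
  "C1_on S F F' \<longleftrightarrow>
     (\<forall>x\<in>S. (F has_real_derivative F' x) (at x within S)) \<and> continuous_on S F'"

definition flux_source_data ::
    "real \<Rightarrow> (real \<Rightarrow> real) \<Rightarrow> (real \<Rightarrow> real) \<Rightarrow> (real \<Rightarrow> real) \<Rightarrow> bool" where
  "flux_source_data R f h g \<longleftrightarrow>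
     C1_on {0..R} f h \<and> f 0 = 0 \<and>
     continuous_on {0..R} g \<and> (\<forall>\<rho>\<in>{0..<R}. 0 < g \<rho>) \<and> g R = 0"

definition cond_D :: "real \<Rightarrow> (real \<Rightarrow> real) \<Rightarrow> (real \<Rightarrow> real) \<Rightarrow> bool" where
  "cond_D R D dD \<longleftrightarrow>
     C1_on {0..R} D dD \<and> D R = 0 \<and> (\<forall>\<rho>\<in>{0<..<R}. 0 < D \<rho>)"

definition cond_D_tilde :: "real \<Rightarrow> (real \<Rightarrow> real) \<Rightarrow> (real \<Rightarrow> real) \<Rightarrow> bool" where
  "cond_D_tilde R D g \<longleftrightarrow>
     continuous_on {0..R} D \<and> (\<exists>dD. C1_on {0..<R} D dD) \<and>
     D R = 0 \<and> (\<forall>\<rho>\<in>{0<..<R}. 0 < D \<rho>) \<and>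
     filterlim (\<lambda>\<rho>. (D \<rho> - D R) / (\<rho> - R)) at_bot (at_left R) \<and>
     (\<exists>L\<le>0. ((\<lambda>\<rho>. D \<rho> * g \<rho> / (\<rho> - R)) \<longlongrightarrow> L) (at_left R))"

definition abs_continuous_on :: "real set \<Rightarrow> (real \<Rightarrow> real) \<Rightarrow> bool" where
  "abs_continuous_on S F \<longleftrightarrow>
     (\<forall>\<epsilon>>0. \<exists>\<delta>>0. \<forall>(n::nat) (a::nat \<Rightarrow> real) (b::nat \<Rightarrow> real).
        (\<forall>i<n. a i \<le> b i \<and> {a i..b i} \<subseteq> S) \<and>
        disjoint_family_on (\<lambda>i. {a i<..<b i}) {..<n} \<and>
        (\<Sum>i<n. b i - a i) < \<delta>
        \<longrightarrow> (\<Sum>i<n. \<bar>F (b i) - F (a i)\<bar>) < \<epsilon>)"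

definition loc_abs_continuous_on :: "real set \<Rightarrow> (real \<Rightarrow> real) \<Rightarrow> bool" where
  "loc_abs_continuous_on S F \<longleftrightarrow> (\<forall>a b. {a..b} \<subseteq> S \<longrightarrow> abs_continuous_on {a..b} F)"

text \<open>\<open>C\<^sub>0\<^sup>\<infinity>(I)\<close>: test functions are extended by zero to the whole line.\<close>

definition test_function :: "real set \<Rightarrow> (real \<Rightarrow> real) \<Rightarrow> bool" where
  "test_function I \<psi> \<longleftrightarrow>
     (\<forall>n x. ((deriv ^^ n) \<psi>) differentiable (at x)) \<and>
     (\<exists>K. compact K \<and> K \<subseteq> I \<and> (\<forall>x. x \<notin> K \<longrightarrow> \<psi> x = 0))"

text \<open>
  The local absolute continuity of \<open>\<integral>\<^sub>0\<^sup>\<phi> D\<close> says that \<open>D(\<phi>)\<phi>'\<close>, formed with the pointwise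
  a.e. derivative, is the distributional derivative of that primitive. Without it a continuous
  \<open>\<phi>\<close> could have a singular (Cantor-type) part, invisible in the weak equation. It holds
  automatically when \<open>\<phi>\<close> is differentiable off one point, is continuous, and \<open>D(\<phi>)\<phi>'\<close> is
  continuous off that point and locally integrable, in particular for classical and sharp profiles.
\<close>

definition tw_profile ::
    "real \<Rightarrow> (real \<Rightarrow> real) \<Rightarrow> (real \<Rightarrow> real) \<Rightarrow> (real \<Rightarrow> real) \<Rightarrow> real \<Rightarrow>
     real set \<Rightarrow> (real \<Rightarrow> real) \<Rightarrow> bool" where
  "tw_profile R f D g c I \<phi> \<longleftrightarrow>
     open I \<and> is_interval I \<and> I \<noteq> {} \<and>
     \<phi> ` I \<subseteq> {0..R} \<and> continuous_on I \<phi> \<and>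
     (AE \<xi> in lebesgue. \<xi> \<in> I \<longrightarrow> \<phi> differentiable (at \<xi>)) \<and>
     (\<forall>a b. {a..b} \<subseteq> I \<longrightarrow>
        (\<lambda>\<xi>. D (\<phi> \<xi>) * deriv \<phi> \<xi>) absolutely_integrable_on {a..b}) \<and>
     loc_abs_continuous_on I (\<lambda>\<xi>. integral {0..\<phi> \<xi>} D) \<and>
     (\<forall>\<psi>. test_function I \<psi> \<longrightarrow>
        (LINT \<xi>:I|lebesgue.
           (D (\<phi> \<xi>) * deriv \<phi> \<xi> - f (\<phi> \<xi>) + c * \<phi> \<xi>) * deriv \<psi> \<xi> - g (\<phi> \<xi>) * \<psi> \<xi>) = 0)"

text \<open>\<open>h\<close> is the derivative of the flux \<open>f\<close>; \<open>S\<close> is open, not necessarily an interval.\<close>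

definition classical_on ::
    "(real \<Rightarrow> real) \<Rightarrow> (real \<Rightarrow> real) \<Rightarrow> (real \<Rightarrow> real) \<Rightarrow> real \<Rightarrow>
     real set \<Rightarrow> (real \<Rightarrow> real) \<Rightarrow> bool" where
  "classical_on h D g c S \<phi> \<longleftrightarrow>
     (\<forall>\<xi>\<in>S. \<phi> differentiable (at \<xi>)) \<and>
     loc_abs_continuous_on S (\<lambda>\<xi>. D (\<phi> \<xi>) * deriv \<phi> \<xi>) \<and>
     (AE \<xi> in lebesgue. \<xi> \<in> S \<longrightarrow>
        (\<exists>v. ((\<lambda>\<xi>. D (\<phi> \<xi>) * deriv \<phi> \<xi>) has_real_derivative v) (at \<xi>) \<and>
             v + (c - h (\<phi> \<xi>)) * deriv \<phi> \<xi> + g (\<phi> \<xi>) = 0))"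

definition sharp_at ::
    "(real \<Rightarrow> real) \<Rightarrow> (real \<Rightarrow> real) \<Rightarrow> (real \<Rightarrow> real) \<Rightarrow> real \<Rightarrow>
     real set \<Rightarrow> (real \<Rightarrow> real) \<Rightarrow> real \<Rightarrow> bool" where
  "sharp_at h D g c I \<phi> l \<longleftrightarrow>
     g l = 0 \<and>
     (\<exists>\<xi>\<^sub>0\<in>I. \<phi> \<xi>\<^sub>0 = l \<and> classical_on h D g c (I - {\<xi>\<^sub>0}) \<phi> \<and> \<not> \<phi> differentiable (at \<xi>\<^sub>0))"

definition classical_or_sharp ::
    "real \<Rightarrow> (real \<Rightarrow> real) \<Rightarrow> (real \<Rightarrow> real) \<Rightarrow> (real \<Rightarrow> real) \<Rightarrow> real \<Rightarrow>
     real set \<Rightarrow> (real \<Rightarrow> real) \<Rightarrow> bool" where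
  "classical_or_sharp R h D g c I \<phi> \<longleftrightarrow>
     classical_on h D g c I \<phi> \<or> (\<exists>l\<in>{0..R}. sharp_at h D g c I \<phi> l)"

definition strict_profile ::
    "real \<Rightarrow> (real \<Rightarrow> real) \<Rightarrow> (real \<Rightarrow> real) \<Rightarrow> (real \<Rightarrow> real) \<Rightarrow> real \<Rightarrow>
     real set \<Rightarrow> (real \<Rightarrow> real) \<Rightarrow> bool" where
  "strict_profile R f D g c I \<phi> \<longleftrightarrow>
     I \<noteq> UNIV \<and>
     \<not> (\<exists>\<theta>. tw_profile R f D g c UNIV \<theta> \<and> (\<forall>\<xi>\<in>I. \<theta> \<xi> = \<phi> \<xi>))"

definition maximal_profile ::
    "real \<Rightarrow> (real \<Rightarrow> real) \<Rightarrow> (real \<Rightarrow> real) \<Rightarrow> (real \<Rightarrow> real) \<Rightarrow> real \<Rightarrow>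
     real set \<Rightarrow> (real \<Rightarrow> real) \<Rightarrow> bool" where
  "maximal_profile R f D g c I \<phi> \<longleftrightarrow>
     tw_profile R f D g c I \<phi> \<and>
     (\<forall>J \<theta>. tw_profile R f D g c J \<theta> \<and> I \<subseteq> J \<and> (\<forall>\<xi>\<in>I. \<theta> \<xi> = \<phi> \<xi>) \<longrightarrow> J = I)"

definition semi_wavefront_from ::
    "real \<Rightarrow> (real \<Rightarrow> real) \<Rightarrow> (real \<Rightarrow> real) \<Rightarrow> (real \<Rightarrow> real) \<Rightarrow> real \<Rightarrow>
     real \<Rightarrow> real \<Rightarrow> (real \<Rightarrow> real) \<Rightarrow> bool" where
  "semi_wavefront_from R f D g c l \<omega> \<phi> \<longleftrightarrow>
     tw_profile R f D g c {..<\<omega>} \<phi> \<and> l \<in> {0..R} \<and> g l = 0 \<and>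
     (mono_on {..<\<omega>} \<phi> \<or> antimono_on {..<\<omega>} \<phi>) \<and>
     \<not> \<phi> constant_on {..<\<omega>} \<and>
     (\<phi> \<longlongrightarrow> l) at_bot"

definition semi_wavefront_to ::
    "real \<Rightarrow> (real \<Rightarrow> real) \<Rightarrow> (real \<Rightarrow> real) \<Rightarrow> (real \<Rightarrow> real) \<Rightarrow> real \<Rightarrow>
     real \<Rightarrow> real \<Rightarrow> (real \<Rightarrow> real) \<Rightarrow> bool" where
  "semi_wavefront_to R f D g c l \<omega> \<phi> \<longleftrightarrow>
     tw_profile R f D g c {\<omega><..} \<phi> \<and> l \<in> {0..R} \<and> g l = 0 \<and>
     (mono_on {\<omega><..} \<phi> \<or> antimono_on {\<omega><..} \<phi>) \<and>
     \<not> \<phi> constant_on {\<omega><..} \<and>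
     (\<phi> \<longlongrightarrow> l) at_top"

text \<open>
  Uniqueness up to shifts: every classical or sharp competitor is a translate of a restriction of
  \<open>\<phi>\<close> to a smaller or equal half-line. A competitor on its maximal interval is therefore a
  translate of \<open>\<phi>\<close> itself. (Mere agreement on some common half-line would be too weak: sharp
  profiles are constant far out.)
\<close>

definition unique_from ::
    "real \<Rightarrow> (real \<Rightarrow> real) \<Rightarrow> (real \<Rightarrow> real) \<Rightarrow> (real \<Rightarrow> real) \<Rightarrow> (real \<Rightarrow> real) \<Rightarrow> real \<Rightarrow>
     real \<Rightarrow> real \<Rightarrow> (real \<Rightarrow> real) \<Rightarrow> bool" where
  "unique_from R f h D g c l \<omega> \<phi> \<longleftrightarrow>
     (\<forall>\<omega>' \<theta>. semi_wavefront_from R f D g c l \<omega>' \<theta> \<and>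
              classical_or_sharp R h D g c {..<\<omega>'} \<theta> \<longrightarrow>
        (\<exists>s. \<omega>' + s \<le> \<omega> \<and> (\<forall>\<xi><\<omega>'. \<theta> \<xi> = \<phi> (\<xi> + s))))"

definition unique_to ::
    "real \<Rightarrow> (real \<Rightarrow> real) \<Rightarrow> (real \<Rightarrow> real) \<Rightarrow> (real \<Rightarrow> real) \<Rightarrow> (real \<Rightarrow> real) \<Rightarrow> real \<Rightarrow>
     real \<Rightarrow> real \<Rightarrow> (real \<Rightarrow> real) \<Rightarrow> bool" where
  "unique_to R f h D g c l \<omega> \<phi> \<longleftrightarrow>
     (\<forall>\<omega>' \<theta>. semi_wavefront_to R f D g c l \<omega>' \<theta> \<and>
              classical_or_sharp R h D g c {\<omega>'<..} \<theta> \<longrightarrow>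
        (\<exists>s. \<omega> \<le> \<omega>' + s \<and> (\<forall>\<xi>>\<omega>'. \<theta> \<xi> = \<phi> (\<xi> + s))))"

end

theory Submission
  imports Defs "HOL-Computational_Algebra.Polynomial"
begin

text \<open>
  Along a decreasing profile put \<open>x = R - \<phi>\<close> and \<open>u(x) = - D(\<phi>) \<phi>'\<close>; the wave equation becomes the
  singular first-order problem \<open>u' = h(R - x) - c + D(R - x) g(R - x) / u\<close>, \<open>u > 0\<close>, \<open>u(0+) = 0\<close>, which is
  solved by a monotone regularisation. The profile is recovered by separating variables in
  \<open>dx/d\<xi> = u / D(R - x)\<close>; it leaves \<open>R\<close> with slope \<open>lim u / D\<close>, so that a comparison of \<open>u\<close> with multiples
  of \<open>D\<close> decides between sharp and classical, and it reaches \<open>0\<close> in finite time because \<open>g(0) > 0\<close>.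
  Conversely, for any weak profile \<open>\<theta>\<close> the du Bois-Reymond lemma shows that \<open>\<integral>\<^sub>0\<^sup>\<theta> D\<close> is \<open>C\<^sup>1\<close> with derivative \<open>Y\<close>
  satisfying \<open>(Y - f(\<theta>) + c \<theta>)' = - g(\<theta>)\<close>. This gives uniqueness, since
  \<open>(- Y - u(R - \<theta>))\<^sup>2\<close> is nonincreasing and vanishes where \<open>\<theta>\<close> leaves \<open>R\<close>, and maximality, since past a
  zero of \<open>\<theta>\<close> the primitive would become negative. The waves to \<open>R\<close> are obtained by the reflection
  \<open>\<xi> \<mapsto> - \<xi>\<close>, \<open>f \<mapsto> - f\<close>, \<open>c \<mapsto> - c\<close>.
\<close>

text \<open>The state \<open>R\<close> is singular twice: \<open>D\<close> vanishes there, and in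
  the first-order problem both \<open>u\<close> and \<open>D g\<close> tend to \<open>0\<close> at
  the starting point, so no standard existence or uniqueness theorem applies at
  \<open>x = 0\<close>. What helps is that \<open>k / u\<close> is decreasing in \<open>u\<close>.
  It orders the approximations that start above \<open>0\<close>, and explicit barriers then keep
  their limit positive inside and null at \<open>0\<close>. It also prevents two trajectories from
  drifting apart as \<open>\<xi>\<close> increases, so a difference could only enter at minus
  infinity or at the point of departure from \<open>R\<close>, and both sources are closed by the
  bounds on \<open>P(\<theta>)\<close> and by the continuity of the flux.

  A weak profile need not be differentiable where it meets a zero of \<open>D\<close>, and
  \<open>0\<close> may be such a zero as well as \<open>R\<close>. Competitors are therefore handled
  through \<open>P(\<theta>)\<close> and its flux, and a derivative of \<open>\<theta>\<close>
  itself is used only where \<open>0 < \<theta> < R\<close>.\<close>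

subsection \<open>Absolutely continuous functions\<close>

text \<open>Barrier principle: between the last point with \<open>w >= 0\<close> and a point with
  \<open>w < 0\<close> the function would be nondecreasing. Only points where a barrier is violated
  have to be examined, and there the singular term \<open>k / u\<close> has a known bound. The later
  barriers for \<open>u\<close> are verified with it.\<close>

lemma nonneg_of_deriv_nonneg_where_neg:
  fixes w :: "real \<Rightarrow> real"
  assumes cont: "continuous_on {a..b} w" and init: "0 \<le> w a"
    and deriv: "\<And>x. a < x \<Longrightarrow> x < b \<Longrightarrow> w x < 0 \<Longrightarrow>
      \<exists>d\<ge>0. (w has_real_derivative d) (at x)"
    and x: "x \<in> {a..b}"
  shows "0 \<le> w x"
proof (rule ccontr)
  assume "\<not> 0 \<le> w x"
  then have neg: "w x < 0" by simp
  define S where "S = {a..x} \<inter> w -` {0..}"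
  have cx: "continuous_on {a..x} w" using cont x by (auto intro: continuous_on_subset)
  have "closed S" unfolding S_def
    using continuous_closed_preimage[OF cx] by auto
  have aS: "a \<in> S" unfolding S_def using init x by auto
  have bdd: "bdd_above S" unfolding S_def by (auto intro: bdd_aboveI[of _ x])
  define y where "y = Sup S"
  have yS: "y \<in> S" unfolding y_def
    using \<open>closed S\<close> aS bdd by (intro closed_contains_Sup) auto
  then have y: "a \<le> y" "y \<le> x" "0 \<le> w y" by (auto simp: S_def)
  have yx: "y < x" using y neg by (cases "y = x") auto
  have below: "w t < 0" if "y < t" "t \<le> x" for t
  proof (rule ccontr)
    assume "\<not> w t < 0"
    then have "t \<in> S" using that y by (auto simp: S_def)
    then have "t \<le> y" unfolding y_def using bdd by (rule cSup_upper)
    then show False using that by simp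
  qed
  have "w y \<le> w x"
  proof (rule DERIV_nonneg_imp_increasing_open[of y x w])
    show "y \<le> x" using yx by simp
    show "\<exists>d. (w has_real_derivative d) (at t) \<and> 0 \<le> d" if "y < t" "t < x" for t
      using deriv[of t] below[of t] that y x by auto
    show "continuous_on {y..x} w" using cx y by (auto intro: continuous_on_subset)
  qed
  then show False using neg y by simp
qed

lemma negligible_if_AE:
  assumes "AE x in lebesgue. Q (x :: real)" shows "negligible {x. \<not> Q x}"
proof -
  obtain N where "N \<in> null_sets lebesgue" "{x \<in> space lebesgue. \<not> Q x} \<subseteq> N"
    using assms unfolding eventually_ae_filter by blast
  then have "negligible N" "{x. \<not> Q x} \<subseteq> N" by (auto simp: negligible_iff_null_sets)
  then show ?thesis by (rule negligible_subset)
qed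

lemma abs_bounded_on_Icc:
  fixes p :: "real \<Rightarrow> real"
  assumes "continuous_on {a..b} p"
  obtains A where "0 \<le> A" "\<And>x. x \<in> {a..b} \<Longrightarrow> \<bar>p x\<bar> \<le> A"
proof -
  have "bounded (p ` {a..b})" by (intro compact_imp_bounded compact_continuous_image assms compact_Icc)
  then obtain A where "\<forall>y\<in>p ` {a..b}. norm y \<le> A" unfolding bounded_iff by blast
  then show ?thesis by (intro that[of "max 0 A"]) (auto simp: le_max_iff_disj)
qed

lemma sum_integral_disjoint_le:
  fixes r :: "real \<Rightarrow> real"
  assumes r: "r integrable_on {a..b}" and nn: "\<And>x. x \<in> {a..b} \<Longrightarrow> 0 \<le> r x"
    and I: "finite I" and sub: "\<And>i. i \<in> I \<Longrightarrow> {s i..t i} \<subseteq> {a..b}"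
    and dis: "disjoint_family_on (\<lambda>i. {s i<..<t i}) I"
  shows "(\<Sum>i\<in>I. integral {s i..t i} r) \<le> integral {a..b} r"
proof -
  have int: "(r has_integral integral {s i..t i} r) {s i<..<t i}" if "i \<in> I" for i
    unfolding has_integral_Icc_iff_Ioo[symmetric]
    by (rule integrable_integral, rule integrable_on_subinterval[OF r sub[OF that]])
  have "(r has_integral (\<Sum>i\<in>I. integral {s i..t i} r)) (\<Union>i\<in>I. {s i<..<t i})"
    by (rule has_integral_UN[OF I])
      (use int dis in \<open>auto simp: pairwise_def disjoint_family_on_def\<close>)
  moreover have "(\<Union>i\<in>I. {s i<..<t i}) \<subseteq> {a..b}"
    using sub by (fastforce simp: subset_iff)
  ultimately show ?thesis
    using has_integral_subset_le[OF _ _ integrable_integral[OF r]] nn by blast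
qed

text \<open>Split \<open>w\<close> at height \<open>N\<close>: the part \<open>min w N\<close>
  contributes at most \<open>N\<close> times the total length, and the excess has small integral for
  large \<open>N\<close> by dominated convergence. In the application to fronts \<open>w\<close>
  contains the slope of the profile, which may be unbounded.\<close>

lemma abs_continuous_on_dominated:
  fixes w F :: "real \<Rightarrow> real"
  assumes w: "w integrable_on {a..b}" and nn: "\<And>x. x \<in> {a..b} \<Longrightarrow> 0 \<le> w x"
    and F: "\<And>s t. a \<le> s \<Longrightarrow> s \<le> t \<Longrightarrow> t \<le> b \<Longrightarrow> \<bar>F t - F s\<bar> \<le> integral {s..t} w"
  shows "abs_continuous_on {a..b} F"
  unfolding abs_continuous_on_def
proof (intro allI impI)
  fix e :: real assume e: "0 < e"
  define m where "m = (\<lambda>N::nat. \<lambda>x. min (w x) (real N))"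
  have wabs: "w absolutely_integrable_on {a..b}"
    using w nn by (rule nonnegative_absolutely_integrable_1)
  have mint: "m N integrable_on {a..b}" for N
    unfolding m_def
    by (rule set_lebesgue_integral_eq_integral(1), rule absolutely_integrable_min_1[OF wabs])
      (rule absolutely_integrable_continuous_real, simp)
  have conv: "(\<lambda>N. integral {a..b} (m N)) \<longlonglongrightarrow> integral {a..b} w"
  proof (rule dominated_convergence(2)[OF mint w])
    show "norm (m k x) \<le> w x" if "x \<in> {a..b}" for k x using nn[OF that] by (auto simp: m_def)
    show "(\<lambda>k. m k x) \<longlonglongrightarrow> w x" if "x \<in> {a..b}" for x
    proof -
      obtain N where "w x \<le> real N" using real_arch_simple by blast
      then have "\<forall>k\<ge>N. m k x = w x" by (auto simp: m_def)
      then show ?thesis by (metis (mono_tags, lifting) eventually_sequentiallyI tendsto_eventually)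
    qed
  qed
  then have "\<forall>\<^sub>F N in sequentially. dist (integral {a..b} (m N)) (integral {a..b} w) < e/2"
    using e by (intro tendstoD) auto
  then obtain N where N: "dist (integral {a..b} (m N)) (integral {a..b} w) < e/2"
    by (auto simp: eventually_sequentially)
  define r where "r = (\<lambda>x. w x - m N x)"
  have rint: "r integrable_on {a..b}" unfolding r_def by (intro integrable_diff w mint)
  have rnn: "0 \<le> r x" for x by (auto simp: r_def m_def)
  have rsmall: "integral {a..b} r < e/2"
    using N unfolding r_def integral_diff[OF w mint] dist_real_def by linarith
  have bound: "\<bar>F t - F s\<bar> \<le> real N * (t - s) + integral {s..t} r"
    if "s \<le> t" "{s..t} \<subseteq> {a..b}" for s t
  proof -
    have "\<bar>F t - F s\<bar> \<le> integral {s..t} w" using F[of s t] that by auto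
    also have "integral {s..t} w = integral {s..t} (m N) + integral {s..t} r"
      unfolding r_def
      using integral_diff[OF integrable_on_subinterval[OF w that(2)]
          integrable_on_subinterval[OF mint that(2)]] by simp
    finally have "\<bar>F t - F s\<bar> \<le> integral {s..t} (m N) + integral {s..t} r" .
    moreover have "integral {s..t} (m N) \<le> integral {s..t} (\<lambda>_. real N)"
      by (rule integral_le[OF integrable_on_subinterval[OF mint that(2)]]) (auto simp: m_def)
    ultimately show ?thesis using that by (simp add: mult.commute)
  qed
  \<comment> \<open>\<open>N * d\<close> uses at most half of \<open>e\<close>; the other half is
    reserved for the excess \<open>r\<close>.\<close>
  define d where "d = e / (2 * (real N + 1))"
  have d: "0 < d" "real N * d \<le> e/2" using e by (auto simp: d_def field_simps)
  show "\<exists>\<delta>>0. \<forall>(n::nat) (s::nat \<Rightarrow> real) (t::nat \<Rightarrow> real).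
        (\<forall>i<n. s i \<le> t i \<and> {s i..t i} \<subseteq> {a..b}) \<and>
        disjoint_family_on (\<lambda>i. {s i<..<t i}) {..<n} \<and>
        (\<Sum>i<n. t i - s i) < \<delta>
        \<longrightarrow> (\<Sum>i<n. \<bar>F (t i) - F (s i)\<bar>) < e"
  proof (intro exI[of _ d] conjI d allI impI)
    fix n :: nat and s t :: "nat \<Rightarrow> real"
    assume A: "(\<forall>i<n. s i \<le> t i \<and> {s i..t i} \<subseteq> {a..b}) \<and>
        disjoint_family_on (\<lambda>i. {s i<..<t i}) {..<n} \<and> (\<Sum>i<n. t i - s i) < d"
    have "(\<Sum>i<n. \<bar>F (t i) - F (s i)\<bar>) \<le> (\<Sum>i<n. real N * (t i - s i) + integral {s i..t i} r)"
      by (rule sum_mono, rule bound) (use A in auto)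
    also have "\<dots> = real N * (\<Sum>i<n. t i - s i) + (\<Sum>i<n. integral {s i..t i} r)"
      by (simp add: sum.distrib sum_distrib_left)
    also have "\<dots> \<le> real N * d + integral {a..b} r"
    proof (rule add_mono)
      show "real N * (\<Sum>i<n. t i - s i) \<le> real N * d"
        by (rule mult_left_mono) (use A in auto)
      show "(\<Sum>i<n. integral {s i..t i} r) \<le> integral {a..b} r"
        by (rule sum_integral_disjoint_le[OF rint rnn]) (use A in auto)
    qed
    also have "\<dots> < e" using d(2) rsmall by simp
    finally show "(\<Sum>i<n. \<bar>F (t i) - F (s i)\<bar>) < e" .
  qed
qed

lemma abs_continuous_on_cong:
  assumes "abs_continuous_on {a..b} F" and eq: "\<And>x. x \<in> {a..b} \<Longrightarrow> F x = G x"
  shows "abs_continuous_on {a..b} G"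
proof -
  have sum: "(\<Sum>i<n. \<bar>G (t i) - G (s i)\<bar>) = (\<Sum>i<n. \<bar>F (t i) - F (s i)\<bar>)"
    if st: "\<forall>i<n. s i \<le> t i \<and> {s i..t i} \<subseteq> {a..b}" for n :: nat and s t :: "nat \<Rightarrow> real"
  proof (rule sum.cong[OF refl])
    fix i assume "i \<in> {..<n}"
    then have "s i \<in> {a..b}" "t i \<in> {a..b}" using st by auto
    then show "\<bar>G (t i) - G (s i)\<bar> = \<bar>F (t i) - F (s i)\<bar>" by (simp only: eq)
  qed
  show ?thesis
    unfolding abs_continuous_on_def
  proof (intro allI impI)
    fix e :: real assume "0 < e"
    then obtain d where "0 < d" "\<forall>(n::nat) s t. (\<forall>i<n. s i \<le> t i \<and> {s i..t i} \<subseteq> {a..b}) \<and>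
        disjoint_family_on (\<lambda>i. {s i<..<t i}) {..<n} \<and> (\<Sum>i<n. t i - s i) < d
        \<longrightarrow> (\<Sum>i<n. \<bar>F (t i) - F (s i)\<bar>) < e"
      using assms(1) unfolding abs_continuous_on_def by blast
    with sum show "\<exists>\<delta>>0. \<forall>(n::nat) (s::nat \<Rightarrow> real) (t::nat \<Rightarrow> real).
        (\<forall>i<n. s i \<le> t i \<and> {s i..t i} \<subseteq> {a..b}) \<and>
        disjoint_family_on (\<lambda>i. {s i<..<t i}) {..<n} \<and> (\<Sum>i<n. t i - s i) < \<delta>
        \<longrightarrow> (\<Sum>i<n. \<bar>G (t i) - G (s i)\<bar>) < e"
      by (intro exI[of _ d]) auto
  qed
qed

lemma negligible_open_cover:
  assumes "negligible (N :: real set)" "0 < e"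
  obtains U where "open U" "N \<subseteq> U" "emeasure lebesgue U < ennreal e"
proof -
  have N: "N \<in> null_sets lebesgue" using assms(1) by (simp add: negligible_iff_null_sets)
  obtain T where T: "open T" "N \<subseteq> T" "T - N \<in> lmeasurable" "emeasure lebesgue (T - N) < ennreal e"
    using sets_lebesgue_outer_open[of N e] assms N by auto
  have "emeasure lebesgue (T - N) = emeasure lebesgue T"
    by (rule emeasure_Diff_null_set[OF N]) (use T in auto)
  then show ?thesis using that T by auto
qed

text \<open>A Henstock-Kurzweil gauge separates two kinds of tags. Away from \<open>N\<close> the
  straddle estimate compares \<open>y x\<close> times the length with the increment of
  \<open>F\<close>; at tags in \<open>N\<close> the gauge is an open set of measure below
  \<open>\<delta>\<close>, so absolute continuity itself bounds the sum of the increments.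
  Integrability of \<open>y\<close> comes out as part of the conclusion.\<close>

lemma abs_continuous_on_has_integral:
  fixes F y :: "real \<Rightarrow> real"
  assumes ac: "abs_continuous_on {a..b} F" and ab: "a \<le> b"
    and N: "negligible N"
    and deriv: "\<And>x. x \<in> {a..b} - N \<Longrightarrow> (F has_real_derivative y x) (at x within {a..b})"
  shows "(y has_integral (F b - F a)) {a..b}"
proof -
  \<comment> \<open>Tags in \<open>N\<close> contribute nothing to the Riemann sum of
    \<open>y0\<close>, so only their increments of \<open>F\<close> remain as an error.\<close>
  define y0 where "y0 = (\<lambda>x. if x \<in> N then 0 else y x)"
  have "(y0 has_integral (F b - F a)) {a..b}"
    unfolding has_integral_real
  proof (intro allI impI)
    fix e :: real assume e: "0 < e"
    \<comment> \<open>The total error away from \<open>N\<close> is \<open>e1 * (b - a)\<close>; the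
      extra \<open>1\<close> in the denominator covers \<open>a = b\<close>.\<close>
    define e1 where "e1 = e / (2 * (b - a + 1))"
    have e1: "0 < e1" "e1 * (b - a) < e / 2"
      using e ab by (auto simp: e1_def field_simps)
    obtain \<delta> where \<delta>: "0 < \<delta>" and acd: "\<And>(n::nat) s t.
        (\<forall>i<n. s i \<le> t i \<and> {s i..t i} \<subseteq> {a..b}) \<Longrightarrow>
        disjoint_family_on (\<lambda>i. {s i<..<t i}) {..<n} \<Longrightarrow>
        (\<Sum>i<n. t i - s i) < \<delta> \<Longrightarrow> (\<Sum>i<n. \<bar>F (t i) - F (s i)\<bar>) < e / 2"
    proof -
      have "0 < e / 2" using e by simp
      then obtain \<delta> where "0 < \<delta>" and "\<forall>(n::nat) s t.
        (\<forall>i<n. s i \<le> t i \<and> {s i..t i} \<subseteq> {a..b}) \<and>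
        disjoint_family_on (\<lambda>i. {s i<..<t i}) {..<n} \<and>
        (\<Sum>i<n. t i - s i) < \<delta> \<longrightarrow> (\<Sum>i<n. \<bar>F (t i) - F (s i)\<bar>) < e / 2"
        using ac unfolding abs_continuous_on_def by blast
      then show ?thesis by (intro that[of \<delta>]) auto
    qed
    obtain U where U: "open U" "N \<subseteq> U" "emeasure lebesgue U < ennreal \<delta>"
      using negligible_open_cover[OF N \<delta>] by blast
    have "\<exists>d>0. \<forall>v\<in>{a..b}. \<bar>v - x\<bar> < d \<longrightarrow> \<bar>F v - F x - y x * (v - x)\<bar> \<le> e1 * \<bar>v - x\<bar>"
      if "x \<in> {a..b} - N" for x
    proof -
      have "\<forall>e>0. \<exists>d>0. \<forall>v\<in>{a..b}. norm (v - x) < d \<longrightarrow> norm (F v - F x - y x * (v - x)) \<le> e * norm (v - x)"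
        using deriv[OF that] unfolding has_field_derivative_def has_derivative_within_alt by blast
      then show ?thesis using e1(1) by (simp only: real_norm_def)
    qed
    then have "\<forall>x\<in>{a..b} - N. \<exists>d>0. \<forall>v\<in>{a..b}. \<bar>v - x\<bar> < d \<longrightarrow>
        \<bar>F v - F x - y x * (v - x)\<bar> \<le> e1 * \<bar>v - x\<bar>" by blast
    from bchoice[OF this] obtain d where d: "\<And>x. x \<in> {a..b} - N \<Longrightarrow> 0 < d x"
      "\<And>x v. x \<in> {a..b} - N \<Longrightarrow> v \<in> {a..b} \<Longrightarrow> \<bar>v - x\<bar> < d x \<Longrightarrow>
         \<bar>F v - F x - y x * (v - x)\<bar> \<le> e1 * \<bar>v - x\<bar>"
      by blast
    define \<gamma> where "\<gamma> = (\<lambda>x. if x \<in> N then U else if x \<in> {a..b} then ball x (d x) else UNIV)"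
    have gauge: "gauge \<gamma>"
      unfolding gauge_def \<gamma>_def using U d(1) by auto
    show "\<exists>\<gamma>. gauge \<gamma> \<and> (\<forall>p. p tagged_division_of {a..b} \<and> \<gamma> fine p \<longrightarrow>
        norm (sum (\<lambda>(x,k). measure lborel k *\<^sub>R y0 x) p - (F b - F a)) < e)"
    proof (intro exI[of _ \<gamma>] conjI gauge allI impI)
      fix p assume p: "p tagged_division_of {a..b} \<and> \<gamma> fine p"
      then have tag: "p tagged_division_of {a..b}" and fine: "\<gamma> fine p" by auto
      have fin: "finite p" using tag by (rule tagged_division_of_finite)
      have K: "\<exists>u v. K = {u..v} \<and> u \<le> x \<and> x \<le> v \<and> a \<le> u \<and> v \<le> b" if "(x,K) \<in> p" for x K
      proof -
        have "x \<in> K" "K \<subseteq> {a..b}" "\<exists>u v. K = cbox u v"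
          using tagged_division_ofD(2-4)[OF tag that] by auto
        then obtain u v where "K = {u..v}" "x \<in> {u..v}" "{u..v} \<subseteq> {a..b}" by auto
        then show ?thesis by (intro exI[of _ u] exI[of _ v]) auto
      qed
      define \<Delta> where "\<Delta> = (\<lambda>K. F (Sup K) - F (Inf K))"
      have tel: "(\<Sum>(x,K)\<in>p. \<Delta> K) = F b - F a"
        unfolding \<Delta>_def
        using additive_tagged_division_1[OF ab tag, of F] by simp
      define p1 where "p1 = {q \<in> p. fst q \<in> N}"
      define p2 where "p2 = {q \<in> p. fst q \<notin> N}"
      have split: "sum G p = sum G p1 + sum G p2" for G :: "_ \<Rightarrow> real"
        unfolding p1_def p2_def using fin
        by (subst sum.union_disjoint[symmetric]) (auto intro: sum.cong)
      have fin12: "finite p1" "finite p2" using fin by (auto simp: p1_def p2_def)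
      have b2: "\<bar>measure lborel K * y0 x - \<Delta> K\<bar> \<le> e1 * measure lborel K" if "(x,K) \<in> p2" for x K
      proof -
        have xp: "(x,K) \<in> p" "x \<notin> N" using that by (auto simp: p2_def)
        obtain u v where uv: "K = {u..v}" "u \<le> x" "x \<le> v" "a \<le> u" "v \<le> b" using K[OF xp(1)] by blast
        have "K \<subseteq> \<gamma> x" using fine xp(1) by (auto simp: fine_def)
        then have "K \<subseteq> ball x (d x)" using uv xp by (auto simp: \<gamma>_def)
        then have "u \<in> ball x (d x)" "v \<in> ball x (d x)" using uv by (auto simp del: mem_ball)
        then have *: "\<bar>F u - F x - y x * (u - x)\<bar> \<le> e1 * \<bar>u - x\<bar>" "\<bar>F v - F x - y x * (v - x)\<bar> \<le> e1 * \<bar>v - x\<bar>"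
          using d(2)[of x u] d(2)[of x v] uv xp by (auto simp: dist_real_def)
        have "measure lborel K * y0 x - \<Delta> K = (F u - F x - y x * (u - x)) - (F v - F x - y x * (v - x))"
          using uv xp by (simp add: \<Delta>_def y0_def algebra_simps)
        then show ?thesis using * uv by (simp add: algebra_simps)
      qed
      have csum: "(\<Sum>(x,K)\<in>p. measure lborel K) = b - a"
        using additive_content_tagged_division[of p a b] tag ab by (simp add: content_real)
      have s2: "\<bar>\<Sum>(x,K)\<in>p2. measure lborel K * y0 x - \<Delta> K\<bar> < e / 2"
      proof -
        have "\<bar>\<Sum>(x,K)\<in>p2. measure lborel K * y0 x - \<Delta> K\<bar> \<le> (\<Sum>(x,K)\<in>p2. e1 * measure lborel K)"
          by (rule order_trans[OF sum_abs], rule sum_mono) (use b2 in auto)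
        also have "\<dots> \<le> (\<Sum>(x,K)\<in>p. e1 * measure lborel K)"
          by (rule sum_mono2[OF fin]) (use e1 in \<open>auto simp: p2_def\<close>)
        also have "\<dots> = e1 * (b - a)"
          unfolding csum[symmetric] by (simp add: sum_distrib_left case_prod_beta)
        finally show ?thesis using e1 by simp
      qed
      have s1: "(\<Sum>(x,K)\<in>p1. \<bar>\<Delta> K\<bar>) < e / 2"
      proof -
        obtain h where h: "bij_betw h {..<card p1} p1"
          using ex_bij_betw_nat_finite[OF fin12(1)] by (auto simp: atLeast0LessThan)
        define s where "s = (\<lambda>i. Inf (snd (h i)))"
        define t where "t = (\<lambda>i. Sup (snd (h i)))"
        have hi: "h i \<in> p1" if "i < card p1" for i using h that by (auto dest: bij_betwE)
        have st: "snd (h i) = {s i..t i} \<and> s i \<le> t i \<and> {s i..t i} \<subseteq> {a..b} \<and> {s i..t i} \<subseteq> U"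
          if i: "i < card p1" for i
        proof -
          obtain x K where xK: "h i = (x,K)" by force
          have xp: "(x,K) \<in> p" "x \<in> N" using hi[OF i] xK by (auto simp: p1_def)
          obtain u v where uv: "K = {u..v}" "u \<le> x" "x \<le> v" "a \<le> u" "v \<le> b" using K[OF xp(1)] by blast
          have "K \<subseteq> \<gamma> x" using fine xp(1) by (auto simp: fine_def)
          then show ?thesis using uv xK xp by (auto simp: s_def t_def \<gamma>_def)
        qed
        have dis: "disjoint_family_on (\<lambda>i. {s i<..<t i}) {..<card p1}"
          unfolding disjoint_family_on_def
        proof (intro ballI impI)
          fix i j assume ij: "i \<in> {..<card p1}" "j \<in> {..<card p1}" "i \<noteq> j"
          have "h i \<noteq> h j" using h ij by (auto simp: bij_betw_def inj_on_def)
          moreover have "h i \<in> p" "h j \<in> p" using hi ij by (auto simp: p1_def)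
          ultimately have "interior (snd (h i)) \<inter> interior (snd (h j)) = {}"
            using tagged_division_ofD(5)[OF tag, of "fst (h i)" "snd (h i)" "fst (h j)" "snd (h j)"] by auto
          then show "{s i<..<t i} \<inter> {s j<..<t j} = {}"
            using st ij by auto
        qed
        have "(\<Sum>i<card p1. t i - s i) < \<delta>"
        proof -
          have "ennreal (\<Sum>i<card p1. t i - s i) = (\<Sum>i<card p1. ennreal (t i - s i))"
            by (rule sum_ennreal[symmetric]) (use st in auto)
          also have "\<dots> = (\<Sum>i<card p1. emeasure lebesgue {s i<..<t i})"
            by (rule sum.cong) (use st in auto)
          also have "\<dots> = emeasure lebesgue (\<Union>i<card p1. {s i<..<t i})"
            by (rule sum_emeasure) (use dis in auto)
          also have "\<dots> \<le> emeasure lebesgue U"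
            by (rule emeasure_mono) (use st U in \<open>auto simp: subset_iff\<close>)
          also have "\<dots> < ennreal \<delta>" by (rule U)
          finally show ?thesis using \<delta> st by (subst (asm) ennreal_less_iff) (auto intro: sum_nonneg)
        qed
        then have "(\<Sum>i<card p1. \<bar>F (t i) - F (s i)\<bar>) < e / 2"
          by (intro acd dis) (use st in auto)
        also have "(\<Sum>i<card p1. \<bar>F (t i) - F (s i)\<bar>) = (\<Sum>q\<in>p1. \<bar>\<Delta> (snd q)\<bar>)"
          unfolding \<Delta>_def s_def t_def by (rule sum.reindex_bij_betw[OF h])
        finally show ?thesis by (simp add: case_prod_beta)
      qed
      have "(\<Sum>(x,k)\<in>p. measure lborel k *\<^sub>R y0 x) - (F b - F a) = (\<Sum>(x,K)\<in>p. measure lborel K * y0 x - \<Delta> K)"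
        unfolding tel[symmetric] by (simp add: sum_subtractf case_prod_beta)
      also have "\<dots> = (\<Sum>(x,K)\<in>p1. measure lborel K * y0 x - \<Delta> K) + (\<Sum>(x,K)\<in>p2. measure lborel K * y0 x - \<Delta> K)"
        by (rule split)
      also have "(\<Sum>(x,K)\<in>p1. measure lborel K * y0 x - \<Delta> K) = (\<Sum>(x,K)\<in>p1. - \<Delta> K)"
        by (rule sum.cong) (auto simp: p1_def y0_def)
      finally have "norm ((\<Sum>(x,k)\<in>p. measure lborel k *\<^sub>R y0 x) - (F b - F a)) \<le>
          \<bar>\<Sum>(x,K)\<in>p1. - \<Delta> K\<bar> + \<bar>\<Sum>(x,K)\<in>p2. measure lborel K * y0 x - \<Delta> K\<bar>"
        by simp
      also have "\<bar>\<Sum>(x,K)\<in>p1. - \<Delta> K\<bar> \<le> (\<Sum>(x,K)\<in>p1. \<bar>\<Delta> K\<bar>)"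
        by (rule order_trans[OF sum_abs]) (auto simp: case_prod_beta)
      finally show "norm (sum (\<lambda>(x,k). measure lborel k *\<^sub>R y0 x) p - (F b - F a)) < e"
        using s1 s2 by simp
    qed
  qed
  then show ?thesis
    by (rule has_integral_spike[OF N, rotated]) (auto simp: y0_def)
qed

subsection \<open>Smooth test functions and the du Bois-Reymond lemma\<close>

text \<open>\<open>test_function\<close> asks for all iterates of \<open>deriv\<close>; a class
  closed under differentiation yields them by induction on the order. In \<open>flat\<close> the
  polynomial is arbitrary because differentiation changes it, and \<open>primitive\<close> admits
  the ramp used in the tents.\<close>

inductive_set smooth_fun :: "(real \<Rightarrow> real) set" where
  const: "(\<lambda>_. c) \<in> smooth_fun"
| flat: "(\<lambda>x. if 0 < x then poly p (1 / x) * exp (- (1 / x)) else 0) \<in> smooth_fun"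
| add: "F \<in> smooth_fun \<Longrightarrow> G \<in> smooth_fun \<Longrightarrow> (\<lambda>x. F x + G x) \<in> smooth_fun"
| mult: "F \<in> smooth_fun \<Longrightarrow> G \<in> smooth_fun \<Longrightarrow> (\<lambda>x. F x * G x) \<in> smooth_fun"
| affine: "F \<in> smooth_fun \<Longrightarrow> (\<lambda>x. F (a * x + b)) \<in> smooth_fun"
| inverse: "F \<in> smooth_fun \<Longrightarrow> (\<And>x. F x \<noteq> 0) \<Longrightarrow> (\<lambda>x. 1 / F x) \<in> smooth_fun"
| primitive: "F \<in> smooth_fun \<Longrightarrow> (\<And>x. (G has_real_derivative F x) (at x)) \<Longrightarrow> G \<in> smooth_fun"

lemma poly_times_exp_neg_tendsto_0: "((\<lambda>t::real. poly q t * exp (- t)) \<longlongrightarrow> 0) at_top"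
proof -
  have "((\<lambda>t. \<Sum>i\<le>degree q. coeff q i * (t ^ i / exp t)) \<longlongrightarrow> (\<Sum>i\<le>degree q. coeff q i * 0)) at_top"
    by (intro tendsto_sum tendsto_mult tendsto_const tendsto_power_div_exp_0)
  then show ?thesis
    by (simp add: poly_altdef sum_distrib_right exp_minus divide_inverse mult.assoc)
qed

text \<open>With \<open>t = 1 / x\<close> one has \<open>dt/dx = - t^2\<close>, which turns
  \<open>p(t) exp(-t)\<close> into \<open>t^2 (p - p')(t) exp(-t)\<close>; the factor
  \<open>[:0, 0, 1:]\<close> is this \<open>t^2\<close>. At \<open>0\<close> the right difference
  quotient is \<open>t p(t) exp(-t)\<close>, which vanishes as \<open>t\<close> tends to
  infinity.\<close>

lemma flat_has_derivative:
  "((\<lambda>x. if 0 < x then poly p (1 / x) * exp (- (1 / x)) else 0) has_real_derivative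
    (if 0 < x then poly ([:0, 0, 1:] * (p - pderiv p)) (1 / x) * exp (- (1 / x)) else 0)) (at x)"
  (is "(?F has_real_derivative ?d) (at x)")
proof -
  consider "x > 0" | "x < 0" | "x = 0" by linarith
  then show ?thesis
  proof cases
    case 1
    have "((\<lambda>x. poly p (1 / x) * exp (- (1 / x))) has_real_derivative ?d) (at x)"
      using 1
      by (auto intro!: derivative_eq_intros DERIV_chain2[OF poly_DERIV]
          simp: field_simps power2_eq_square)
    then show ?thesis
      by (rule has_field_derivative_transform_within_open[of _ _ _ "{0<..}"]) (use 1 in auto)
  next
    case 2
    have "((\<lambda>x. 0) has_real_derivative ?d) (at x)" using 2 by simp
    then show ?thesis
      by (rule has_field_derivative_transform_within_open[of _ _ _ "{..<0}"]) (use 2 in auto)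
  next
    case 3
    have "((\<lambda>h. poly ([:0, 1:] * p) (inverse h) * exp (- inverse h)) \<longlongrightarrow> 0) (at_right 0)"
      by (rule filterlim_compose[OF poly_times_exp_neg_tendsto_0 filterlim_inverse_at_top_right])
    then have "((\<lambda>h. (?F h - ?F 0) / (h - 0)) \<longlongrightarrow> 0) (at_right 0)"
      by (rule Lim_transform_eventually)
        (auto simp: eventually_at_right_field field_simps intro!: exI[of _ 1])
    moreover have "((\<lambda>h. (?F h - ?F 0) / (h - 0)) \<longlongrightarrow> 0) (at_left 0)"
      by (rule Lim_transform_eventually[OF tendsto_const])
        (auto simp: eventually_at_left_field intro!: exI[of _ "-1"])
    ultimately have "((\<lambda>h. (?F h - ?F 0) / (h - 0)) \<longlongrightarrow> 0) (at 0)"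
      by (simp only: filterlim_split_at)
    then show ?thesis using 3 by (simp add: has_field_derivative_iff)
  qed
qed

lemma smooth_fun_has_derivative:
  assumes "F \<in> smooth_fun"
  shows "\<exists>F'\<in>smooth_fun. \<forall>x. (F has_real_derivative F' x) (at x)"
  using assms
proof induction
  case (const c)
  show ?case by (rule bexI[of _ "\<lambda>_. 0"]) (auto intro: smooth_fun.const)
next
  case (flat p)
  show ?case
    by (rule bexI[OF _ smooth_fun.flat[of "[:0, 0, 1:] * (p - pderiv p)"]]) (intro allI flat_has_derivative)
next
  case (add F G)
  then obtain F' G' where "F' \<in> smooth_fun" "G' \<in> smooth_fun"
    "\<forall>x. (F has_real_derivative F' x) (at x)" "\<forall>x. (G has_real_derivative G' x) (at x)" by blast
  then show ?case
    by (intro bexI[of _ "\<lambda>x. F' x + G' x"]) (auto intro!: derivative_eq_intros smooth_fun.add)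
next
  case (mult F G)
  then obtain F' G' where "F' \<in> smooth_fun" "G' \<in> smooth_fun"
    "\<forall>x. (F has_real_derivative F' x) (at x)" "\<forall>x. (G has_real_derivative G' x) (at x)" by blast
  then show ?case using mult.hyps
    by (intro bexI[of _ "\<lambda>x. F' x * G x + G' x * F x"])
      (auto intro!: derivative_eq_intros smooth_fun.add smooth_fun.mult)
next
  case (affine F a b)
  then obtain F' where "F' \<in> smooth_fun" "\<forall>x. (F has_real_derivative F' x) (at x)" by blast
  then show ?case
    by (intro bexI[of _ "\<lambda>x. F' (a * x + b) * a"] allI DERIV_chain2[where f = F])
      (auto intro!: derivative_eq_intros smooth_fun.mult smooth_fun.affine smooth_fun.const)
next
  case (inverse F)
  then obtain F' where F': "F' \<in> smooth_fun" "\<forall>x. (F has_real_derivative F' x) (at x)" by blast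
  have "(\<lambda>x. (-1) * (F' x * ((1 / F x) * (1 / F x)))) \<in> smooth_fun"
    by (intro smooth_fun.mult[OF smooth_fun.const] smooth_fun.mult F' smooth_fun.inverse inverse)
  moreover have "((\<lambda>x. 1 / F x) has_real_derivative (-1) * (F' x * ((1 / F x) * (1 / F x)))) (at x)" for x
    using F'(2) inverse(2) by (auto intro!: derivative_eq_intros simp: power2_eq_square)
  ultimately show ?case by (intro bexI[of _ "\<lambda>x. (-1) * (F' x * ((1 / F x) * (1 / F x)))"] allI)
next
  case (primitive F G)
  then show ?case by blast
qed

lemma smooth_fun_deriv_funpow: "F \<in> smooth_fun \<Longrightarrow> (deriv ^^ n) F \<in> smooth_fun"
proof (induction n arbitrary: F)
  case (Suc n)
  obtain F' where F': "F' \<in> smooth_fun" "\<forall>x. (F has_real_derivative F' x) (at x)"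
    using smooth_fun_has_derivative[OF Suc.prems] by blast
  have "deriv F = F'" using F'(2) by (auto intro: DERIV_imp_deriv)
  then show ?case using Suc.IH[OF F'(1)] by (simp add: funpow_Suc_right del: funpow.simps)
qed simp

lemma smooth_fun_differentiable:
  assumes "F \<in> smooth_fun" shows "(deriv ^^ n) F differentiable (at x)"
  using smooth_fun_has_derivative[OF smooth_fun_deriv_funpow[OF assms, of n]]
  by (metis real_differentiable_def)

lemma test_function_smooth_fun:
  assumes "F \<in> smooth_fun" "{a..b} \<subseteq> I" "\<And>x. x \<notin> {a..b} \<Longrightarrow> F x = 0"
  shows "test_function I F"
  unfolding test_function_def
  using smooth_fun_differentiable[OF assms(1)] assms(2,3) compact_Icc by blast

text \<open>The usual smooth cutoff built from \<open>exp (-1/x)\<close>; rescaled to a small width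
  it approximates a jump.\<close>

definition smooth_step :: "real \<Rightarrow> real" where
  "smooth_step x = (let b = (\<lambda>x::real. if 0 < x then exp (- (1 / x)) else 0) in b x / (b x + b (1 - x)))"

lemma smooth_step_in_smooth_fun: "smooth_step \<in> smooth_fun"
proof -
  define b where "b = (\<lambda>x::real. if 0 < x then exp (- (1 / x)) else 0)"
  have b: "b \<in> smooth_fun" using smooth_fun.flat[of 1, unfolded poly_1 mult_1] by (simp add: b_def)
  have b': "(\<lambda>x. b (1 - x)) \<in> smooth_fun"
    using smooth_fun.affine[OF b, of "-1" 1] by (simp add: algebra_simps)
  have "b x + b (1 - x) \<noteq> 0" for x
    by (auto simp: b_def add_nonneg_eq_0_iff not_less)
  then have "(\<lambda>x. b x * (1 / (b x + b (1 - x)))) \<in> smooth_fun"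
    by (intro smooth_fun.mult smooth_fun.inverse smooth_fun.add b b')
  then show ?thesis by (simp add: smooth_step_def[abs_def] b_def[symmetric] Let_def)
qed

lemma smooth_step_simps:
  "x \<le> 0 \<Longrightarrow> smooth_step x = 0" "1 \<le> x \<Longrightarrow> smooth_step x = 1"
  "0 \<le> smooth_step x" "smooth_step x \<le> 1"
proof -
  have *: "0 \<le> p / (p + q) \<and> p / (p + q) \<le> 1" if "0 \<le> p" "0 \<le> q" for p q :: real
    using that by (auto simp: divide_le_eq_1)
  show "0 \<le> smooth_step x" "smooth_step x \<le> 1"
    unfolding smooth_step_def Let_def by (rule *[THEN conjunct1] *[THEN conjunct2]; simp)+
qed (auto simp: smooth_step_def)

lemma smooth_fun_continuous_on: "F \<in> smooth_fun \<Longrightarrow> continuous_on S F"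
  using smooth_fun_has_derivative[of F]
  by (meson DERIV_isCont continuous_at_imp_continuous_on)

text \<open>The lower limit \<open>-1\<close> lies where the integrand is already \<open>0\<close>,
  so that \<open>0\<close> is an interior point for the fundamental theorem.\<close>

definition smooth_ramp :: "real \<Rightarrow> real" where
  "smooth_ramp x = integral {-1..x} smooth_step"

lemma smooth_ramp_nonpos: "x \<le> 0 \<Longrightarrow> smooth_ramp x = 0"
  unfolding smooth_ramp_def
  by (rule integral_unique, rule has_integral_is_0) (auto intro: smooth_step_simps)

lemma smooth_ramp_has_derivative: "(smooth_ramp has_real_derivative smooth_step x) (at x)"
proof (cases "x < 0")
  case True
  have "((\<lambda>_. 0) has_real_derivative smooth_step x) (at x)" using True by (simp add: smooth_step_simps)
  then show ?thesis
    by (rule has_field_derivative_transform_within_open[of _ _ _ "{..<0}"])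
      (use True in \<open>auto simp: smooth_ramp_nonpos\<close>)
next
  case False
  have "((\<lambda>u. integral {-1..u} smooth_step) has_real_derivative smooth_step x) (at x within {-1..x+1})"
    by (rule integral_has_real_derivative)
      (use False in \<open>auto intro: smooth_fun_continuous_on smooth_step_in_smooth_fun\<close>)
  moreover have "at x within {-1..x+1} = at x"
    by (rule at_within_interior) (use False in auto)
  ultimately show ?thesis unfolding smooth_ramp_def[abs_def] by simp
qed

lemma smooth_ramp_in_smooth_fun: "smooth_ramp \<in> smooth_fun"
  using smooth_fun.primitive[OF smooth_step_in_smooth_fun smooth_ramp_has_derivative] .

lemma smooth_ramp_ge1:
  assumes "1 \<le> x" shows "smooth_ramp x = x - 1 + smooth_ramp 1"
proof (cases "x = 1")
  case False
  have "\<exists>z. 1 < z \<and> z < x \<and> smooth_ramp x - smooth_ramp 1 = (x - 1) * smooth_step z"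
    by (rule MVT2) (use assms False smooth_ramp_has_derivative in auto)
  then show ?thesis by (auto simp: smooth_step_simps)
qed simp

lemma integral_times_indicator_gt:
  fixes W :: "real \<Rightarrow> real"
  assumes W: "W integrable_on {s..b}" and q: "s \<le> q" "q \<le> b"
  shows "((\<lambda>x. W x * (if q < x then 1 else 0)) has_integral integral {q..b} W) {s..b}"
proof -
  have "((\<lambda>x. W x * (if q < x then 1 else 0)) has_integral 0) {s..q}"
    by (rule has_integral_is_0) auto
  moreover have "((\<lambda>x. W x * (if q < x then 1 else 0)) has_integral integral {q..b} W) {q..b}"
    by (rule has_integral_spike_finite[of "{q}"])
      (use q in \<open>auto intro!: integrable_integral integrable_on_subinterval[OF W]\<close>)
  ultimately show ?thesis
    using has_integral_combine[OF q, of "\<lambda>x. W x * (if q < x then 1 else 0)" 0] by simp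
qed

text \<open>The test function is a smoothed tent with corners \<open>s\<close>, \<open>m\<close>, \<open>t\<close>; its derivative converges
  pointwise to a step function.\<close>

lemma du_bois_reymond_three_points:
  fixes W :: "real \<Rightarrow> real"
  assumes W: "W absolutely_integrable_on {s..b}" and ord: "s < m" "m < t" "t < b"
    and weak: "\<And>\<psi> \<psi>'. \<psi> \<in> smooth_fun \<Longrightarrow> \<psi>' \<in> smooth_fun \<Longrightarrow>
      (\<And>x. (\<psi> has_real_derivative \<psi>' x) (at x)) \<Longrightarrow>
      (\<And>x. x \<notin> {s<..<b} \<Longrightarrow> \<psi> x = 0) \<Longrightarrow> integral {s..b} (\<lambda>x. W x * \<psi>' x) = 0"
  shows "(t - m) * integral {s..b} W - (t - s) * integral {m..b} W + (m - s) * integral {t..b} W = 0"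
proof -
  \<comment> \<open>With width at most \<open>b - t\<close> even the last corner \<open>t\<close> is
    rounded off before \<open>b\<close>, so the support stays in \<open>[s, b]\<close>.\<close>
  define e where "e = (\<lambda>n::nat. (b - t) / (real n + 1))"
  have e: "0 < e n" "e n \<le> b - t" for n
    using ord mult_nonneg_nonneg[of "real n" "b - t"] by (auto simp: e_def field_simps)
  have elim: "e \<longlonglongrightarrow> 0"
    unfolding e_def using lim_const_over_n[of "b - t"]
    by (metis (no_types, lifting) LIMSEQ_Suc ext of_nat_Suc add.commute)
  \<comment> \<open>The three weights sum to \<open>0\<close>, and so do the weights times the
    corners. Beyond \<open>b\<close>, where all ramps are affine with the same slope, the
    combination therefore vanishes.\<close>
  define \<psi> where "\<psi> = (\<lambda>n x. e n * ((t - m) * smooth_ramp ((x - s) / e n)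
    - (t - s) * smooth_ramp ((x - m) / e n) + (m - s) * smooth_ramp ((x - t) / e n)))"
  define \<psi>' where "\<psi>' = (\<lambda>n x. (t - m) * smooth_step ((x - s) / e n)
    - (t - s) * smooth_step ((x - m) / e n) + (m - s) * smooth_step ((x - t) / e n))"
  have sm: "(\<lambda>x. F ((x - q) / e n)) \<in> smooth_fun" if "F \<in> smooth_fun" for F q n
    using smooth_fun.affine[OF that, of "1 / e n" "- q / e n"] e(1)[of n]
    by (simp add: field_simps)
  have neg: "(\<lambda>x. F x - G x) \<in> smooth_fun" if "F \<in> smooth_fun" "G \<in> smooth_fun" for F G
    using smooth_fun.add[OF that(1) smooth_fun.mult[OF smooth_fun.const[of "-1"] that(2)]] by simp
  have 1: "\<psi> n \<in> smooth_fun" for n unfolding \<psi>_def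
    by (intro smooth_fun.mult[OF smooth_fun.const] smooth_fun.add neg sm smooth_ramp_in_smooth_fun)
  have 2: "\<psi>' n \<in> smooth_fun" for n unfolding \<psi>'_def
    by (intro smooth_fun.mult[OF smooth_fun.const] smooth_fun.add neg sm smooth_step_in_smooth_fun)
  have 3: "(\<psi> n has_real_derivative \<psi>' n x) (at x)" for n x
  proof -
    have *: "((\<lambda>x. smooth_ramp ((x - q) / e n)) has_real_derivative smooth_step ((x - q) / e n) * (1 / e n)) (at x)" for q
      by (rule DERIV_chain2[OF smooth_ramp_has_derivative])
        (use e(1)[of n] in \<open>auto intro!: derivative_eq_intros\<close>)
    show ?thesis unfolding \<psi>_def \<psi>'_def
      by (rule derivative_eq_intros * refl)+ (use e(1)[of n] in \<open>simp add: field_simps\<close>)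
  qed
  have 4: "\<psi> n x = 0" if "x \<notin> {s<..<b}" for n x
  proof (cases "x \<le> s")
    case True
    then show ?thesis using ord e(1)[of n]
      by (simp add: \<psi>_def smooth_ramp_nonpos divide_le_0_iff)
  next
    case False
    then have "b \<le> x" using that by simp
    then have *: "smooth_ramp ((x - q) / e n) = (x - q) / e n - 1 + smooth_ramp 1" if "q \<le> t" for q
      by (intro smooth_ramp_ge1) (use e[of n] that in \<open>simp add: field_simps\<close>)
    show ?thesis unfolding \<psi>_def
      using ord e(1)[of n] by (simp add: *) (simp add: field_simps)
  qed
  have zero: "integral {s..b} (\<lambda>x. W x * \<psi>' n x) = 0" for n by (rule weak[OF 1 2 3 4])
  \<comment> \<open>The limit of the derivatives: slope \<open>t - m\<close> on
    \<open>(s, m)\<close>, slope \<open>- (m - s)\<close> on \<open>(m, t)\<close>, and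
    \<open>0\<close> afterwards.\<close>
  define L where "L = (\<lambda>x::real. (t - m) * (if s < x then 1 else 0) - (t - s) * (if m < x then 1 else 0)
    + (m - s) * (if t < x then 1 else 0))"
  have Wi: "W integrable_on {s..b}" using W by (rule set_lebesgue_integral_eq_integral(1))
  have lim1: "(\<lambda>n. smooth_step ((x - q) / e n)) \<longlonglongrightarrow> (if q < x then 1 else 0)" for x q
  proof (cases "q < x")
    case True
    have "\<forall>\<^sub>F n in sequentially. e n < x - q"
      using order_tendstoD(2)[OF elim, of "x - q"] True by simp
    then have "\<forall>\<^sub>F n in sequentially. smooth_step ((x - q) / e n) = 1"
      by eventually_elim (use e(1) in \<open>auto intro!: smooth_step_simps simp: field_simps\<close>)
    then show ?thesis using True by (simp add: tendsto_eventually)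
  next
    case False
    then have "smooth_step ((x - q) / e n) = 0" for n
      using e(1)[of n] by (intro smooth_step_simps) (simp add: divide_le_0_iff)
    then show ?thesis using False by simp
  qed
  have conv: "(\<lambda>n. integral {s..b} (\<lambda>x. W x * \<psi>' n x)) \<longlonglongrightarrow> integral {s..b} (\<lambda>x. W x * L x)"
  proof (rule dominated_convergence(2)[where h = "\<lambda>x. \<bar>W x\<bar> * (2 * (t - s))"])
    show "(\<lambda>x. W x * \<psi>' n x) integrable_on {s..b}" for n
    proof (rule set_lebesgue_integral_eq_integral(1))
      have c: "continuous_on {s..b} (\<psi>' n)" by (rule smooth_fun_continuous_on[OF 2])
      have "(\<lambda>x. \<psi>' n x * W x) absolutely_integrable_on {s..b}"
        by (rule absolutely_integrable_bounded_measurable_product_real[OF _ _ _ W])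
          (auto intro!: compact_imp_bounded compact_continuous_image c
            continuous_imp_measurable_on_sets_lebesgue)
      then show "(\<lambda>x. W x * \<psi>' n x) absolutely_integrable_on {s..b}" by (simp add: mult.commute)
    qed
    show "(\<lambda>x. \<bar>W x\<bar> * (2 * (t - s))) integrable_on {s..b}"
      using W by (intro integrable_on_mult_left) (simp add: absolutely_integrable_on_def)
    show "norm (W x * \<psi>' n x) \<le> \<bar>W x\<bar> * (2 * (t - s))" for n x
    proof -
      have st: "0 \<le> smooth_step y \<and> smooth_step y \<le> 1" for y by (simp add: smooth_step_simps)
      have b: "0 \<le> k * smooth_step y \<and> k * smooth_step y \<le> k" if "0 \<le> k" for k y
        using st[of y] that by (simp add: mult_left_le)
      have "\<bar>\<psi>' n x\<bar> \<le> 2 * (t - s)"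
      proof -
        have "0 \<le> t - m" "0 \<le> t - s" "0 \<le> m - s" using ord by auto
        note b[OF this(1), of "(x - s) / e n"] b[OF this(2), of "(x - m) / e n"]
          b[OF this(3), of "(x - t) / e n"]
        moreover have "\<bar>A - B + C\<bar> \<le> 2 * (t - s)"
          if "0 \<le> A \<and> A \<le> t - m" "0 \<le> B \<and> B \<le> t - s" "0 \<le> C \<and> C \<le> m - s" for A B C
          using that ord by auto
        ultimately show ?thesis unfolding \<psi>'_def by blast
      qed
      then show ?thesis by (simp add: abs_mult mult_left_mono)
    qed
    show "(\<lambda>n. W x * \<psi>' n x) \<longlonglongrightarrow> W x * L x" for x
      unfolding \<psi>'_def L_def by (intro tendsto_intros lim1)
  qed
  have "((\<lambda>x. (t - m) * (W x * (if s < x then 1 else 0)) - (t - s) * (W x * (if m < x then 1 else 0))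
      + (m - s) * (W x * (if t < x then 1 else 0))) has_integral
      (t - m) * integral {s..b} W - (t - s) * integral {m..b} W + (m - s) * integral {t..b} W) {s..b}"
    by (intro has_integral_add has_integral_diff has_integral_mult_right integral_times_indicator_gt[OF Wi])
      (use ord in auto)
  then have "integral {s..b} (\<lambda>x. W x * L x) =
      (t - m) * integral {s..b} W - (t - s) * integral {m..b} W + (m - s) * integral {t..b} W"
    by (intro integral_unique) (simp add: L_def algebra_simps)
  moreover have "integral {s..b} (\<lambda>x. W x * L x) = 0"
    using LIMSEQ_unique[OF conv] by (simp add: zero)
  ultimately show ?thesis by simp
qed

subsection \<open>The flux of a weak profile\<close>

lemma open_interval_Icc_subset:
  fixes J :: "real set"
  assumes "is_interval J" "a \<in> J" "b \<in> J" shows "{a..b} \<subseteq> J"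
  using assms by (meson atLeastAtMost_iff mem_is_interval_1_I subsetI)

lemma open_interval_enclose:
  fixes J :: "real set"
  assumes "open J" "is_interval J" "x \<in> J" "y \<in> J"
  obtains a b where "a < x" "a < y" "x < b" "y < b" "{a..b} \<subseteq> J"
proof -
  have mM: "min x y \<in> J" "max x y \<in> J" using assms by (auto simp: min_def max_def)
  obtain d where d: "0 < d" "ball (min x y) d \<subseteq> J" using assms(1) mM open_contains_ball by blast
  obtain e where e: "0 < e" "ball (max x y) e \<subseteq> J" using assms(1) mM open_contains_ball by blast
  have "min x y - d/2 \<in> ball (min x y) d" "max x y + e/2 \<in> ball (max x y) e"
    using d e by (auto simp: dist_real_def)
  then have "{min x y - d/2 .. max x y + e/2} \<subseteq> J"
    using d e by (intro open_interval_Icc_subset assms) auto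
  then show ?thesis using that[of "min x y - d/2" "max x y + e/2"] d e by auto
qed

lemma ftc_real:
  fixes G G' :: "real \<Rightarrow> real"
  assumes "a \<le> b" "\<And>x. x \<in> {a..b} \<Longrightarrow> (G has_real_derivative G' x) (at x)"
  shows "(G' has_integral (G b - G a)) {a..b}"
  using assms(1)
  by (rule fundamental_theorem_of_calculus)
    (metis assms(2) has_field_derivative_at_within has_real_derivative_iff_has_vector_derivative)

lemma continuous_on_open_interval_primitive:
  fixes J :: "real set" and \<phi> :: "real \<Rightarrow> real"
  assumes J: "open J" "is_interval J" and cont: "continuous_on J \<phi>"
  obtains \<Phi> where "\<And>x. x \<in> J \<Longrightarrow> (\<Phi> has_real_derivative \<phi> x) (at x)"
proof (cases "J = {}")
  case False
  then obtain p where p: "p \<in> J" by auto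
  define \<Phi> where "\<Phi> = (\<lambda>x. if p \<le> x then integral {p..x} \<phi> else - integral {x..p} \<phi>)"
  have "(\<Phi> has_real_derivative \<phi> x) (at x)" if x: "x \<in> J" for x
  proof -
    obtain a b where ab: "a < x" "a < p" "x < b" "p < b" "{a..b} \<subseteq> J"
      using open_interval_enclose[OF J x p] by blast
    have cab: "continuous_on {a..b} \<phi>" using cont ab(5) by (rule continuous_on_subset)
    have int: "\<phi> integrable_on {c..d}" if "a \<le> c" "d \<le> b" for c d
      by (rule integrable_continuous_real) (use cab that in \<open>auto intro: continuous_on_subset\<close>)
    have eq: "integral {a..y} \<phi> - integral {a..p} \<phi> = \<Phi> y" if "y \<in> {a<..<b}" for y
    proof (cases "p \<le> y")
      case True
      then show ?thesis using Henstock_Kurzweil_Integration.integral_combine[OF _ True int[of a y]] ab that by (auto simp: \<Phi>_def)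
    next
      case False
      then show ?thesis using Henstock_Kurzweil_Integration.integral_combine[OF _ _ int[of a p], of y] ab that by (auto simp: \<Phi>_def)
    qed
    have "((\<lambda>y. integral {a..y} \<phi>) has_real_derivative \<phi> x) (at x within {a..b})"
      by (rule integral_has_real_derivative) (use ab cab in auto)
    then have "((\<lambda>y. integral {a..y} \<phi>) has_real_derivative \<phi> x) (at x)"
      using ab by (simp add: at_within_Icc_at)
    then have "((\<lambda>y. integral {a..y} \<phi> - integral {a..p} \<phi>) has_real_derivative \<phi> x) (at x)"
      by (auto intro!: derivative_eq_intros)
    then show ?thesis
      by (rule has_field_derivative_transform_within_open[of _ _ _ "{a<..<b}"]) (use ab eq in auto)
  qed
  then show ?thesis by (rule that)
qed (use that in auto)

text \<open>The identity places \<open>V m\<close> on the chord over \<open>[s, t]\<close>. Two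
  fixed points \<open>p < q\<close> determine the line, and every position of a third point relative
  to them is one instance.\<close>

lemma affine_if_three_points:
  fixes V :: "real \<Rightarrow> real"
  assumes J: "open J" "is_interval J" "J \<noteq> {}"
    and three: "\<And>s m t. s \<in> J \<Longrightarrow> t \<in> J \<Longrightarrow> s < m \<Longrightarrow> m < t \<Longrightarrow>
      (t - m) * V s - (t - s) * V m + (m - s) * V t = 0"
  obtains \<alpha> \<kappa> where "\<And>x. x \<in> J \<Longrightarrow> V x = \<alpha> + \<kappa> * x"
proof -
  obtain p where p: "p \<in> J" using J by auto
  obtain a q where q: "p < q" "{a..q} \<subseteq> J" "a < p"
    using open_interval_enclose[OF J(1,2) p p] by metis
  then have qJ: "q \<in> J" by auto
  define \<kappa> where "\<kappa> = (V q - V p) / (q - p)"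
  have k: "\<kappa> * (q - p) = V q - V p" using q by (simp add: \<kappa>_def)
  have "V x = V p - \<kappa> * p + \<kappa> * x" if x: "x \<in> J" for x
  proof -
    consider "x < p" | "x = p" | "p < x" "x < q" | "x = q" | "q < x" by linarith
    then have "(q - p) * (V x - V p) = (V q - V p) * (x - p)"
    proof cases
      case 1
      show ?thesis using three[OF x qJ 1 q(1)] by (simp add: algebra_simps)
    next
      case 3
      show ?thesis using three[OF p qJ 3] by (simp add: algebra_simps)
    next
      case 5
      show ?thesis using three[OF p x q(1) 5] by (simp add: algebra_simps)
    qed auto
    then have "(q - p) * (V x - V p) = (q - p) * (\<kappa> * (x - p))" unfolding k[symmetric] by simp
    then have "V x - V p = \<kappa> * (x - p)" using q by (subst (asm) mult_left_cancel) auto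
    then show ?thesis by (simp add: algebra_simps)
  qed
  then show ?thesis by (rule that)
qed

section \<open>The data of the problem and the pointwise form of the weak equation\<close>

locale rd_data =
  fixes R c :: real and f h D g :: "real \<Rightarrow> real"
  assumes R_pos: "0 < R"
    and data: "flux_source_data R f h g"
    and D_cont: "continuous_on {0..R} D" and D_R: "D R = 0"
    and D_pos: "\<And>\<rho>. 0 < \<rho> \<Longrightarrow> \<rho> < R \<Longrightarrow> 0 < D \<rho>"
begin

text \<open>The flux seen from the frame moving with speed \<open>c\<close>; the profile equation
  becomes \<open>(D(\<phi>) \<phi>' - F(\<phi>))' = - g(\<phi>)\<close>.\<close>

definition F :: "real \<Rightarrow> real" where "F s = f s - c * s"

text \<open>The Kirchhoff transform of the diffusion. Composed with a weak profile it is
  differentiable even where the profile has a corner, since there the slope is weighted by a zero of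
  \<open>D\<close>.\<close>

definition P :: "real \<Rightarrow> real" where "P s = integral {0..s} D"

lemma g_cont: "continuous_on {0..R} g" and g_pos: "0 \<le> \<rho> \<Longrightarrow> \<rho> < R \<Longrightarrow> 0 < g \<rho>" and g_R: "g R = 0"
  using data by (auto simp: flux_source_data_def)

lemma g_nonneg: "0 \<le> \<rho> \<Longrightarrow> \<rho> \<le> R \<Longrightarrow> 0 \<le> g \<rho>"
  using g_pos[of \<rho>] g_R by (cases "\<rho> = R") auto

lemma h_cont: "continuous_on {0..R} h"
  using data by (auto simp: flux_source_data_def C1_on_def)

lemma h_bounded: obtains A where "0 \<le> A" "\<And>s. s \<in> {0..R} \<Longrightarrow> \<bar>h s - c\<bar> \<le> A"
  using abs_bounded_on_Icc[of 0 R "\<lambda>s. h s - c"] continuous_on_diff[OF h_cont continuous_on_const] by metis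

lemma f_deriv: "s \<in> {0..R} \<Longrightarrow> (f has_real_derivative h s) (at s within {0..R})"
  using data by (auto simp: flux_source_data_def C1_on_def)

lemma f_cont: "continuous_on {0..R} f"
  by (rule DERIV_continuous_on[OF f_deriv])

lemma F_cont: "continuous_on {0..R} F"
  unfolding F_def[abs_def] by (intro continuous_intros f_cont)

lemma F_deriv: "0 < s \<Longrightarrow> s < R \<Longrightarrow> (F has_real_derivative h s - c) (at s)"
proof -
  assume s: "0 < s" "s < R"
  then have "(f has_real_derivative h s) (at s)"
    using f_deriv[of s] by (simp add: at_within_Icc_at)
  then show ?thesis
    unfolding F_def[abs_def] by (auto intro!: derivative_eq_intros)
qed

lemma D_nonneg: assumes "0 \<le> \<rho>" "\<rho> \<le> R" shows "0 \<le> D \<rho>"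
proof -
  have cl: "closure {0<..<R} = {0..R}" using R_pos by (rule closure_greaterThanLessThan)
  have c: "continuous_on (closure {0<..<R}) D" unfolding cl by (rule D_cont)
  have m: "\<rho> \<in> closure {0<..<R}" unfolding cl using assms by simp
  have p: "0 \<le> D x" if "x \<in> {0<..<R}" for x
    using D_pos[of x] that by simp
  show ?thesis by (rule continuous_ge_on_closure[OF c m p])
qed

lemma D_int: "0 \<le> a \<Longrightarrow> b \<le> R \<Longrightarrow> D integrable_on {a..b}"
  by (rule integrable_continuous_real) (auto intro: continuous_on_subset[OF D_cont])

lemma P_deriv_within: "s \<in> {0..R} \<Longrightarrow> (P has_real_derivative D s) (at s within {0..R})"
  unfolding P_def[abs_def] by (rule integral_has_real_derivative[OF D_cont])

lemma P_deriv: "0 < s \<Longrightarrow> s < R \<Longrightarrow> (P has_real_derivative D s) (at s)"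
  using P_deriv_within[of s] by (simp add: at_within_Icc_at)

lemma P_0: "P 0 = 0" by (simp add: P_def)

lemma P_mono: "0 \<le> s \<Longrightarrow> s \<le> t \<Longrightarrow> t \<le> R \<Longrightarrow> P s \<le> P t"
  unfolding P_def by (rule integral_subset_le) (auto intro!: D_int D_nonneg)

lemma P_nonneg: "0 \<le> s \<Longrightarrow> s \<le> R \<Longrightarrow> 0 \<le> P s"
  using P_mono[of 0 s] P_0 by simp

text \<open>Two integrations make the weak equation pointwise. With the primitive
  \<open>\<Phi>1\<close> of \<open>g(\<theta>)\<close> it says that \<open>W\<close> is orthogonal
  to all derivatives of test functions, so du Bois-Reymond makes the primitive \<open>V\<close> of
  \<open>W\<close> affine. Solving for \<open>P(\<theta>)\<close> exhibits it as an affine function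
  minus \<open>\<Phi>2\<close>, differentiable everywhere, whereas \<open>y\<close> was only known
  almost everywhere.\<close>

lemma weak_profile_flux:
  assumes tw: "tw_profile R f D g c J \<theta>"
  obtains Y where "\<And>\<xi>. \<xi> \<in> J \<Longrightarrow> ((\<lambda>\<xi>. P (\<theta> \<xi>)) has_real_derivative Y \<xi>) (at \<xi>)"
    and "\<And>\<xi>. \<xi> \<in> J \<Longrightarrow> ((\<lambda>\<xi>. Y \<xi> - F (\<theta> \<xi>)) has_real_derivative - g (\<theta> \<xi>)) (at \<xi>)"
proof -
  have J: "open J" "is_interval J" "J \<noteq> {}" and range: "\<And>\<xi>. \<xi> \<in> J \<Longrightarrow> \<theta> \<xi> \<in> {0..R}"
    and \<theta>_cont: "continuous_on J \<theta>"
    using tw by (auto simp: tw_profile_def)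
  define y where "y = (\<lambda>\<xi>. D (\<theta> \<xi>) * deriv \<theta> \<xi>)"
  have F\<theta>: "continuous_on J (\<lambda>\<xi>. F (\<theta> \<xi>))" and g\<theta>: "continuous_on J (\<lambda>\<xi>. g (\<theta> \<xi>))"
    using \<theta>_cont range by (auto intro!: continuous_on_compose2[OF F_cont] continuous_on_compose2[OF g_cont])
  obtain \<Phi>1 where \<Phi>1: "\<And>x. x \<in> J \<Longrightarrow> (\<Phi>1 has_real_derivative g (\<theta> x)) (at x)"
    using continuous_on_open_interval_primitive[OF J(1,2) g\<theta>] by blast
  have \<Phi>1_cont: "continuous_on J \<Phi>1"
    using \<Phi>1 by (meson DERIV_isCont continuous_at_imp_continuous_on)
  have "continuous_on J (\<lambda>\<xi>. - F (\<theta> \<xi>) + \<Phi>1 \<xi>)" by (intro continuous_intros F\<theta> \<Phi>1_cont)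
  then obtain \<Phi>2 where \<Phi>2: "\<And>x. x \<in> J \<Longrightarrow> (\<Phi>2 has_real_derivative - F (\<theta> x) + \<Phi>1 x) (at x)"
    using continuous_on_open_interval_primitive[OF J(1,2)] by blast
  define V where "V = (\<lambda>\<xi>. P (\<theta> \<xi>) + \<Phi>2 \<xi>)"
  define W where "W = (\<lambda>\<xi>. y \<xi> + (- F (\<theta> \<xi>) + \<Phi>1 \<xi>))"
  define N where "N = {\<xi> \<in> J. \<not> \<theta> differentiable (at \<xi>)}"
  have "AE \<xi> in lebesgue. \<xi> \<in> J \<longrightarrow> \<theta> differentiable (at \<xi>)" using tw by (simp add: tw_profile_def)
  from negligible_if_AE[OF this] have N: "negligible N" by (simp add: N_def)
  have yabs: "y absolutely_integrable_on {a..b}" if "{a..b} \<subseteq> J" for a b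
    using tw that by (auto simp: tw_profile_def y_def)
  have Wabs: "W absolutely_integrable_on {a..b}" if ab: "{a..b} \<subseteq> J" for a b
    unfolding W_def
    by (intro set_integral_add(1) yabs ab absolutely_integrable_continuous_real continuous_intros
        continuous_on_subset[OF F\<theta> ab] continuous_on_subset[OF \<Phi>1_cont ab])
  have WV: "(W has_integral V b - V a) {a..b}" if ab: "a \<le> b" "{a..b} \<subseteq> J" for a b
  proof -
    have "(y has_integral P (\<theta> b) - P (\<theta> a)) {a..b}"
    proof (rule abs_continuous_on_has_integral[OF _ ab(1) N])
      \<comment> \<open>Here the regularity built into \<open>tw_profile\<close> enters: it excludes
        a singular part and lets the a.e. derivative \<open>y\<close> recover the increments of
        \<open>P(\<theta>)\<close>.\<close>
      show "abs_continuous_on {a..b} (\<lambda>\<xi>. P (\<theta> \<xi>))"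
        using tw ab by (auto simp: tw_profile_def loc_abs_continuous_on_def P_def)
      show "((\<lambda>\<xi>. P (\<theta> \<xi>)) has_real_derivative y x) (at x within {a..b})" if "x \<in> {a..b} - N" for x
      proof -
        have x: "x \<in> J" "\<theta> differentiable (at x)" using that ab by (auto simp: N_def)
        then have "(\<theta> has_real_derivative deriv \<theta> x) (at x within {a..b})"
          by (metis DERIV_deriv_iff_real_differentiable has_field_derivative_at_within)
        moreover have "(P has_real_derivative D (\<theta> x)) (at (\<theta> x) within \<theta> ` {a..b})"
          by (rule DERIV_subset[OF P_deriv_within]) (use range x ab in auto)
        ultimately show ?thesis
          unfolding y_def by (rule DERIV_image_chain[unfolded o_def, rotated])
      qed
    qed
    moreover have "((\<lambda>\<xi>. - F (\<theta> \<xi>) + \<Phi>1 \<xi>) has_integral \<Phi>2 b - \<Phi>2 a) {a..b}"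
      using ab(2) by (intro ftc_real[OF ab(1)] \<Phi>2) auto
    ultimately have "(W has_integral (P (\<theta> b) - P (\<theta> a)) + (\<Phi>2 b - \<Phi>2 a)) {a..b}"
      unfolding W_def by (rule has_integral_add)
    then show ?thesis by (simp add: V_def algebra_simps)
  qed
  have weak: "integral {s..b} (\<lambda>x. W x * \<psi>' x) = 0"
    if sb: "s < b" "{s..b} \<subseteq> J" and \<psi>: "\<psi> \<in> smooth_fun" "\<psi>' \<in> smooth_fun"
      and d: "\<And>x. (\<psi> has_real_derivative \<psi>' x) (at x)"
      and z: "\<And>x. x \<notin> {s<..<b} \<Longrightarrow> \<psi> x = 0" for s b \<psi> \<psi>'
  proof -
    have tf: "test_function J \<psi>"
      by (rule test_function_smooth_fun[OF \<psi>(1) sb(2)]) (use z in auto)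
    have dv: "deriv \<psi> x = \<psi>' x" for x by (rule DERIV_imp_deriv[OF d])
    have z': "\<psi>' x = 0" if "x \<notin> {s..b}" for x
    proof -
      have "((\<lambda>_. 0) has_real_derivative 0) (at x)" by simp
      then have "(\<psi> has_real_derivative 0) (at x)"
        by (rule has_field_derivative_transform_within_open[of _ _ _ "- {s..b}"]) (use that z in auto)
      then show ?thesis using d DERIV_unique by blast
    qed
    define q where "q = (\<lambda>\<xi>. (y \<xi> - F (\<theta> \<xi>)) * \<psi>' \<xi> - g (\<theta> \<xi>) * \<psi> \<xi>)"
    have c\<psi>: "continuous_on {s..b} \<psi>" "continuous_on {s..b} \<psi>'"
      using \<psi> by (auto intro: smooth_fun_continuous_on)
    have times: "(\<lambda>\<xi>. k \<xi> * \<psi>' \<xi>) absolutely_integrable_on {s..b}"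
      if "k absolutely_integrable_on {s..b}" for k :: "real \<Rightarrow> real"
    proof -
      have "(\<lambda>x. \<psi>' x * k x) absolutely_integrable_on {s..b}"
        by (rule absolutely_integrable_bounded_measurable_product_real[OF _ _ _ that])
          (auto intro!: compact_imp_bounded compact_continuous_image c\<psi>
            continuous_imp_measurable_on_sets_lebesgue)
      then show ?thesis by (simp add: mult.commute)
    qed
    have qabs: "q absolutely_integrable_on {s..b}"
      unfolding q_def
      by (intro set_integral_diff(1) times yabs sb absolutely_integrable_continuous_real continuous_intros
          continuous_on_subset[OF F\<theta> sb(2)] continuous_on_subset[OF g\<theta> sb(2)] c\<psi>)
    have "(LINT \<xi>:J|lebesgue. q \<xi>) = 0"
    proof -
      have "(LINT \<xi>:J|lebesgue. (D (\<theta> \<xi>) * deriv \<theta> \<xi> - f (\<theta> \<xi>) + c * \<theta> \<xi>) * deriv \<psi> \<xi> - g (\<theta> \<xi>) * \<psi> \<xi>) = 0"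
        using tw tf unfolding tw_profile_def by blast
      then show ?thesis unfolding q_def y_def F_def dv by (simp add: diff_diff_eq2 diff_add_eq)
    qed
    also have "(LINT \<xi>:J|lebesgue. q \<xi>) = (LINT \<xi>:{s..b}|lebesgue. q \<xi>)"
      unfolding set_lebesgue_integral_def
      by (rule Bochner_Integration.integral_cong)
        (use sb z z' in \<open>auto simp: indicator_def q_def\<close>)
    also have "\<dots> = integral {s..b} q" by (rule set_lebesgue_integral_eq_integral(2)[OF qabs])
    finally have "(q has_integral 0) {s..b}"
      using set_lebesgue_integral_eq_integral(1)[OF qabs] by (metis integrable_integral)
    \<comment> \<open>Integration by parts: \<open>\<Phi>1 \<psi>\<close> vanishes at both ends, so
      \<open>- g(\<theta>) \<psi>\<close> may be exchanged for
      \<open>\<Phi>1 \<psi>'\<close>.\<close>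
    moreover have "((\<lambda>\<xi>. \<Phi>1 \<xi> * \<psi>' \<xi> + g (\<theta> \<xi>) * \<psi> \<xi>) has_integral \<Phi>1 b * \<psi> b - \<Phi>1 s * \<psi> s) {s..b}"
    proof (rule ftc_real)
      show "s \<le> b" using sb by simp
      fix x assume "x \<in> {s..b}"
      then have "(\<Phi>1 has_real_derivative g (\<theta> x)) (at x)" using sb by (intro \<Phi>1) auto
      then show "((\<lambda>\<xi>. \<Phi>1 \<xi> * \<psi> \<xi>) has_real_derivative \<Phi>1 x * \<psi>' x + g (\<theta> x) * \<psi> x) (at x)"
        using d[of x] by (auto intro!: derivative_eq_intros)
    qed
    ultimately have "((\<lambda>\<xi>. q \<xi> + (\<Phi>1 \<xi> * \<psi>' \<xi> + g (\<theta> \<xi>) * \<psi> \<xi>)) has_integral 0 + 0) {s..b}"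
      using z[of s] z[of b] by (intro has_integral_add) auto
    then show ?thesis
      by (intro integral_unique) (simp add: q_def W_def algebra_simps)
  qed
  have three: "(t - m) * V s - (t - s) * V m + (m - s) * V t = 0"
    if st: "s \<in> J" "t \<in> J" and ord: "s < m" "m < t" for s m t
  proof -
    obtain a b where ab: "t < b" "{a..b} \<subseteq> J" "a < s"
      using open_interval_enclose[OF J(1,2) st(1,2)] by metis
    have sb: "{s..b} \<subseteq> J" using ab by auto
    have sub: "integral {q..b} W = V b - V q" if "s \<le> q" "q \<le> t" for q
      by (rule integral_unique, rule WV) (use that ab sb in auto)
    have "(t - m) * integral {s..b} W - (t - s) * integral {m..b} W + (m - s) * integral {t..b} W = 0"
      by (rule du_bois_reymond_three_points[OF Wabs[OF sb] ord ab(1)], rule weak[OF _ sb])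
        (use ab ord in \<open>linarith | blast\<close>)+
    then show ?thesis
      using ord by (simp add: sub algebra_simps)
  qed
  obtain \<alpha> \<kappa> where \<kappa>: "\<And>x. x \<in> J \<Longrightarrow> V x = \<alpha> + \<kappa> * x"
    by (rule affine_if_three_points[OF J, of V]) (erule (3) three, rule that)
  define Y where "Y = (\<lambda>\<xi>. \<kappa> + F (\<theta> \<xi>) - \<Phi>1 \<xi>)"
  show ?thesis
  proof
    fix \<xi> assume \<xi>: "\<xi> \<in> J"
    have "((\<lambda>\<xi>. \<alpha> + \<kappa> * \<xi> - \<Phi>2 \<xi>) has_real_derivative Y \<xi>) (at \<xi>)"
      unfolding Y_def using \<Phi>2[OF \<xi>] by (auto intro!: derivative_eq_intros)
    then show "((\<lambda>\<xi>. P (\<theta> \<xi>)) has_real_derivative Y \<xi>) (at \<xi>)"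
      by (rule has_field_derivative_transform_within_open[OF _ J(1) \<xi>])
        (use \<kappa> in \<open>auto simp: V_def algebra_simps\<close>)
    show "((\<lambda>\<xi>. Y \<xi> - F (\<theta> \<xi>)) has_real_derivative - g (\<theta> \<xi>)) (at \<xi>)"
      unfolding Y_def using \<Phi>1[OF \<xi>] by (auto intro!: derivative_eq_intros)
  qed
qed

end

subsection \<open>Comparison of a profile with a trajectory\<close>

text \<open>The first-order system extracted from the weak formulation. \<open>Y\<close> is the
  continuous version of \<open>D(\<theta>) \<theta>'\<close> and has a value also where
  \<open>\<theta>\<close> has no derivative.\<close>

locale flux_profile = rd_data +
  fixes J :: "real set" and \<theta> Y :: "real \<Rightarrow> real"
  assumes J: "open J" "is_interval J"
    and \<theta>_range: "\<And>\<xi>. \<xi> \<in> J \<Longrightarrow> \<theta> \<xi> \<in> {0..R}"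
    and \<theta>_cont: "continuous_on J \<theta>"
    and P_\<theta>: "\<And>\<xi>. \<xi> \<in> J \<Longrightarrow> ((\<lambda>\<xi>. P (\<theta> \<xi>)) has_real_derivative Y \<xi>) (at \<xi>)"
    and Y_F: "\<And>\<xi>. \<xi> \<in> J \<Longrightarrow> ((\<lambda>\<xi>. Y \<xi> - F (\<theta> \<xi>)) has_real_derivative - g (\<theta> \<xi>)) (at \<xi>)"
begin

lemma \<theta>_isCont: "\<xi> \<in> J \<Longrightarrow> isCont \<theta> \<xi>"
  using \<theta>_cont J(1) continuous_on_eq_continuous_at by blast

lemma Y_cont: "continuous_on J Y"
proof -
  have "continuous_on J (\<lambda>\<xi>. Y \<xi> - F (\<theta> \<xi>))"
    using Y_F by (meson DERIV_isCont continuous_at_imp_continuous_on)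
  moreover have "continuous_on J (\<lambda>\<xi>. F (\<theta> \<xi>))"
    using \<theta>_cont \<theta>_range by (intro continuous_on_compose2[OF F_cont]) auto
  ultimately have "continuous_on J (\<lambda>\<xi>. (Y \<xi> - F (\<theta> \<xi>)) + F (\<theta> \<xi>))" by (rule continuous_on_add)
  then show ?thesis by simp
qed

text \<open>\<open>P\<close> is monotone and the domain open, so \<open>P(\<theta>)\<close> has an
  interior extremum at such a point. Fermat's rule applies to it even if \<open>\<theta>\<close> has
  a corner there.\<close>

lemma Y_eq_0_at_extreme:
  assumes \<xi>: "\<xi> \<in> J" and ext: "\<theta> \<xi> = 0 \<or> \<theta> \<xi> = R"
  shows "Y \<xi> = 0"
proof -
  obtain d where d: "0 < d" "\<And>y. \<bar>\<xi> - y\<bar> < d \<Longrightarrow> y \<in> J"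
    using J(1) \<xi> unfolding open_contains_ball by (metis dist_real_def mem_ball subsetD)
  from ext show ?thesis
  proof
    assume "\<theta> \<xi> = 0"
    then have "\<forall>y. \<bar>\<xi> - y\<bar> < d \<longrightarrow> P (\<theta> \<xi>) \<le> P (\<theta> y)"
      using d(2) \<theta>_range by (auto intro!: P_mono)
    then show ?thesis using DERIV_local_min[OF P_\<theta>[OF \<xi>] d(1)] by blast
  next
    assume "\<theta> \<xi> = R"
    then have "\<forall>y. \<bar>\<xi> - y\<bar> < d \<longrightarrow> P (\<theta> y) \<le> P (\<theta> \<xi>)"
      using d(2) \<theta>_range by (auto intro!: P_mono)
    then show ?thesis using DERIV_local_max[OF P_\<theta>[OF \<xi>] d(1)] by blast
  qed
qed

text \<open>Since \<open>P\<close> is strictly increasing with continuous derivative, \<open>\<theta>\<close> inherits the derivative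
  of \<open>P \<circ> \<theta>\<close> by Caratheodory's form of the derivative of \<open>P\<close>.\<close>

lemma \<theta>_deriv:
  assumes \<xi>: "\<xi> \<in> J" and in01: "0 < \<theta> \<xi>" "\<theta> \<xi> < R"
  shows "(\<theta> has_real_derivative Y \<xi> / D (\<theta> \<xi>)) (at \<xi>)"
proof -
  obtain Q where Q: "\<forall>z. P z - P (\<theta> \<xi>) = Q z * (z - \<theta> \<xi>)" "isCont Q (\<theta> \<xi>)" "Q (\<theta> \<xi>) = D (\<theta> \<xi>)"
    using P_deriv[OF in01] unfolding CARAT_DERIV by blast
  have Qpos: "0 < D (\<theta> \<xi>)" using D_pos in01 by blast
  have Qlim: "((\<lambda>y. Q (\<theta> y)) \<longlongrightarrow> D (\<theta> \<xi>)) (at \<xi>)"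
    using isCont_o2[OF \<theta>_isCont[OF \<xi>] Q(2)] Q(3) by (simp add: isCont_def)
  then have "((\<lambda>y. ((P (\<theta> y) - P (\<theta> \<xi>)) / (y - \<xi>)) / Q (\<theta> y)) \<longlongrightarrow> Y \<xi> / D (\<theta> \<xi>)) (at \<xi>)"
    using P_\<theta>[OF \<xi>] Qpos by (intro tendsto_divide) (auto simp: has_field_derivative_iff)
  moreover have "\<forall>\<^sub>F y in at \<xi>. Q (\<theta> y) \<noteq> 0"
    using order_tendstoD(1)[OF Qlim Qpos] by eventually_elim simp
  then have "\<forall>\<^sub>F y in at \<xi>. ((P (\<theta> y) - P (\<theta> \<xi>)) / (y - \<xi>)) / Q (\<theta> y) = (\<theta> y - \<theta> \<xi>) / (y - \<xi>)"
    by eventually_elim (simp add: Q(1))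
  ultimately show ?thesis
    unfolding has_field_derivative_iff by (rule Lim_transform_eventually)
qed

lemma Y_deriv:
  assumes \<xi>: "\<xi> \<in> J" and in01: "0 < \<theta> \<xi>" "\<theta> \<xi> < R"
  shows "(Y has_real_derivative (h (\<theta> \<xi>) - c) * (Y \<xi> / D (\<theta> \<xi>)) - g (\<theta> \<xi>)) (at \<xi>)"
proof -
  have "((\<lambda>\<xi>. (Y \<xi> - F (\<theta> \<xi>)) + F (\<theta> \<xi>)) has_real_derivative
      - g (\<theta> \<xi>) + (h (\<theta> \<xi>) - c) * (Y \<xi> / D (\<theta> \<xi>))) (at \<xi>)"
    by (intro DERIV_add Y_F \<xi> DERIV_chain2[where f = F] F_deriv in01 \<theta>_deriv)
  then show ?thesis by simp
qed

text \<open>\<open>D\<close> may vanish at \<open>0\<close>, so no slope of \<open>\<theta>\<close>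
  is available at \<open>\<omega>\<close>, and the sign of \<open>F(s) - F(0)\<close> for small
  \<open>s\<close> is not given. That sign is learned from the descending branch: there
  \<open>Y <= 0\<close> while \<open>Y - F(\<theta>)\<close> decreases to \<open>- F(0)\<close>, and
  every small value is attained, so \<open>F(s) <= F(0)\<close>. Beyond \<open>\<omega>\<close> the
  strict decrease of \<open>Y - F(\<theta>)\<close> then forces \<open>Y < 0\<close>.\<close>

lemma no_extension_past_zero:
  assumes \<omega>: "\<omega> \<in> J" "\<theta> \<omega> = 0" and anti: "antimono_on (J \<inter> {..<\<omega>}) \<theta>"
    and p: "p \<in> J" "p < \<omega>" "0 < \<theta> p"
  shows False
proof -
  have sub: "{p..\<omega>} \<subseteq> J" using open_interval_Icc_subset[OF J(2) p(1) \<omega>(1)] .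
  have Ynonpos: "Y \<xi> \<le> 0" if \<xi>: "\<xi> \<in> {p..<\<omega>}" for \<xi>
  proof (rule ccontr)
    assume "\<not> Y \<xi> \<le> 0"
    then have pos: "0 < Y \<xi>" by simp
    have \<xi>J: "\<xi> \<in> J" using \<xi> sub by auto
    obtain d where d: "0 < d" "\<And>k. 0 < k \<Longrightarrow> k < d \<Longrightarrow> P (\<theta> \<xi>) < P (\<theta> (\<xi> + k))"
      using DERIV_pos_inc_right[OF P_\<theta>[OF \<xi>J] pos] by blast
    define k where "k = min (d / 2) ((\<omega> - \<xi>) / 2)"
    have k: "0 < k" "k < d" "\<xi> + k < \<omega>" using d \<xi> by (auto simp: k_def min_def field_simps)
    have "\<xi> + k \<in> J" using k \<xi> sub by auto
    then have "\<theta> (\<xi> + k) \<le> \<theta> \<xi>" using anti \<xi>J k \<xi> by (auto simp: monotone_on_def)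
    then have "P (\<theta> (\<xi> + k)) \<le> P (\<theta> \<xi>)"
      using \<theta>_range[OF \<xi>J] \<theta>_range[OF \<open>\<xi> + k \<in> J\<close>] by (intro P_mono) auto
    then show False using d(2)[OF k(1,2)] by simp
  qed
  have Y\<omega>: "Y \<omega> = 0" using Y_eq_0_at_extreme \<omega> by blast
  define Z where "Z = (\<lambda>\<xi>. Y \<xi> - F (\<theta> \<xi>))"
  have Z: "(Z has_real_derivative - g (\<theta> \<xi>)) (at \<xi>)" if "\<xi> \<in> J" for \<xi>
    using Y_F[OF that] by (simp add: Z_def)
  have F_le: "F (\<theta> \<xi>) \<le> F 0" if \<xi>: "\<xi> \<in> {p..<\<omega>}" for \<xi>
  proof -
    have "Z \<xi> \<ge> Z \<omega>"
    proof (rule DERIV_nonpos_imp_nonincreasing[of \<xi> \<omega> Z])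
      fix x assume "\<xi> \<le> x" "x \<le> \<omega>"
      then have "x \<in> J" using \<xi> sub by auto
      then show "\<exists>y. (Z has_real_derivative y) (at x) \<and> y \<le> 0"
        using Z[of x] g_nonneg[of "\<theta> x"] \<theta>_range[of x] by (intro exI[of _ "- g (\<theta> x)"]) auto
    qed (use \<xi> in simp)
    then show ?thesis using Ynonpos[OF \<xi>] Y\<omega> \<omega> by (simp add: Z_def)
  qed
  have F_le': "F s \<le> F 0" if s: "0 \<le> s" "s < \<theta> p" for s
  proof (cases "s = 0")
    case False
    obtain x where "p \<le> x" "x \<le> \<omega>" "\<theta> x = s"
      using IVT2'[of \<theta> \<omega> s p] continuous_on_subset[OF \<theta>_cont sub] s \<omega> p by auto
    moreover have "x \<noteq> \<omega>" using False \<omega> calculation by auto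
    ultimately show ?thesis using F_le[of x] by auto
  qed simp
  have "\<forall>\<^sub>F \<xi> in at \<omega>. \<theta> \<xi> < \<theta> p"
    using \<theta>_isCont[OF \<omega>(1)] \<omega>(2) p(3) unfolding isCont_def by (intro order_tendstoD) auto
  then obtain d where d: "0 < d" "\<And>\<xi>. \<xi> \<noteq> \<omega> \<Longrightarrow> dist \<xi> \<omega> < d \<Longrightarrow> \<theta> \<xi> < \<theta> p"
    unfolding eventually_at by auto
  obtain e where e: "0 < e" "ball \<omega> e \<subseteq> J" using J(1) \<omega>(1) open_contains_ball by blast
  \<comment> \<open>Up to \<open>q\<close> the values stay below \<open>\<theta> p\<close>, the
    range on which \<open>F\<close> has been compared with \<open>F 0\<close>; they also stay below
    \<open>R\<close>, so that \<open>g > 0\<close>.\<close>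
  define q where "q = \<omega> + min d e / 2"
  have q: "\<omega> < q" "\<And>\<xi>. \<xi> \<in> {\<omega>..q} \<Longrightarrow> \<xi> \<in> J" "\<And>\<xi>. \<xi> \<in> {\<omega><..q} \<Longrightarrow> \<theta> \<xi> < \<theta> p"
    using d(1) e(1) by (auto simp: q_def dist_real_def intro!: d(2) subsetD[OF e(2)])
  have Yneg: "Y \<xi> < 0" if \<xi>: "\<xi> \<in> {\<omega><..q}" for \<xi>
  proof -
    have "Z \<xi> < Z \<omega>"
    proof (rule DERIV_neg_imp_decreasing_open[of \<omega> \<xi> Z])
      show "\<omega> < \<xi>" using \<xi> by simp
      show "\<exists>y. (Z has_real_derivative y) (at x) \<and> y < 0" if "\<omega> < x" "x < \<xi>" for x
      proof -
        have x: "x \<in> J" "\<theta> x < \<theta> p" "0 \<le> \<theta> x" "\<theta> p \<le> R" using q \<xi> that \<theta>_range[of x] \<theta>_range[of p] p by auto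
        then have "0 < g (\<theta> x)" by (intro g_pos) auto
        then show ?thesis using Z[OF x(1)] by (intro exI[of _ "- g (\<theta> x)"]) auto
      qed
      have "isCont Z x" if "x \<in> J" for x using Z[OF that] by (rule DERIV_isCont)
      then show "continuous_on {\<omega>..\<xi>} Z"
        using q(2) \<xi> by (intro continuous_at_imp_continuous_on) auto
    qed
    moreover have "F (\<theta> \<xi>) \<le> F 0"
      using \<xi> q \<theta>_range[of \<xi>] by (intro F_le') auto
    ultimately show ?thesis using Y\<omega> \<omega> by (simp add: Z_def)
  qed
  have "P (\<theta> q) < P (\<theta> \<omega>)"
  proof (rule DERIV_neg_imp_decreasing_open[of \<omega> q "\<lambda>\<xi>. P (\<theta> \<xi>)"])
    show "\<exists>y. ((\<lambda>\<xi>. P (\<theta> \<xi>)) has_real_derivative y) (at x) \<and> y < 0" if "\<omega> < x" "x < q" for x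
      using P_\<theta>[of x] Yneg[of x] q(2)[of x] that by (intro exI[of _ "Y x"]) auto
    have "isCont (\<lambda>\<xi>. P (\<theta> \<xi>)) x" if "x \<in> J" for x using P_\<theta>[OF that] by (rule DERIV_isCont)
    then show "continuous_on {\<omega>..q} (\<lambda>\<xi>. P (\<theta> \<xi>))"
      using q(2) by (intro continuous_at_imp_continuous_on) auto
  qed (rule q(1))
  then show False using \<omega> P_0 P_nonneg[of "\<theta> q"] \<theta>_range[OF q(2), of q] q(1) by auto
qed

end

text \<open>A trajectory of the equation \<open>u' = a + k/u\<close> for \<open>u(x) = - D(\<phi>) \<phi>'\<close> at \<open>\<phi> = R - x\<close>.\<close>

locale trajectory = rd_data +
  fixes u :: "real \<Rightarrow> real"
  assumes u_pos: "\<And>x. 0 < x \<Longrightarrow> x < R \<Longrightarrow> 0 < u x"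
    and u_deriv: "\<And>x. 0 < x \<Longrightarrow> x < R \<Longrightarrow>
      (u has_real_derivative h (R - x) - c + D (R - x) * g (R - x) / u x) (at x)"
    and u_0: "(u \<longlongrightarrow> 0) (at_right 0)"

section \<open>Decreasing weak profiles lie on the trajectory\<close>

locale wavefront = flux_profile R c f h D g "{..<w}" \<theta> Y + trajectory R c f h D g u
  for R c f h D g w \<theta> Y u +
  assumes \<theta>_anti: "antimono_on {..<w} \<theta>" and \<theta>_lim: "(\<theta> \<longlongrightarrow> R) at_bot"
begin

lemma Y_nonpos: assumes "\<xi> < w" shows "Y \<xi> \<le> 0"
proof (rule ccontr)
  assume "\<not> Y \<xi> \<le> 0"
  then have pos: "0 < Y \<xi>" by simp
  obtain d where d: "0 < d" "\<And>k. 0 < k \<Longrightarrow> k < d \<Longrightarrow> P (\<theta> \<xi>) < P (\<theta> (\<xi> + k))"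
    using DERIV_pos_inc_right[OF P_\<theta> pos] assms by auto
  define k where "k = min (d / 2) ((w - \<xi>) / 2)"
  have k: "0 < k" "k < d" "\<xi> + k < w" using d assms by (auto simp: k_def min_def field_simps)
  have "\<theta> (\<xi> + k) \<le> \<theta> \<xi>" using \<theta>_anti k assms by (auto simp: monotone_on_def)
  then have "P (\<theta> (\<xi> + k)) \<le> P (\<theta> \<xi>)"
    using \<theta>_range[of \<xi>] \<theta>_range[of "\<xi> + k"] k assms by (intro P_mono) auto
  then show False using d(2)[OF k(1,2)] by simp
qed

text \<open>Once at \<open>0\<close> a decreasing profile stays there, so
  \<open>Y - F(\<theta>)\<close> would be constant, against its derivative
  \<open>- g(0) < 0\<close>.\<close>

lemma \<theta>_pos: assumes "\<xi> < w" shows "0 < \<theta> \<xi>"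
proof (rule ccontr)
  assume "\<not> 0 < \<theta> \<xi>"
  then have z: "\<theta> \<xi> = 0" using \<theta>_range[of \<xi>] assms by auto
  have z': "\<theta> x = 0" if "\<xi> \<le> x" "x < w" for x
  proof -
    have "\<theta> x \<le> \<theta> \<xi>" using \<theta>_anti that assms by (auto simp: monotone_on_def)
    then show ?thesis using z \<theta>_range[of x] that by auto
  qed
  define m where "m = (\<xi> + w) / 2"
  have m: "\<xi> < m" "m < w" using assms by (auto simp: m_def field_simps)
  have "((\<lambda>\<xi>. Y \<xi> - F (\<theta> \<xi>)) has_real_derivative - g 0) (at m)"
    using Y_F[of m] z'[of m] m by auto
  moreover have "((\<lambda>\<xi>. Y \<xi> - F (\<theta> \<xi>)) has_real_derivative 0) (at m)"
  proof (rule has_field_derivative_transform_within_open[of "\<lambda>_. - F 0" _ _ "{\<xi><..<w}"])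
    show "- F 0 = Y x - F (\<theta> x)" if "x \<in> {\<xi><..<w}" for x
      using z'[of x] Y_eq_0_at_extreme[of x] that by auto
  qed (use m in auto)
  ultimately have "- g 0 = 0" by (rule DERIV_unique)
  then show False using g_pos[of 0] R_pos by simp
qed

text \<open>A zero of \<open>Y\<close> below \<open>R\<close> would be crossed downwards, since
  there \<open>Y' = - g(\<theta>) < 0\<close>; then \<open>Y\<close> would be positive just before
  it.\<close>

lemma Y_neg: assumes "\<xi> < w" "\<theta> \<xi> < R" shows "Y \<xi> < 0"
proof (rule ccontr)
  assume "\<not> Y \<xi> < 0"
  then have Y0: "Y \<xi> = 0" using Y_nonpos[OF assms(1)] by simp
  have "(Y has_real_derivative - g (\<theta> \<xi>)) (at \<xi>)"
    using Y_deriv[of \<xi>] \<theta>_pos[OF assms(1)] assms Y0 by simp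
  moreover have "- g (\<theta> \<xi>) < 0" using g_pos[of "\<theta> \<xi>"] \<theta>_pos[OF assms(1)] assms by simp
  ultimately obtain d where d: "0 < d" "\<And>k. 0 < k \<Longrightarrow> k < d \<Longrightarrow> Y \<xi> < Y (\<xi> - k)"
    using DERIV_neg_dec_left by blast
  have "Y \<xi> < Y (\<xi> - d / 2)" using d by auto
  moreover have "Y (\<xi> - d / 2) \<le> 0" using Y_nonpos[of "\<xi> - d / 2"] assms d by auto
  ultimately show False using Y0 by simp
qed

lemma antiD: "\<xi> \<le> \<eta> \<Longrightarrow> \<eta> < w \<Longrightarrow> \<theta> \<eta> \<le> \<theta> \<xi>"
  using \<theta>_anti by (auto simp: monotone_on_def)

text \<open>The squared distance between the two trajectories is nonincreasing in \<open>\<xi>\<close>, and it vanishes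
  where the profile leaves \<open>R\<close>.\<close>

lemma Y_eq_trajectory:
  assumes "\<xi> < w" "\<theta> \<xi> < R"
  shows "Y \<xi> = - u (R - \<theta> \<xi>)"
proof (rule ccontr)
  assume neq: "Y \<xi> \<noteq> - u (R - \<theta> \<xi>)"
  define q where "q = (\<lambda>\<eta>. (- Y \<eta> - u (R - \<theta> \<eta>))\<^sup>2)"
  define e where "e = \<bar>- Y \<xi> - u (R - \<theta> \<xi>)\<bar>"
  have e: "0 < e" using neq by (auto simp: e_def)
  have far: "e \<le> \<bar>- Y \<eta> - u (R - \<theta> \<eta>)\<bar>" if \<eta>: "\<eta> \<le> \<xi>" "\<theta> \<eta> < R" for \<eta>
  proof -
    have "q \<xi> \<le> q \<eta>"
    proof (rule DERIV_nonpos_imp_nonincreasing[of \<eta> \<xi> q])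
      fix x assume x: "\<eta> \<le> x" "x \<le> \<xi>"
      have t: "0 < \<theta> x" "\<theta> x < R" "x < w"
        using \<theta>_pos[of x] antiD[of \<eta> x] x \<eta> assms by auto
      define D0 g0 v u0 where "D0 = D (\<theta> x)" and "g0 = g (\<theta> x)" and "v = - Y x" and "u0 = u (R - \<theta> x)"
      have pos: "0 < D0" "0 < g0" "0 < v" "0 < u0"
        using D_pos t g_pos[of "\<theta> x"] Y_neg[of x] u_pos[of "R - \<theta> x"] by (auto simp: D0_def g0_def v_def u0_def)
      have "((\<lambda>\<eta>. u (R - \<theta> \<eta>)) has_real_derivative
          (h (\<theta> x) - c + D0 * g0 / u0) * (0 - Y x / D0)) (at x)"
      proof (rule DERIV_chain2[where f = u and g = "\<lambda>\<eta>. R - \<theta> \<eta>"])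
        show "(u has_real_derivative h (\<theta> x) - c + D0 * g0 / u0) (at (R - \<theta> x))"
          using u_deriv[of "R - \<theta> x"] t by (simp add: D0_def g0_def u0_def)
        show "((\<lambda>\<eta>. R - \<theta> \<eta>) has_real_derivative 0 - Y x / D0) (at x)"
          unfolding D0_def by (intro DERIV_diff DERIV_const \<theta>_deriv) (use t in auto)
      qed
      then have "((\<lambda>\<eta>. - Y \<eta> - u (R - \<theta> \<eta>)) has_real_derivative
          - ((h (\<theta> x) - c) * (Y x / D0) - g0) - (h (\<theta> x) - c + D0 * g0 / u0) * (0 - Y x / D0)) (at x)"
        unfolding D0_def g0_def by (intro DERIV_diff DERIV_minus Y_deriv) (use t in auto)
      \<comment> \<open>The terms with \<open>h - c\<close> cancel. What is left,
        \<open>g0 (1 - v / u0)\<close>, has the sign opposite to \<open>v - u0\<close>.\<close>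
      moreover have "- ((h (\<theta> x) - c) * (Y x / D0) - g0) - (h (\<theta> x) - c + D0 * g0 / u0) * (0 - Y x / D0)
          = - (g0 / u0) * (v - u0)"
        using pos by (simp add: v_def field_simps)
      ultimately have base: "((\<lambda>\<eta>. - Y \<eta> - u (R - \<theta> \<eta>)) has_real_derivative - (g0 / u0) * (v - u0)) (at x)" by simp
      have "(q has_real_derivative of_nat 2 * (- (g0 / u0) * (v - u0) * (- Y x - u0) ^ (2 - Suc 0))) (at x)"
        unfolding q_def u0_def by (rule DERIV_power[OF base[unfolded u0_def]])
      moreover have "of_nat 2 * (- (g0 / u0) * (v - u0) * (- Y x - u0) ^ (2 - Suc 0)) = - (2 * (g0 / u0) * (v - u0)\<^sup>2)"
        by (simp add: v_def power2_eq_square)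
      moreover have "- (2 * (g0 / u0) * (v - u0)\<^sup>2) \<le> 0" using pos by simp
      ultimately show "\<exists>y. (q has_real_derivative y) (at x) \<and> y \<le> 0" by metis
    qed (use \<eta> in simp)
    then have "e\<^sup>2 \<le> \<bar>- Y \<eta> - u (R - \<theta> \<eta>)\<bar>\<^sup>2" unfolding q_def e_def power2_abs .
    then show ?thesis by (rule power2_le_imp_le) simp
  qed
  have "\<forall>\<^sub>F x in at_right 0. u x < e" by (rule order_tendstoD(2)[OF u_0 e])
  then obtain x1 where x1: "0 < x1" "\<And>x. 0 < x \<Longrightarrow> x < x1 \<Longrightarrow> u x < e"
    unfolding eventually_at_right_field by auto
  have far': "Y \<eta> \<le> - e" if "\<eta> \<le> \<xi>" "\<theta> \<eta> < R" "R - \<theta> \<eta> < x1" for \<eta>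
    using far[OF that(1,2)] x1(2)[of "R - \<theta> \<eta>"] that Y_neg[of \<eta>] assms u_pos[of "R - \<theta> \<eta>"] \<theta>_pos[of \<eta>]
    by auto
  show False
  proof (cases "\<exists>\<eta><w. \<theta> \<eta> = R")
    case False
    have "\<forall>\<^sub>F \<eta> in at_bot. R - x1 < \<theta> \<eta>" using order_tendstoD(1)[OF \<theta>_lim, of "R - x1"] x1(1) by simp
    then obtain m where m: "\<And>\<eta>. \<eta> \<le> m \<Longrightarrow> R - x1 < \<theta> \<eta>" unfolding eventually_at_bot_linorder by auto
    define b where "b = min m \<xi>"
    \<comment> \<open>Over this length a slope of at most \<open>- e\<close> would lower
      \<open>P(\<theta>)\<close> by at least \<open>P R + 1\<close>, more than its whole
      range.\<close>
    define a where "a = b - (P R + 1) / e"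
    have ab: "a < b" using e P_nonneg[of R] R_pos by (auto simp: a_def)
    have "\<exists>z. a < z \<and> z < b \<and> P (\<theta> b) - P (\<theta> a) = (b - a) * Y z"
      by (rule MVT2[OF ab], rule P_\<theta>) (use assms in \<open>auto simp: b_def\<close>)
    then obtain z where z: "a < z" "z < b" "P (\<theta> b) - P (\<theta> a) = (b - a) * Y z" by blast
    have zw: "z < w" "z \<le> \<xi>" "z \<le> m" using z assms by (auto simp: b_def)
    have "Y z \<le> - e"
      by (rule far') (use zw m[of z] False \<theta>_range[of z] in force)+
    then have "(b - a) * Y z \<le> (b - a) * (- e)" using ab by (intro mult_left_mono) auto
    also have "\<dots> = - (P R + 1)" using e by (simp add: a_def)
    finally have "P (\<theta> a) \<ge> P (\<theta> b) + P R + 1" using z by simp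
    moreover have "P (\<theta> a) \<le> P R" "0 \<le> P (\<theta> b)"
      using \<theta>_range[of a] \<theta>_range[of b] ab assms by (auto intro!: P_mono P_nonneg simp: b_def)
    ultimately show False by simp
  next
    case True
    then obtain \<eta>0 where \<eta>0: "\<eta>0 < w" "\<theta> \<eta>0 = R" by blast
    have \<eta>0\<xi>: "\<eta>0 < \<xi>" using antiD[of \<xi> \<eta>0] \<eta>0 assms by (cases "\<eta>0 < \<xi>") auto
    have ct: "continuous_on {\<eta>0..\<xi>} \<theta>" by (rule continuous_on_subset[OF \<theta>_cont]) (use assms in auto)
    define S where "S = {\<eta>0..\<xi>} \<inter> \<theta> -` {R..}"
    have "closed S" unfolding S_def using continuous_closed_preimage[OF ct] by auto
    moreover have S0: "\<eta>0 \<in> S" and bdd: "bdd_above S" using \<eta>0 \<eta>0\<xi> by (auto simp: S_def intro!: bdd_aboveI[of _ \<xi>])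
    ultimately have sS: "Sup S \<in> S" by (intro closed_contains_Sup) auto
    \<comment> \<open>The last point with \<open>\<theta> = R\<close>. The flux is \<open>0\<close>
      there, so by continuity it cannot be at most \<open>- e\<close> immediately
      afterwards.\<close>
    define z where "z = Sup S"
    have "z \<in> S" using sS by (simp add: z_def)
    then have "z \<le> \<xi>" "R \<le> \<theta> z" by (auto simp: S_def)
    then have z: "z < w" "\<theta> z = R" "z < \<xi>"
      using assms \<theta>_range[of z] by (auto simp: less_le)
    have less: "\<theta> x < R" if "z < x" "x \<le> \<xi>" for x
    proof (rule ccontr)
      assume "\<not> \<theta> x < R"
      then have "x \<in> S" using that sS unfolding z_def S_def by auto
      then have "x \<le> z" unfolding z_def using bdd by (rule cSup_upper)
      then show False using that by simp
    qed
    have Yz: "Y z = 0" using Y_eq_0_at_extreme z by auto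
    have "isCont Y z" using Y_cont z continuous_on_eq_continuous_at[of "{..<w}" Y] by auto
    then have "\<forall>\<^sub>F x in at z. - e < Y x" using order_tendstoD(1)[of Y "Y z" "at z" "- e"] Yz e by (simp add: isCont_def)
    moreover have "\<forall>\<^sub>F x in at z. R - x1 < \<theta> x"
      using \<theta>_isCont[of z] order_tendstoD(1)[of \<theta> "\<theta> z" "at z" "R - x1"] z x1(1)
      by (simp add: isCont_def)
    ultimately have "\<forall>\<^sub>F x in at z. - e < Y x \<and> R - x1 < \<theta> x" by (rule eventually_conj)
    then obtain d where d: "0 < d" "\<And>x. x \<noteq> z \<Longrightarrow> dist x z < d \<Longrightarrow> - e < Y x \<and> R - x1 < \<theta> x"
      unfolding eventually_at by auto
    define x where "x = z + min (d / 2) ((\<xi> - z) / 2)"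
    have x: "z < x" "x \<le> \<xi>" "dist x z < d" using d(1) z by (auto simp: x_def dist_real_def min_def field_simps)
    show False using far'[of x] less[of x] d(2)[of x] x by auto
  qed
qed

text \<open>Separation of variables: since \<open>\<theta>' = Y / D(\<theta>) = - u / D\<close>, the
  time along the profile and the travel time along the trajectory run at the same rate. The points
  with \<open>\<theta> < R\<close> form an upward closed part of the half-line, hence one constant
  serves for all of them.\<close>

lemma profile_is_shift:
  assumes H: "\<And>x. 0 < x \<Longrightarrow> x < R \<Longrightarrow> (H has_real_derivative D (R - x) / u x) (at x)"
    and nonconst: "\<not> \<theta> constant_on {..<w}"
  obtains s where "\<And>\<xi>. \<xi> < w \<Longrightarrow> \<theta> \<xi> < R \<Longrightarrow> H (R - \<theta> \<xi>) = \<xi> + s"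
proof -
  define k where "k = (\<lambda>\<xi>. H (R - \<theta> \<xi>) - \<xi>)"
  have k: "(k has_real_derivative 0) (at x)" if t: "x < w" "\<theta> x < R" for x
  proof -
    have pos: "0 < \<theta> x" "0 < D (\<theta> x)" "0 < u (R - \<theta> x)"
      using \<theta>_pos t D_pos u_pos by auto
    have a: "((\<lambda>x. R - \<theta> x) has_real_derivative 0 - Y x / D (\<theta> x)) (at x)"
      by (intro DERIV_diff DERIV_const \<theta>_deriv) (use t pos in auto)
    have "(H has_real_derivative D (\<theta> x) / u (R - \<theta> x)) (at (R - \<theta> x))"
      using H[of "R - \<theta> x"] t pos by simp
    then have "((\<lambda>x. H (R - \<theta> x)) has_real_derivative
        (D (\<theta> x) / u (R - \<theta> x)) * (0 - Y x / D (\<theta> x))) (at x)"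
      using a by (rule DERIV_chain2)
    then have "(k has_real_derivative (D (\<theta> x) / u (R - \<theta> x)) * (0 - Y x / D (\<theta> x)) - 1) (at x)"
      unfolding k_def by (rule DERIV_diff[OF _ DERIV_ident])
    then show ?thesis using pos Y_eq_trajectory[OF t] by simp
  qed
  have const: "k x = k y" if "x < w" "y < w" "\<theta> x < R" "\<theta> y < R" for x y
  proof -
    have *: "k b = k a" if "a < b" "b < w" "\<theta> a < R" for a b
    proof (rule DERIV_isconst_end[of a b k])
      have k': "(k has_real_derivative 0) (at x)" if "a \<le> x" "x \<le> b" for x
        using k[of x] antiD[of a x] that \<open>b < w\<close> \<open>\<theta> a < R\<close> by simp
      then have "isCont k x" if "a \<le> x" "x \<le> b" for x using that by (blast intro: DERIV_isCont)
      then show "continuous_on {a..b} k" by (intro continuous_at_imp_continuous_on) auto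
      show "(k has_real_derivative 0) (at x)" if "a < x" "x < b" for x using k'[of x] that by simp
    qed (rule \<open>a < b\<close>)
    show ?thesis using *[of x y] *[of y x] that by (cases x y rule: linorder_cases) auto
  qed
  show ?thesis
  proof (cases "\<exists>x<w. \<theta> x < R")
    case True
    then obtain x where "x < w" "\<theta> x < R" by blast
    then have "H (R - \<theta> \<xi>) = \<xi> + k x" if "\<xi> < w" "\<theta> \<xi> < R" for \<xi>
      using const[OF that(1) _ that(2), of x] by (simp add: k_def)
    then show ?thesis by (rule that)
  qed (use that in blast)
qed

end

subsection \<open>Existence of the singular trajectory\<close>

text \<open>Composition with the retraction of the line onto \<open>[0, R]\<close> puts functions on
  the interval into the complete space of bounded continuous functions, where the Banach fixed point
  theorem is applied.\<close>

lemma bcontfun_clamp: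
  fixes G :: "real \<Rightarrow> real"
  assumes "0 \<le> R" "continuous_on {0..R} G"
  shows "(\<lambda>x. G (max 0 (min R x))) \<in> bcontfun"
proof -
  have r: "max 0 (min R x) \<in> {0..R}" for x using assms(1) by auto
  have c: "continuous_on UNIV (\<lambda>x. G (max 0 (min R x)))"
    by (rule continuous_on_compose2[OF assms(2)]) (use r in \<open>auto intro!: continuous_intros\<close>)
  obtain B where B: "\<And>y. y \<in> {0..R} \<Longrightarrow> \<bar>G y\<bar> \<le> B" using abs_bounded_on_Icc[OF assms(2)] by metis
  show ?thesis by (rule bcontfun_normI[OF c, of B]) (unfold real_norm_def, rule B[OF r])
qed

text \<open>The weight \<open>exp (- 2 L x)\<close> makes the Picard operator a contraction on the whole interval.\<close>

lemma picard_lindeloef: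
  fixes q :: "real \<Rightarrow> real \<Rightarrow> real"
  assumes R: "0 \<le> R" and L: "0 < L"
    and cont: "\<And>w. continuous_on {0..R} w \<Longrightarrow> continuous_on {0..R} (\<lambda>t. q t (w t))"
    and lip: "\<And>t v w. t \<in> {0..R} \<Longrightarrow> \<bar>q t v - q t w\<bar> \<le> L * \<bar>v - w\<bar>"
  obtains u where "u 0 = u0" "continuous_on {0..R} u"
    "\<And>x. x \<in> {0..R} \<Longrightarrow> (u has_real_derivative q x (u x)) (at x within {0..R})"
proof -
  define S where "S = (\<lambda>(v :: real \<Rightarrow>\<^sub>C real) x. u0 + integral {0..x} (\<lambda>t. q t (exp (2 * L * t) * apply_bcontfun v t)))"
  have int: "continuous_on {0..R} (\<lambda>t. q t (exp (2 * L * t) * apply_bcontfun v t))" for v :: "real \<Rightarrow>\<^sub>C real"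
    by (intro cont continuous_intros continuous_on_apply_bcontfun)
  have cS: "continuous_on {0..R} (S v)" for v
    unfolding S_def
    by (intro continuous_intros indefinite_integral_continuous_1 integrable_continuous_real int)
  \<comment> \<open>The fixed point is \<open>v(x) = exp (- 2 L x) u(x)\<close>, extended by
    clamping. The rate \<open>2 L\<close> against the Lipschitz constant \<open>L\<close> gives the
    contraction factor \<open>1/2\<close>, whatever the length \<open>R\<close>.\<close>
  define T where "T = (\<lambda>v. Bcontfun (\<lambda>x. exp (- 2 * L * max 0 (min R x)) * S v (max 0 (min R x))))"
  have T: "apply_bcontfun (T v) x = exp (- 2 * L * max 0 (min R x)) * S v (max 0 (min R x))" for v x
    unfolding T_def
    by (subst Bcontfun_inverse)
      (auto intro!: bcontfun_clamp[OF R, of "\<lambda>y. exp (- 2 * L * y) * S v y", simplified] continuous_intros cS[simplified])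
  have "dist (T v) (T w) \<le> 1/2 * dist v w" for v w
  proof (rule dist_bound)
    fix x
    define y where "y = max 0 (min R x)"
    have y: "0 \<le> y" "y \<le> R" using R by (auto simp: y_def)
    define d where "d = dist v w"
    have iv: "(\<lambda>t. q t (exp (2 * L * t) * apply_bcontfun v t)) integrable_on {0..y}" for v :: "real \<Rightarrow>\<^sub>C real"
      by (rule integrable_continuous_real, rule continuous_on_subset[OF int]) (use y in auto)
    have E: "((\<lambda>t. L * d * exp (2 * L * t)) has_integral d / 2 * exp (2 * L * y) - d / 2 * exp (2 * L * 0)) {0..y}"
      by (rule ftc_real[OF y(1)]) (auto intro!: derivative_eq_intros)
    have "\<bar>S v y - S w y\<bar> = \<bar>integral {0..y} (\<lambda>t. q t (exp (2 * L * t) * apply_bcontfun v t) - q t (exp (2 * L * t) * apply_bcontfun w t))\<bar>"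
      unfolding S_def by (simp add: integral_diff[OF iv iv])
    also have "\<dots> \<le> integral {0..y} (\<lambda>t. L * d * exp (2 * L * t))"
      unfolding real_norm_def[symmetric]
    proof (rule integral_norm_bound_integral)
      show "(\<lambda>t. q t (exp (2 * L * t) * apply_bcontfun v t) - q t (exp (2 * L * t) * apply_bcontfun w t)) integrable_on {0..y}"
        by (intro integrable_diff iv)
      show "(\<lambda>t. L * d * exp (2 * L * t)) integrable_on {0..y}" using E by blast
      fix t assume t: "t \<in> {0..y}"
      have "\<bar>q t (exp (2 * L * t) * apply_bcontfun v t) - q t (exp (2 * L * t) * apply_bcontfun w t)\<bar>
          \<le> L * \<bar>exp (2 * L * t) * apply_bcontfun v t - exp (2 * L * t) * apply_bcontfun w t\<bar>"
        using lip t y by auto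
      also have "\<dots> = L * (exp (2 * L * t) * \<bar>apply_bcontfun v t - apply_bcontfun w t\<bar>)"
        by (simp add: right_diff_distrib[symmetric] abs_mult)
      also have "\<dots> \<le> L * (exp (2 * L * t) * d)"
        using dist_bounded[of v t w] L by (intro mult_left_mono) (auto simp: d_def dist_real_def)
      finally show "norm (q t (exp (2 * L * t) * apply_bcontfun v t) - q t (exp (2 * L * t) * apply_bcontfun w t))
          \<le> L * d * exp (2 * L * t)" by (simp add: mult_ac)
    qed
    also have "\<dots> = d / 2 * exp (2 * L * y) - d / 2 * exp (2 * L * 0)" using E by (rule integral_unique)
    also have "\<dots> \<le> d / 2 * exp (2 * L * y)" by (simp add: d_def)
    finally have b: "\<bar>S v y - S w y\<bar> \<le> d / 2 * exp (2 * L * y)" .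
    have "dist (apply_bcontfun (T v) x) (apply_bcontfun (T w) x) = exp (- (2 * L * y)) * \<bar>S v y - S w y\<bar>"
      unfolding T y_def[symmetric] dist_real_def by (simp add: right_diff_distrib[symmetric] abs_mult)
    also have "\<dots> \<le> exp (- (2 * L * y)) * (d / 2 * exp (2 * L * y))" using b by (intro mult_left_mono) auto
    also have "\<dots> = 1/2 * d" by (simp add: exp_minus field_simps)
    finally show "dist (apply_bcontfun (T v) x) (apply_bcontfun (T w) x) \<le> 1/2 * dist v w" by (simp add: d_def)
  qed
  then have "\<exists>!v. T v = v" by (intro banach_fix_type[of "1/2"]) auto
  then obtain v where v: "T v = v" by blast
  define u where "u = (\<lambda>x. exp (2 * L * x) * apply_bcontfun v x)"
  have u: "u x = S v x" if "x \<in> {0..R}" for x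
  proof -
    have "max 0 (min R x) = x" using that by auto
    then have "apply_bcontfun v x = exp (- 2 * L * x) * S v x" using T[of v x] v by simp
    then show ?thesis by (simp add: u_def exp_minus field_simps)
  qed
  have "u 0 = u0" using u[of 0] R by (simp add: S_def)
  moreover have "continuous_on {0..R} u" unfolding u_def by (intro continuous_intros continuous_on_apply_bcontfun)
  moreover have "(u has_real_derivative q x (u x)) (at x within {0..R})" if x: "x \<in> {0..R}" for x
  proof -
    have "((\<lambda>x. integral {0..x} (\<lambda>t. q t (u t))) has_real_derivative q x (u x)) (at x within {0..R})"
      by (rule integral_has_real_derivative[OF _ x]) (use int[of v] in \<open>simp add: u_def\<close>)
    then have "((\<lambda>x. u0 + integral {0..x} (\<lambda>t. q t (u t))) has_real_derivative 0 + q x (u x)) (at x within {0..R})"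
      by (intro DERIV_add DERIV_const)
    then have "((\<lambda>x. u0 + integral {0..x} (\<lambda>t. q t (u t))) has_real_derivative q x (u x)) (at x within {0..R})"
      by simp
    then show ?thesis
      by (rule has_field_derivative_transform_within[of _ _ _ _ 1]) (use x u in \<open>auto simp: S_def u_def\<close>)
  qed
  ultimately show ?thesis by (rule that)
qed

text \<open>Cutting the denominator off at \<open>\<eta>\<close> makes the singular right-hand side
  globally Lipschitz, as the Picard iteration requires.\<close>

lemma abs_divide_max_diff_le:
  fixes v w \<eta> K :: real
  assumes "0 < \<eta>" "0 \<le> K"
  shows "\<bar>K / max v \<eta> - K / max w \<eta>\<bar> \<le> K / \<eta>\<^sup>2 * \<bar>v - w\<bar>"
proof -
  define x y where "x = max v \<eta>" and "y = max w \<eta>"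
  have xy: "\<eta> \<le> x" "\<eta> \<le> y" "\<bar>y - x\<bar> \<le> \<bar>v - w\<bar>" by (auto simp: x_def y_def)
  then have pos: "0 < x" "0 < y" using assms by auto
  have "K / x - K / y = K * (y - x) / (x * y)" using pos by (simp add: field_simps)
  then have "\<bar>K / x - K / y\<bar> = K * \<bar>y - x\<bar> / (x * y)" using pos assms by (simp add: abs_mult)
  also have "\<dots> \<le> K * \<bar>v - w\<bar> / (\<eta> * \<eta>)"
    using xy pos assms by (intro frac_le mult_mono) auto
  finally show ?thesis by (simp add: x_def y_def power2_eq_square)
qed

text \<open>Regularisation of the singular equation: the added \<open>d\<close> and the initial value \<open>d / (A + 1)\<close> keep the
  solution away from \<open>0\<close>.\<close>

lemma regularized_trajectory_exists:
  fixes a k :: "real \<Rightarrow> real"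
  assumes R: "0 < R" and a: "continuous_on {0..R} a" and k: "continuous_on {0..R} k"
    and k_nonneg: "\<And>x. x \<in> {0..R} \<Longrightarrow> 0 \<le> k x"
    and A: "\<And>x. x \<in> {0..R} \<Longrightarrow> \<bar>a x\<bar> \<le> A" and d: "0 < d"
  obtains u where "u 0 = d / (A + 1)" "continuous_on {0..R} u" "\<And>x. x \<in> {0..R} \<Longrightarrow> 0 < u x"
    "\<And>x. 0 < x \<Longrightarrow> x < R \<Longrightarrow> (u has_real_derivative a x + (k x + d) / u x) (at x)"
proof -
  have A0: "0 \<le> A" using A[of 0] R by (auto intro: order_trans[OF abs_ge_zero])
  \<comment> \<open>At height \<open>\<eta>\<close> the added \<open>d\<close> alone pushes with
    strength \<open>d / \<eta> = A + 1\<close>, which beats \<open>a >= - A\<close>. The solution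
    cannot go below \<open>\<eta>\<close>, so the cutoff in \<open>q\<close> stays inactive.\<close>
  define \<eta> where "\<eta> = d / (A + 1)"
  have \<eta>: "0 < \<eta>" "d / \<eta> = A + 1" using A0 d by (auto simp: \<eta>_def)
  obtain M where M: "\<And>x. x \<in> {0..R} \<Longrightarrow> k x \<le> M"
    using continuous_attains_sup[of "{0..R}" k] k R by (metis atLeastatMost_empty_iff2 compact_Icc less_le_not_le)
  have M0: "0 \<le> M" using M[of 0] k_nonneg[of 0] R by auto
  define q where "q = (\<lambda>x v. a x + (k x + d) / max v \<eta>)"
  obtain u where u: "u 0 = \<eta>" "continuous_on {0..R} u"
    "\<And>x. x \<in> {0..R} \<Longrightarrow> (u has_real_derivative q x (u x)) (at x within {0..R})"
  proof (rule picard_lindeloef[of R "(M + d) / \<eta>\<^sup>2" q \<eta>])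
    show "0 < (M + d) / \<eta>\<^sup>2" using M0 d \<eta> by simp
    show "continuous_on {0..R} (\<lambda>t. q t (w t))" if "continuous_on {0..R} w" for w
      unfolding q_def using \<eta> by (intro continuous_intros a k that) (auto simp: max_def)
    show "\<bar>q t v - q t w\<bar> \<le> (M + d) / \<eta>\<^sup>2 * \<bar>v - w\<bar>" if t: "t \<in> {0..R}" for t v w
    proof -
      have "\<bar>q t v - q t w\<bar> \<le> (k t + d) / \<eta>\<^sup>2 * \<bar>v - w\<bar>"
        using abs_divide_max_diff_le[of \<eta> "k t + d" v w] \<eta> k_nonneg[OF t] d by (simp add: q_def)
      also have "\<dots> \<le> (M + d) / \<eta>\<^sup>2 * \<bar>v - w\<bar>"
        using M[OF t] by (intro mult_right_mono divide_right_mono) auto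
      finally show ?thesis .
    qed
  qed (use R in auto)
  have d': "(u has_real_derivative q x (u x)) (at x)" if "0 < x" "x < R" for x
    using u(3)[of x] that by (simp add: at_within_Icc_at)
  have ge: "0 \<le> u x - \<eta>" if "x \<in> {0..R}" for x
  proof (rule nonneg_of_deriv_nonneg_where_neg[of 0 R "\<lambda>x. u x - \<eta>"])
    show "\<exists>d\<ge>0. ((\<lambda>x. u x - \<eta>) has_real_derivative d) (at x)" if x: "0 < x" "x < R" "u x - \<eta> < 0" for x
    proof (intro exI conjI)
      show "((\<lambda>x. u x - \<eta>) has_real_derivative q x (u x) - 0) (at x)"
        by (intro DERIV_diff d' DERIV_const x)
      have "q x (u x) = a x + (k x / \<eta> + d / \<eta>)" using x by (simp add: q_def max_def add_divide_distrib)
      moreover have "0 \<le> k x / \<eta>" using k_nonneg[of x] x \<eta> by simp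
      ultimately show "0 \<le> q x (u x) - 0" using A[of x] x \<eta>(2) by auto
    qed
  qed (use u that in \<open>auto intro!: continuous_intros\<close>)
  have ge': "\<eta> \<le> u x" if "x \<in> {0..R}" for x using ge[OF that] by simp
  show ?thesis
  proof (rule that[OF u(1)[unfolded \<eta>_def] u(2)])
    show "0 < u x" if "x \<in> {0..R}" for x using ge'[OF that] \<eta> by simp
    show "(u has_real_derivative a x + (k x + d) / u x) (at x)" if "0 < x" "x < R" for x
      using d'[OF that] ge'[of x] that by (simp add: q_def max_def split: if_splits)
  qed
qed

text \<open>The regularised solutions decrease with \<open>n\<close> and so converge pointwise. Two
  barriers independent of \<open>n\<close> shape the limit: an upper one that can be taken
  arbitrarily low at \<open>0\<close> gives the initial value, and a lower one on compact
  subintervals gives positivity and the domination for passing to the limit in the integrated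
  equation.\<close>

lemma singular_trajectory_exists:
  fixes a k :: "real \<Rightarrow> real"
  assumes R: "0 < R" and a: "continuous_on {0..R} a" and k: "continuous_on {0..R} k"
    and k_nonneg: "\<And>x. x \<in> {0..R} \<Longrightarrow> 0 \<le> k x" and k_pos: "\<And>x. 0 < x \<Longrightarrow> x < R \<Longrightarrow> 0 < k x"
  obtains u B where "\<And>x. 0 < x \<Longrightarrow> x < R \<Longrightarrow> 0 < u x \<and> u x \<le> B"
    "\<And>x. 0 < x \<Longrightarrow> x < R \<Longrightarrow> (u has_real_derivative a x + k x / u x) (at x)"
    "(u \<longlongrightarrow> 0) (at_right 0)"
proof -
  obtain A where A0: "0 \<le> A" and A: "\<And>x. x \<in> {0..R} \<Longrightarrow> \<bar>a x\<bar> \<le> A"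
    using abs_bounded_on_Icc[OF a] by metis
  obtain M where M0: "0 \<le> M" and M: "\<And>x. x \<in> {0..R} \<Longrightarrow> \<bar>k x\<bar> \<le> M"
    using abs_bounded_on_Icc[OF k] by metis
  define d where "d = (\<lambda>n::nat. 1 / (real n + 1))"
  have d: "0 < d n" "d n \<le> 1" for n by (auto simp: d_def)
  have ex: "\<forall>n. \<exists>u. u 0 = d n / (A + 1) \<and> continuous_on {0..R} u \<and> (\<forall>x\<in>{0..R}. 0 < u x) \<and>
    (\<forall>x. 0 < x \<longrightarrow> x < R \<longrightarrow> (u has_real_derivative a x + (k x + d n) / u x) (at x))"
  proof
    fix n
    obtain w where "w 0 = d n / (A + 1)" "continuous_on {0..R} w" "\<And>x. x \<in> {0..R} \<Longrightarrow> 0 < w x"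
      "\<And>x. 0 < x \<Longrightarrow> x < R \<Longrightarrow> (w has_real_derivative a x + (k x + d n) / w x) (at x)"
      by (rule regularized_trajectory_exists[OF R a k k_nonneg A d(1)[of n]]) (assumption, assumption, rule that)
    then show "\<exists>u. u 0 = d n / (A + 1) \<and> continuous_on {0..R} u \<and> (\<forall>x\<in>{0..R}. 0 < u x) \<and>
      (\<forall>x. 0 < x \<longrightarrow> x < R \<longrightarrow> (u has_real_derivative a x + (k x + d n) / u x) (at x))"
      by (intro exI[of _ w] conjI ballI allI impI)
  qed
  from choice[OF ex] obtain v where v_ex: "\<forall>n. v n 0 = d n / (A + 1) \<and> continuous_on {0..R} (v n) \<and> (\<forall>x\<in>{0..R}. 0 < v n x) \<and>
    (\<forall>x. 0 < x \<longrightarrow> x < R \<longrightarrow> (v n has_real_derivative a x + (k x + d n) / v n x) (at x))"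
    by (rule exE)
  note v_n = v_ex[THEN spec]
  have v0: "v n 0 = d n / (A + 1)" and vc: "continuous_on {0..R} (v n)" for n
    by (rule v_n[THEN conjunct1] v_n[THEN conjunct2, THEN conjunct1])+
  have vp: "0 < v n x" if "x \<in> {0..R}" for n x
    by (rule v_n[THEN conjunct2, THEN conjunct2, THEN conjunct1, rule_format, OF that])
  have vd: "(v n has_real_derivative a x + (k x + d n) / v n x) (at x)" if "0 < x" "x < R" for n x
    by (rule v_n[THEN conjunct2, THEN conjunct2, THEN conjunct2, rule_format, OF that])
  \<comment> \<open>Where \<open>v m < v n\<close>, the stronger regularisation also has the smaller
    denominator, so \<open>v m\<close> grows at least as fast as \<open>v n\<close>.\<close>
  have dec: "v n x \<le> v m x" if mn: "m \<le> n" and x: "x \<in> {0..R}" for m n x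
  proof -
    have dd: "d n \<le> d m" using mn by (simp add: d_def frac_le)
    have "0 \<le> v m x - v n x"
    proof (rule nonneg_of_deriv_nonneg_where_neg[of 0 R "\<lambda>x. v m x - v n x"])
      show "0 \<le> v m 0 - v n 0" using dd A0 by (simp add: v0 divide_right_mono)
      show "\<exists>D\<ge>0. ((\<lambda>x. v m x - v n x) has_real_derivative D) (at x)"
        if y: "0 < x" "x < R" "v m x - v n x < 0" for x
      proof (intro exI conjI)
        show "((\<lambda>x. v m x - v n x) has_real_derivative (a x + (k x + d m) / v m x) - (a x + (k x + d n) / v n x)) (at x)"
          by (intro DERIV_diff vd y)
        have "(k x + d n) / v n x \<le> (k x + d m) / v m x"
          using dd y vp[of x m] k_nonneg[of x] d(1)[of n] by (intro frac_le) auto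
        then show "0 \<le> (a x + (k x + d m) / v m x) - (a x + (k x + d n) / v n x)" by simp
      qed
    qed (use x vc in \<open>auto intro!: continuous_intros\<close>)
    then show ?thesis by simp
  qed
  \<comment> \<open>Above the line the solution exceeds \<open>e\<close>, so the singular term is at
    most \<open>(M + 1) / e\<close>, the \<open>1\<close> bounding \<open>d n\<close>; the slope
    then does not exceed that of the line.\<close>
  have upper: "v n x \<le> e + (A + (M + 1) / e) * x" if e: "0 < e" "d n \<le> e" and x: "x \<in> {0..R}" for n e x
  proof -
    define C where "C = A + (M + 1) / e"
    have C0: "0 \<le> C" using A0 M0 e by (simp add: C_def)
    have "0 \<le> e + C * x - v n x"
    proof (rule nonneg_of_deriv_nonneg_where_neg[of 0 R "\<lambda>x. e + C * x - v n x"])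
      have "d n / (A + 1) \<le> d n / 1" using A0 d(1)[of n] by (intro divide_left_mono) auto
      then show "0 \<le> e + C * 0 - v n 0" using e by (simp add: v0)
      show "\<exists>D\<ge>0. ((\<lambda>x. e + C * x - v n x) has_real_derivative D) (at x)"
        if y: "0 < x" "x < R" "e + C * x - v n x < 0" for x
      proof (intro exI conjI)
        show "((\<lambda>x. e + C * x - v n x) has_real_derivative C - (a x + (k x + d n) / v n x)) (at x)"
          using vd[OF y(1,2), of n] by (auto intro!: derivative_eq_intros)
        have "e \<le> v n x" using y C0 mult_nonneg_nonneg[of C x] by linarith
        then have "(k x + d n) / v n x \<le> (M + 1) / e"
          using M[of x] y d[of n] e M0 by (intro frac_le) auto
        then show "0 \<le> C - (a x + (k x + d n) / v n x)" using A[of x] y by (auto simp: C_def)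
      qed
    qed (use x vc in \<open>auto intro!: continuous_intros\<close>)
    then show ?thesis by (simp add: C_def)
  qed
  have lower: "\<exists>m>0. \<forall>n. \<forall>x\<in>{y1..y2}. m \<le> v n x" if y: "0 < y1" "y1 \<le> y2" "y2 < R" for y1 y2
  proof -
    \<comment> \<open>A barrier that starts from \<open>0\<close> at half of \<open>y1\<close> has
      positive height on all of \<open>[y1, y2]\<close>, uniformly in \<open>n\<close>.\<close>
    define x1 where "x1 = y1 / 2"
    have x1: "0 < x1" "x1 < y1" using y by (auto simp: x1_def)
    obtain z where z: "z \<in> {x1..y2}" "\<And>x. x \<in> {x1..y2} \<Longrightarrow> k z \<le> k x"
    proof -
      have "{x1..y2} \<noteq> {}" "continuous_on {x1..y2} k"
        using y x1 by (auto intro: continuous_on_subset[OF k])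
      from continuous_attains_inf[OF compact_Icc this] show thesis using that by blast
    qed
    define \<kappa> where "\<kappa> = k z"
    have \<kappa>: "0 < \<kappa>" using k_pos[of z] z(1) x1 y by (simp add: \<kappa>_def)
    \<comment> \<open>The second bound keeps the whole barrier below
      \<open>\<kappa> / (A + 1)\<close>. There the singular term is at least \<open>A + 1\<close>,
      so the solution rises with slope at least \<open>1\<close>, not slower than the
      barrier.\<close>
    define \<sigma> where "\<sigma> = min 1 (\<kappa> / ((A + 1) * R))"
    have "0 < (A + 1) * R" using A0 R by simp
    then have \<sigma>: "0 < \<sigma>" "\<sigma> \<le> 1" "\<sigma> \<le> \<kappa> / ((A + 1) * R)"
      using \<kappa> by (auto simp: \<sigma>_def)
    have "\<sigma> * R \<le> \<kappa> / ((A + 1) * R) * R" using \<sigma>(3) R by (intro mult_right_mono) auto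
    then have \<sigma>R: "\<sigma> * R \<le> \<kappa> / (A + 1)" using R by simp
    have ge: "0 \<le> v n x - \<sigma> * (x - x1)" if x: "x \<in> {x1..y2}" for n x
    proof (rule nonneg_of_deriv_nonneg_where_neg[of x1 y2 "\<lambda>x. v n x - \<sigma> * (x - x1)"])
      show "0 \<le> v n x1 - \<sigma> * (x1 - x1)" using vp[of x1 n] x1 y by simp
      show "\<exists>D\<ge>0. ((\<lambda>x. v n x - \<sigma> * (x - x1)) has_real_derivative D) (at x)"
        if t: "x1 < x" "x < y2" "v n x - \<sigma> * (x - x1) < 0" for x
      proof (intro exI conjI)
        have xR: "0 < x" "x < R" using t x1 y by auto
        show "((\<lambda>x. v n x - \<sigma> * (x - x1)) has_real_derivative (a x + (k x + d n) / v n x) - \<sigma>) (at x)"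
          using vd[OF xR, of n] by (auto intro!: derivative_eq_intros)
        have "\<sigma> * (x - x1) \<le> \<sigma> * R" using \<sigma> x1 xR by (intro mult_left_mono) auto
        then have le: "v n x \<le> \<kappa> / (A + 1)" using t(3) \<sigma>R by linarith
        have "A + 1 = \<kappa> / (\<kappa> / (A + 1))" using \<kappa> A0 by simp
        also have "\<dots> \<le> (k x + d n) / v n x"
          using z(2)[of x] t d(1)[of n] le vp[of x n] xR \<kappa> by (intro frac_le) (auto simp: \<kappa>_def)
        finally show "0 \<le> (a x + (k x + d n) / v n x) - \<sigma>" using A[of x] xR \<sigma>(2) by auto
      qed
      show "continuous_on {x1..y2} (\<lambda>x. v n x - \<sigma> * (x - x1))"
        by (intro continuous_intros continuous_on_subset[OF vc]) (use x1 y in auto)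
    qed (use x in auto)
    have "\<sigma> * (y1 - x1) \<le> v n x" if x: "x \<in> {y1..y2}" for n x
    proof -
      have "\<sigma> * (y1 - x1) \<le> \<sigma> * (x - x1)" using x \<sigma>(1) by (intro mult_left_mono) auto
      then show ?thesis using ge[of x n] x x1 by auto
    qed
    then show ?thesis using \<sigma>(1) x1 by (intro exI[of _ "\<sigma> * (y1 - x1)"]) auto
  qed
  define u where "u = (\<lambda>x. lim (\<lambda>n. v n x))"
  have conv: "(\<lambda>n. v n x) \<longlonglongrightarrow> u x" if "x \<in> {0..R}" for x
  proof -
    have "decseq (\<lambda>n. v n x)" using dec that by (auto simp: decseq_def)
    then have "convergent (\<lambda>n. v n x)"
      using decseq_convergent[of "\<lambda>n. v n x" 0] vp[OF that] by (metis convergentI less_imp_le)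
    then show ?thesis by (simp add: u_def convergent_LIMSEQ_iff)
  qed
  have u_nonneg: "0 \<le> u x" if "x \<in> {0..R}" for x
    using LIMSEQ_le_const[OF conv[OF that], of 0] vp[OF that] by (auto intro: less_imp_le)
  have u_pos: "0 < u x" if x: "0 < x" "x < R" for x
  proof -
    obtain m where "0 < m" "\<forall>n. m \<le> v n x" using lower[OF x(1) order_refl x(2)] by auto
    then show ?thesis using LIMSEQ_le_const[OF conv[of x], of m] x by auto
  qed
  have dlim: "d \<longlonglongrightarrow> 0"
    unfolding d_def using LIMSEQ_inverse_real_of_nat by (simp add: inverse_eq_divide add.commute)
  have u_upper: "u x \<le> e + (A + (M + 1) / e) * x" if e: "0 < e" and x: "x \<in> {0..R}" for e x
  proof -
    have "\<forall>\<^sub>F n in sequentially. d n < e" using order_tendstoD(2)[OF dlim e] .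
    then obtain N where N: "\<And>n. N \<le> n \<Longrightarrow> d n < e" by (auto simp: eventually_sequentially)
    have "v n x \<le> e + (A + (M + 1) / e) * x" if "N \<le> n" for n
      using upper[OF e _ x] N[OF that] by simp
    then show ?thesis by (intro LIMSEQ_le_const2[OF conv[OF x]]) blast
  qed
  have u_deriv: "(u has_real_derivative a x + k x / u x) (at x)" if x: "0 < x" "x < R" for x
  proof -
    define y1 y2 where "y1 = x / 2" and "y2 = (x + R) / 2"
    have y: "0 < y1" "y1 < x" "x < y2" "y2 < R" using x by (auto simp: y1_def y2_def)
    have sub: "{y1..y2} \<subseteq> {0..R}" using y by auto
    obtain m where m: "0 < m" "\<And>n x. x \<in> {y1..y2} \<Longrightarrow> m \<le> v n x" using lower[of y1 y2] y by auto
    \<comment> \<open>On \<open>[y1, y2]\<close> the singular terms are bounded uniformly in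
      \<open>n\<close>, so the integral equation survives the limit. It yields first the continuity
      of \<open>u\<close> and then its derivative.\<close>
    have fi: "((\<lambda>t. a t + (k t + d n) / v n t) has_integral v n z - v n y1) {y1..z}" if z: "z \<in> {y1..y2}" for n z
      by (rule ftc_real, use z in simp, rule vd) (use z y in auto)
    have lims: "(\<lambda>t. a t + k t / u t) integrable_on {y1..z} \<and> u z - u y1 = integral {y1..z} (\<lambda>t. a t + k t / u t)"
      if z: "z \<in> {y1..y2}" for z
    proof -
      have zz: "t \<in> {0..R}" "t \<in> {y1..y2}" "0 < t" "t < R" if "t \<in> {y1..z}" for t using that z y by auto
      have i: "(\<lambda>t. a t + (k t + d n) / v n t) integrable_on {y1..z}" for n using fi[OF z] by blast
      have le: "norm (a t + (k t + d n) / v n t) \<le> A + (M + 1) / m" if t: "t \<in> {y1..z}" for n t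
      proof -
        have "\<bar>(k t + d n) / v n t\<bar> = (k t + d n) / v n t"
          using k_nonneg[of t] d(1)[of n] vp[of t n] zz[OF t] by (simp add: less_imp_le)
        also have "\<dots> \<le> (M + 1) / m"
          using M[of t] d[of n] m(1) m(2)[of t n] zz[OF t] M0 by (intro frac_le) auto
        finally have "\<bar>a t\<bar> + \<bar>(k t + d n) / v n t\<bar> \<le> A + (M + 1) / m"
          using A[of t] zz[OF t] by (intro add_mono) auto
        then show ?thesis unfolding real_norm_def by (rule order_trans[OF abs_triangle_ineq])
      qed
      have cv: "(\<lambda>n. a t + (k t + d n) / v n t) \<longlonglongrightarrow> a t + k t / u t" if t: "t \<in> {y1..z}" for t
      proof -
        have "(\<lambda>n. a t + (k t + d n) / v n t) \<longlonglongrightarrow> a t + (k t + 0) / u t"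
          using u_pos[of t] zz[OF t] by (intro tendsto_intros dlim conv) auto
        then show ?thesis by simp
      qed
      note dc = dominated_convergence[OF i integrable_const_ivl le cv]
      have "(\<lambda>n. v n z - v n y1) \<longlonglongrightarrow> u z - u y1" by (intro tendsto_diff conv) (use z y in auto)
      moreover have "integral {y1..z} (\<lambda>t. a t + (k t + d n) / v n t) = v n z - v n y1" for n
        by (rule integral_unique[OF fi[OF z]])
      ultimately show ?thesis using dc LIMSEQ_unique by auto
    qed
    have eq: "u z = u y1 + integral {y1..z} (\<lambda>t. a t + k t / u t)" if "z \<in> {y1..y2}" for z
      using lims[OF that] by simp
    have "continuous_on {y1..y2} (\<lambda>z. u y1 + integral {y1..z} (\<lambda>t. a t + k t / u t))"
      using lims[of y2] y by (intro continuous_intros indefinite_integral_continuous_1) auto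
    then have uc: "continuous_on {y1..y2} u"
      by (rule continuous_on_eq) (rule eq[symmetric])
    have "u t \<noteq> 0" if "t \<in> {y1..y2}" for t using u_pos[of t] that y by auto
    then have "continuous_on {y1..y2} (\<lambda>t. a t + k t / u t)"
      by (intro continuous_intros continuous_on_subset[OF a sub] continuous_on_subset[OF k sub] uc) blast
    then have "((\<lambda>z. integral {y1..z} (\<lambda>t. a t + k t / u t)) has_real_derivative a x + k x / u x) (at x within {y1..y2})"
      by (rule integral_has_real_derivative) (use y in auto)
    then have "((\<lambda>z. integral {y1..z} (\<lambda>t. a t + k t / u t)) has_real_derivative a x + k x / u x) (at x)"
      using y by (simp add: at_within_Icc_at)
    then have "((\<lambda>z. u y1 + integral {y1..z} (\<lambda>t. a t + k t / u t)) has_real_derivative 0 + (a x + k x / u x)) (at x)"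
      by (intro DERIV_add DERIV_const)
    then have "((\<lambda>z. u y1 + integral {y1..z} (\<lambda>t. a t + k t / u t)) has_real_derivative a x + k x / u x) (at x)"
      by simp
    then show ?thesis
      by (rule has_field_derivative_transform_within_open[of _ _ _ "{y1<..<y2}"])
        (use y in \<open>auto intro!: eq[symmetric]\<close>)
  qed
  have u_0: "(u \<longlongrightarrow> 0) (at_right 0)"
  proof (rule order_tendstoI)
    fix e :: real assume "e < 0"
    then show "\<forall>\<^sub>F x in at_right 0. e < u x"
      unfolding eventually_at_right_field using R u_pos by (intro exI[of _ R]) force
  next
    fix e :: real assume e: "0 < e"
    \<comment> \<open>Half of \<open>e\<close> is the height of the barrier at \<open>0\<close>, the
      other half its rise.\<close>
    define C where "C = A + (M + 1) / (e / 2)"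
    have C: "0 < C" using A0 M0 e by (simp add: C_def add_nonneg_pos)
    show "\<forall>\<^sub>F x in at_right 0. u x < e"
      unfolding eventually_at_right_field
    proof (intro exI[of _ "min R (e / (2 * C))"] conjI allI impI)
      show "0 < min R (e / (2 * C))" using R e C by simp
      fix x assume x: "0 < x" "x < min R (e / (2 * C))"
      have "u x \<le> e / 2 + C * x" unfolding C_def by (rule u_upper) (use e x in auto)
      also have "C * x < e / 2" using x C by (simp add: field_simps)
      finally show "u x < e" by simp
    qed
  qed
  show ?thesis
  proof (rule that[of u "1 + (A + (M + 1)) * R"])
    show "0 < u x \<and> u x \<le> 1 + (A + (M + 1)) * R" if x: "0 < x" "x < R" for x
    proof -
      have "u x \<le> 1 + (A + (M + 1) / 1) * x" by (rule u_upper) (use x in auto)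
      moreover have "(A + (M + 1)) * x \<le> (A + (M + 1)) * R" using A0 M0 x by (intro mult_left_mono) auto
      ultimately show ?thesis using u_pos[OF x] by simp
    qed
  qed (use u_deriv u_0 in auto)
qed

subsection \<open>Construction of the profile\<close>

lemma ftc_real_strong:
  fixes G G' :: "real \<Rightarrow> real"
  assumes "finite N" "a \<le> b" "continuous_on {a..b} G"
    and "\<And>x. x \<in> {a<..<b} - N \<Longrightarrow> (G has_real_derivative G' x) (at x)"
  shows "(G' has_integral (G b - G a)) {a..b}"
  using assms(1,2) assms(4)[unfolded has_real_derivative_iff_has_vector_derivative] assms(3)
  by (rule fundamental_theorem_of_calculus_interior_strong)

text \<open>\<open>H\<close> is the travel time along the trajectory. The profile is \<open>R - H\<^sup>-\<^sup>1\<close> on the range \<open>front\<close> of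
  \<open>H\<close>, continued by \<open>R\<close> to the left; \<open>contact\<close> holds the point where it leaves \<open>R\<close>, if there is one, and \<open>z\<close>
  is \<open>D(\<phi>) \<phi>'\<close>.\<close>

locale hodograph = trajectory R c f h D g u
  for R c f h D g u +
  fixes H :: "real \<Rightarrow> real" and B :: real
  assumes H_deriv: "\<And>x. 0 < x \<Longrightarrow> x < R \<Longrightarrow> (H has_real_derivative D (R - x) / u x) (at x)"
    and u_le: "\<And>x. 0 < x \<Longrightarrow> x < R \<Longrightarrow> u x \<le> B"
begin

definition front :: "real set" where "front = H ` {0<..<R}"

definition \<omega> :: real where "\<omega> = Sup front"

definition \<phi> :: "real \<Rightarrow> real" where
  "\<phi> \<xi> = (if \<xi> \<in> front then R - inv_into {0<..<R} H \<xi> else R)"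

definition contact :: "real set" where
  "contact = {\<xi>. \<xi> < \<omega> \<and> \<xi> \<notin> front \<and> (\<forall>\<eta>. \<xi> < \<eta> \<longrightarrow> \<eta> < \<omega> \<longrightarrow> \<eta> \<in> front)}"

definition z :: "real \<Rightarrow> real" where "z \<xi> = (if \<xi> \<in> front then - u (R - \<phi> \<xi>) else 0)"

section \<open>The travel time and its range\<close>

lemma E_pos: "0 < x \<Longrightarrow> x < R \<Longrightarrow> 0 < D (R - x)" using D_pos[of "R - x"] by simp

lemma H_less: assumes "0 < x" "x < y" "y < R" shows "H x < H y"
proof (rule DERIV_pos_imp_increasing[OF assms(2)])
  fix t assume "x \<le> t" "t \<le> y"
  then have t: "0 < t" "t < R" using assms by auto
  then have "0 < D (R - t) / u t" using E_pos u_pos by simp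
  then show "\<exists>d. (H has_real_derivative d) (at t) \<and> 0 < d" using H_deriv[OF t] by blast
qed

lemma H_less_iff: "0 < x \<Longrightarrow> x < R \<Longrightarrow> 0 < y \<Longrightarrow> y < R \<Longrightarrow> H x < H y \<longleftrightarrow> x < y"
  using H_less[of x y] H_less[of y x] by (cases x y rule: linorder_cases) auto

lemma H_inj: "inj_on H {0<..<R}"
  by (rule inj_onI) (metis H_less_iff greaterThanLessThan_iff less_irrefl linorder_neqE_linordered_idom)

lemma H_isCont: "0 < x \<Longrightarrow> x < R \<Longrightarrow> isCont H x" using H_deriv by (blast intro: DERIV_isCont)

text \<open>For \<open>x >= R/2\<close> the source is at least \<open>g m > 0\<close>, and because
  \<open>H' = D / u\<close> the equation gives \<open>u' >= - A + g m * H'\<close>. Hence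
  \<open>u + A x - g m * H\<close> is nondecreasing, and the bound \<open>B\<close> on
  \<open>u\<close> becomes a bound on the travel time.\<close>

lemma H_bdd_above: "bdd_above front"
proof -
  obtain A where "\<And>s. s \<in> {0..R} \<Longrightarrow> \<bar>h s - c\<bar> \<le> A" using h_bounded by metis
  then have A: "\<bar>h (R - x) - c\<bar> \<le> A" if "x \<in> {0..R}" for x using that by simp
  have "continuous_on {0..R/2} g" using R_pos by (intro continuous_on_subset[OF g_cont]) auto
  moreover have "{0..R/2} \<noteq> {}" using R_pos by simp
  ultimately obtain m where m: "m \<in> {0..R/2}" "\<forall>x\<in>{0..R/2}. g m \<le> g x"
    using continuous_attains_inf[OF compact_Icc] by metis
  have gm: "0 < g m" using m(1) R_pos by (intro g_pos) auto
  define C where "C = (B + A * R - (u (R/2) + A * (R/2) - g m * H (R/2))) / g m"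
  have "H x \<le> max C (H (R/2))" if x: "0 < x" "x < R" for x
  proof (cases "x \<le> R/2")
    case True
    then show ?thesis using H_less[of x "R/2"] x R_pos by (cases "x = R/2") auto
  next
    case False
    define q where "q = (\<lambda>x. u x + A * x - g m * H x)"
    have "q (R/2) \<le> q x"
    proof (rule DERIV_nonneg_imp_nondecreasing[of "R/2" x q])
      fix t assume t: "R/2 \<le> t" "t \<le> x"
      then have tR: "0 < t" "t < R" using x R_pos by auto
      define d where "d = (h (R - t) - c + D (R - t) * g (R - t) / u t) + A * 1 - g m * (D (R - t) / u t)"
      have "(q has_real_derivative d) (at t)" unfolding q_def d_def
        by (intro DERIV_add DERIV_diff DERIV_cmult H_deriv u_deriv tR DERIV_ident)
      moreover have "0 \<le> d"
      proof -
        have "g m * (D (R - t) / u t) \<le> g (R - t) * (D (R - t) / u t)"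
          using m(2) t tR E_pos[OF tR] u_pos[OF tR] by (intro mult_right_mono) auto
        then show ?thesis using A[of t] tR unfolding d_def by (auto simp: mult.commute)
      qed
      ultimately show "\<exists>y. (q has_real_derivative y) (at t) \<and> 0 \<le> y" by blast
    qed (use False in simp)
    moreover have "A * x \<le> A * R" using A[of 0] x R_pos by (intro mult_left_mono) auto
    ultimately have "g m * H x \<le> B + A * R - (u (R/2) + A * (R/2) - g m * H (R/2))"
      using u_le[OF x] unfolding q_def by linarith
    then have "H x \<le> C" using gm unfolding C_def by (simp add: pos_le_divide_eq mult.commute)
    then show ?thesis by simp
  qed
  then show ?thesis unfolding front_def by (intro bdd_aboveI[of _ "max C (H (R/2))"]) auto
qed

lemma H_less_\<omega>: assumes "0 < x" "x < R" shows "H x < \<omega>"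
proof -
  have m: "x < (x + R) / 2" "(x + R) / 2 < R" using assms by (auto simp: field_simps)
  have "H x < H ((x + R) / 2)" using H_less[OF assms(1) m] .
  also have "\<dots> \<le> \<omega>" unfolding \<omega>_def
    by (rule cSup_upper[OF _ H_bdd_above]) (use m assms in \<open>auto simp: front_def\<close>)
  finally show ?thesis .
qed

lemma front_less: "\<xi> \<in> front \<Longrightarrow> \<xi> < \<omega>" using H_less_\<omega> by (auto simp: front_def)

lemma front_upward: assumes "\<xi> \<in> front" "\<xi> \<le> \<eta>" "\<eta> < \<omega>" shows "\<eta> \<in> front"
proof -
  obtain x where x: "0 < x" "x < R" "\<xi> = H x" using assms(1) by (auto simp: front_def)
  obtain y where y: "0 < y" "y < R" "\<eta> < H y"
    using less_cSupD[of front \<eta>] assms unfolding \<omega>_def by (auto simp: front_def)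
  have "x \<le> y" using assms x y H_less_iff[of y x] by (cases "y < x") auto
  moreover have "\<forall>t. x \<le> t \<and> t \<le> y \<longrightarrow> isCont H t" using x y by (auto intro: H_isCont)
  ultimately obtain t where "x \<le> t" "t \<le> y" "H t = \<eta>"
    using IVT[of H x \<eta> y] assms x y by auto
  then show ?thesis using x y by (auto simp: front_def)
qed

section \<open>The profile as inverse of the travel time\<close>

lemma \<phi>_H: "0 < x \<Longrightarrow> x < R \<Longrightarrow> \<phi> (H x) = R - x"
  using inv_into_f_f[OF H_inj, of x] by (auto simp: \<phi>_def front_def)

lemma \<phi>_outside: "\<xi> \<notin> front \<Longrightarrow> \<phi> \<xi> = R" by (simp add: \<phi>_def)

lemma frontE:
  assumes "\<xi> \<in> front" obtains x where "0 < x" "x < R" "\<xi> = H x" "\<phi> \<xi> = R - x"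
  using assms \<phi>_H by (auto simp: front_def)

lemma \<phi>_front: "\<xi> \<in> front \<Longrightarrow> 0 < \<phi> \<xi> \<and> \<phi> \<xi> < R" by (erule frontE) auto

lemma \<phi>_range: "0 < \<phi> \<xi> \<and> \<phi> \<xi> \<le> R"
  using \<phi>_front[of \<xi>] \<phi>_outside[of \<xi>] R_pos by (cases "\<xi> \<in> front") auto

lemma \<phi>_in: "\<phi> \<xi> \<in> {0..R}" using \<phi>_range[of \<xi>] by auto

lemma \<phi>_anti: assumes "\<xi> \<le> \<eta>" "\<eta> < \<omega>" shows "\<phi> \<eta> \<le> \<phi> \<xi>"
proof (cases "\<xi> \<in> front")
  case True
  then have "\<eta> \<in> front" using front_upward assms by blast
  obtain x where x: "0 < x" "x < R" "\<xi> = H x" "\<phi> \<xi> = R - x" using True by (rule frontE)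
  obtain y where y: "0 < y" "y < R" "\<eta> = H y" "\<phi> \<eta> = R - y" using \<open>\<eta> \<in> front\<close> by (rule frontE)
  have "x \<le> y" using H_less_iff[of y x] x y assms(1) by (cases "y < x") auto
  then show ?thesis using x y by simp
qed (use \<phi>_range \<phi>_outside in auto)

lemma \<phi>_near_R: assumes "\<xi> < H x" "0 < x" "x < R" shows "R - x < \<phi> \<xi>"
proof (cases "\<xi> \<in> front")
  case True
  then obtain y where "0 < y" "y < R" "\<xi> = H y" "\<phi> \<xi> = R - y" by (rule frontE)
  then show ?thesis using H_less_iff[of y x] assms by auto
qed (use assms \<phi>_outside in auto)

lemma outside_less: "\<xi> \<notin> front \<Longrightarrow> \<xi> < \<omega> \<Longrightarrow> 0 < x \<Longrightarrow> x < R \<Longrightarrow> \<xi> < H x"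
  using front_upward[of "H x" \<xi>] by (force simp: front_def)

lemma open_front: "open front"
proof -
  have "\<exists>e>0. ball \<xi> e \<subseteq> front" if \<xi>: "\<xi> \<in> front" for \<xi>
  proof -
    obtain x where x: "0 < x" "x < R" "\<xi> = H x" using \<xi> by (rule frontE)
    have "H (x / 2) < \<xi>" using H_less[of "x / 2" x] x by simp
    moreover have "\<xi> < \<omega>" using front_less \<xi> by blast
    moreover have "{H (x / 2)<..<\<omega>} \<subseteq> front"
      using front_upward[of "H (x / 2)"] x by (auto simp: front_def)
    ultimately show ?thesis
      by (metis greaterThanLessThan_iff open_contains_ball open_greaterThanLessThan order_trans)
  qed
  then show ?thesis by (simp add: open_contains_ball)
qed

lemma contact_finite: "finite contact" and contact_unique: "\<alpha> \<in> contact \<Longrightarrow> \<beta> \<in> contact \<Longrightarrow> \<alpha> = \<beta>"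
proof -
  show u: "\<alpha> = \<beta>" if "\<alpha> \<in> contact" "\<beta> \<in> contact" for \<alpha> \<beta>
    using that by (cases \<alpha> \<beta> rule: linorder_cases) (auto simp: contact_def)
  show "finite contact"
  proof (cases "contact = {}")
    case False
    then obtain \<alpha> where "\<alpha> \<in> contact" by blast
    then have "contact \<subseteq> {\<alpha>}" using u by blast
    then show ?thesis by (rule finite_subset) simp
  qed simp
qed

text \<open>Among the points before \<open>\<omega>\<close> outside the range of \<open>H\<close>,
  only the boundary point of the range lacks a neighbourhood on which the profile equals
  \<open>R\<close>. Away from \<open>contact\<close> and the range all derivatives are thus those of
  constants.\<close>

lemma const_nbhd:
  assumes "\<xi> < \<omega>" "\<xi> \<notin> front" "\<xi> \<notin> contact"
  obtains \<eta> where "\<xi> < \<eta>" "\<eta> < \<omega>" "\<And>x. x < \<eta> \<Longrightarrow> x \<notin> front"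
proof -
  obtain \<eta> where \<eta>: "\<xi> < \<eta>" "\<eta> < \<omega>" "\<eta> \<notin> front" using assms by (auto simp: contact_def)
  then show ?thesis using front_upward[of _ \<eta>] that[of \<eta>] by (meson less_imp_le)
qed

lemma \<phi>_deriv_front:
  assumes "\<xi> \<in> front" shows "(\<phi> has_real_derivative z \<xi> / D (\<phi> \<xi>)) (at \<xi>)"
proof -
  obtain x where x: "0 < x" "x < R" "\<xi> = H x" "\<phi> \<xi> = R - x" using assms by (rule frontE)
  define q where "q = inv_into {0<..<R} H"
  have q: "q (H y) = y" if "0 < y" "y < R" for y
    unfolding q_def using that by (intro inv_into_f_f[OF H_inj]) auto
  define d where "d = min x (R - x) / 2"
  have d: "0 < d" "d < x" "d < R - x" using x by (auto simp: d_def min_def)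
  then have near: "\<bar>y - x\<bar> \<le> d \<Longrightarrow> 0 < y \<and> y < R" for y by linarith
  have "isCont q (H x)"
    by (rule isCont_inverse_function[OF d(1)]) (use near q H_isCont in auto)
  obtain e where e: "0 < e" "ball \<xi> e \<subseteq> front" using open_front assms open_contains_ball by blast
  have qq: "H (q y) = y" if "y \<in> front" for y using that by (metis f_inv_into_f q_def front_def)
  have "(q has_real_derivative inverse (D (R - x) / u x)) (at (H x))"
  proof (rule DERIV_inverse_function[where f = H and a = "\<xi> - e" and b = "\<xi> + e"])
    show "(H has_real_derivative D (R - x) / u x) (at (q (H x)))"
      using H_deriv[OF x(1,2)] q[OF x(1,2)] by simp
    show "D (R - x) / u x \<noteq> 0" using E_pos[OF x(1,2)] u_pos[OF x(1,2)] by simp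
    show "H (q y) = y" if "\<xi> - e < y" "y < \<xi> + e" for y
      using that e by (intro qq subsetD[OF e(2)]) (auto simp: dist_real_def)
  qed (use x e \<open>isCont q (H x)\<close> in auto)
  then have "((\<lambda>y. R - q y) has_real_derivative 0 - inverse (D (R - x) / u x)) (at \<xi>)"
    unfolding x(3) by (intro DERIV_diff DERIV_const)
  then have "((\<lambda>y. R - q y) has_real_derivative z \<xi> / D (\<phi> \<xi>)) (at \<xi>)"
    using x assms by (simp add: z_def)
  then show ?thesis
    by (rule has_field_derivative_transform_within_open[OF _ open_front assms]) (simp add: \<phi>_def q_def)
qed

text \<open>Here \<open>z\<close> is \<open>0\<close>, so the quotient is \<open>0\<close> although
  \<open>D R = 0\<close>. The one formula \<open>z / D(\<phi>)\<close> for the slope is therefore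
  valid on both sides of the contact point.\<close>

lemma \<phi>_deriv_outside:
  assumes "\<xi> < \<omega>" "\<xi> \<notin> front" "\<xi> \<notin> contact" shows "(\<phi> has_real_derivative z \<xi> / D (\<phi> \<xi>)) (at \<xi>)"
proof -
  obtain \<eta> where \<eta>: "\<xi> < \<eta>" "\<And>x. x < \<eta> \<Longrightarrow> x \<notin> front" using const_nbhd[OF assms] by metis
  have "((\<lambda>_. R) has_real_derivative z \<xi> / D (\<phi> \<xi>)) (at \<xi>)" using assms by (simp add: z_def)
  then show ?thesis
    by (rule has_field_derivative_transform_within_open[of _ _ _ "{..<\<eta>}"]) (use \<eta> \<phi>_outside in auto)
qed

lemma \<phi>_deriv: "\<xi> < \<omega> \<Longrightarrow> \<xi> \<notin> contact \<Longrightarrow> (\<phi> has_real_derivative z \<xi> / D (\<phi> \<xi>)) (at \<xi>)"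
  using \<phi>_deriv_front \<phi>_deriv_outside by blast

lemma z_eq: assumes "\<xi> < \<omega>" shows "D (\<phi> \<xi>) * deriv \<phi> \<xi> = z \<xi>"
proof (cases "\<xi> \<in> front")
  case True
  then have "deriv \<phi> \<xi> = z \<xi> / D (\<phi> \<xi>)" using \<phi>_deriv_front DERIV_imp_deriv by blast
  then show ?thesis using D_pos[of "\<phi> \<xi>"] \<phi>_front[OF True] by simp
qed (use D_R \<phi>_outside in \<open>simp add: z_def\<close>)

lemma z_nonpos: "z \<xi> \<le> 0"
  using u_pos[of "R - \<phi> \<xi>"] \<phi>_front[of \<xi>] by (auto simp: z_def less_imp_le)

lemma z_deriv:
  assumes "\<xi> < \<omega>" "\<xi> \<notin> contact"
  shows "(z has_real_derivative (h (\<phi> \<xi>) - c) * (z \<xi> / D (\<phi> \<xi>)) - g (\<phi> \<xi>)) (at \<xi>)"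
proof (cases "\<xi> \<in> front")
  case True
  have t: "0 < \<phi> \<xi>" "\<phi> \<xi> < R" using \<phi>_front[OF True] by auto
  have pos: "0 < D (\<phi> \<xi>)" "0 < u (R - \<phi> \<xi>)" using D_pos t u_pos by auto
  have zu: "z \<xi> = - u (R - \<phi> \<xi>)" using True by (simp add: z_def)
  have a: "((\<lambda>\<xi>. R - \<phi> \<xi>) has_real_derivative 0 - z \<xi> / D (\<phi> \<xi>)) (at \<xi>)"
    by (intro DERIV_diff DERIV_const \<phi>_deriv assms)
  have "(u has_real_derivative h (\<phi> \<xi>) - c + D (\<phi> \<xi>) * g (\<phi> \<xi>) / u (R - \<phi> \<xi>)) (at (R - \<phi> \<xi>))"
    using u_deriv[of "R - \<phi> \<xi>"] t by simp
  then have "((\<lambda>\<xi>. - u (R - \<phi> \<xi>)) has_real_derivative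
      - ((h (\<phi> \<xi>) - c + D (\<phi> \<xi>) * g (\<phi> \<xi>) / u (R - \<phi> \<xi>)) * (0 - z \<xi> / D (\<phi> \<xi>)))) (at \<xi>)"
    by (intro DERIV_minus DERIV_chain2[OF _ a])
  moreover have "- ((h (\<phi> \<xi>) - c + D (\<phi> \<xi>) * g (\<phi> \<xi>) / u (R - \<phi> \<xi>)) * (0 - z \<xi> / D (\<phi> \<xi>)))
      = (h (\<phi> \<xi>) - c) * (z \<xi> / D (\<phi> \<xi>)) - g (\<phi> \<xi>)"
    unfolding zu using pos by (simp add: field_simps)
  ultimately have "((\<lambda>\<xi>. - u (R - \<phi> \<xi>)) has_real_derivative (h (\<phi> \<xi>) - c) * (z \<xi> / D (\<phi> \<xi>)) - g (\<phi> \<xi>)) (at \<xi>)"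
    by (simp only:)
  then show ?thesis
    by (rule has_field_derivative_transform_within_open[OF _ open_front True]) (simp add: z_def)
next
  case False
  obtain \<eta> where \<eta>: "\<xi> < \<eta>" "\<And>x. x < \<eta> \<Longrightarrow> x \<notin> front" using const_nbhd[OF assms(1) False assms(2)] by metis
  have "((\<lambda>_. 0) has_real_derivative (h (\<phi> \<xi>) - c) * (z \<xi> / D (\<phi> \<xi>)) - g (\<phi> \<xi>)) (at \<xi>)"
    using False by (simp add: z_def \<phi>_outside g_R)
  then show ?thesis
    by (rule has_field_derivative_transform_within_open[of _ _ _ "{..<\<eta>}"]) (use \<eta> in \<open>auto simp: z_def\<close>)
qed

text \<open>Such a point lies before every \<open>H x\<close>, so nearby points have height above
  \<open>R - x\<close> for each \<open>x\<close>; thus the profile tends to \<open>R\<close>, and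
  the limit \<open>0\<close> of \<open>u\<close> at \<open>0\<close> makes \<open>z\<close> tend to
  \<open>0\<close>.\<close>

lemma cont_outside:
  assumes \<xi>: "\<xi> \<notin> front" "\<xi> < \<omega>"
  shows "isCont \<phi> \<xi>" "isCont z \<xi>"
proof -
  have nb: "\<forall>\<^sub>F y in at \<xi>. y < H x" if "0 < x" "x < R" for x
    using outside_less[OF \<xi> that] by (intro eventually_at_in_open'[of "{..<H x}", simplified])
  have R0: "(\<phi> \<longlongrightarrow> R) (at \<xi>)"
  proof (rule order_tendstoI)
    fix a assume a: "a < R"
    define x where "x = min (R - a) (R / 2)"
    have x: "0 < x" "x < R" "a \<le> R - x" using a R_pos by (auto simp: x_def)
    show "\<forall>\<^sub>F y in at \<xi>. a < \<phi> y"
      using nb[OF x(1,2)] by eventually_elim (use \<phi>_near_R x in fastforce)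
  next
    fix a assume "R < a"
    then show "\<forall>\<^sub>F y in at \<xi>. \<phi> y < a" using \<phi>_range by (intro always_eventually) (meson le_less_trans)
  qed
  then show "isCont \<phi> \<xi>" by (simp add: isCont_def \<phi>_outside \<xi>)
  have "(z \<longlongrightarrow> 0) (at \<xi>)"
  proof (rule order_tendstoI)
    fix a :: real assume a: "a < 0"
    have "\<forall>\<^sub>F x in at_right 0. u x < - a" by (rule order_tendstoD(2)[OF u_0]) (use a in simp)
    then obtain x0 where x0: "0 < x0" "\<And>x. 0 < x \<Longrightarrow> x < x0 \<Longrightarrow> u x < - a"
      unfolding eventually_at_right_field by auto
    define x where "x = min x0 R / 2"
    have x: "0 < x" "x < R" "x < x0" using x0(1) R_pos by (auto simp: x_def)
    show "\<forall>\<^sub>F y in at \<xi>. a < z y"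
      using nb[OF x(1,2)]
    proof eventually_elim
      case (elim y)
      show ?case
      proof (cases "y \<in> front")
        case True
        then have "u (R - \<phi> y) < - a"
          using \<phi>_near_R[OF elim x(1,2)] \<phi>_front[OF True] x by (intro x0(2)) auto
        then show ?thesis using True by (simp add: z_def)
      qed (use a in \<open>simp add: z_def\<close>)
    qed
  next
    fix a :: real assume "0 < a"
    then show "\<forall>\<^sub>F y in at \<xi>. z y < a" using z_nonpos by (intro always_eventually) (meson le_less_trans)
  qed
  then show "isCont z \<xi>" by (simp add: isCont_def z_def \<xi>)
qed

lemma contact_outside: "\<xi> \<in> contact \<Longrightarrow> \<xi> \<notin> front \<and> \<xi> < \<omega> \<and> \<phi> \<xi> = R" by (auto simp: contact_def \<phi>_outside)

lemma \<phi>_isCont: "\<xi> < \<omega> \<Longrightarrow> isCont \<phi> \<xi>"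
  using cont_outside(1) \<phi>_deriv_front by (blast intro: DERIV_isCont)

lemma z_isCont: "\<xi> < \<omega> \<Longrightarrow> isCont z \<xi>"
  using cont_outside(2) z_deriv contact_outside by (blast intro: DERIV_isCont)

lemma \<phi>_cont: "S \<subseteq> {..<\<omega>} \<Longrightarrow> continuous_on S \<phi>" and z_cont: "S \<subseteq> {..<\<omega>} \<Longrightarrow> continuous_on S z"
  using \<phi>_isCont z_isCont by (auto intro!: continuous_at_imp_continuous_on)

lemma F\<phi>_cont: "S \<subseteq> {..<\<omega>} \<Longrightarrow> continuous_on S (\<lambda>\<xi>. F (\<phi> \<xi>))"
  and g\<phi>_cont: "S \<subseteq> {..<\<omega>} \<Longrightarrow> continuous_on S (\<lambda>\<xi>. g (\<phi> \<xi>))"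
  and P\<phi>_cont: "S \<subseteq> {..<\<omega>} \<Longrightarrow> continuous_on S (\<lambda>\<xi>. P (\<phi> \<xi>))"
proof -
  have P: "continuous_on {0..R} P" by (rule DERIV_continuous_on[OF P_deriv_within])
  have r: "\<phi> ` S \<subseteq> {0..R}" for S using \<phi>_in by auto
  show "S \<subseteq> {..<\<omega>} \<Longrightarrow> continuous_on S (\<lambda>\<xi>. F (\<phi> \<xi>))"
    "S \<subseteq> {..<\<omega>} \<Longrightarrow> continuous_on S (\<lambda>\<xi>. g (\<phi> \<xi>))"
    "S \<subseteq> {..<\<omega>} \<Longrightarrow> continuous_on S (\<lambda>\<xi>. P (\<phi> \<xi>))"
    by (rule continuous_on_compose2[OF F_cont \<phi>_cont r] continuous_on_compose2[OF g_cont \<phi>_cont r]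
        continuous_on_compose2[OF P \<phi>_cont r]; assumption)+
qed

section \<open>Absolute continuity and the weak equation\<close>

lemma Z_deriv:
  assumes "\<xi> < \<omega>" "\<xi> \<notin> contact"
  shows "((\<lambda>\<xi>. z \<xi> - F (\<phi> \<xi>)) has_real_derivative - g (\<phi> \<xi>)) (at \<xi>)"
proof (cases "\<xi> \<in> front")
  case True
  have "((\<lambda>\<xi>. z \<xi> - F (\<phi> \<xi>)) has_real_derivative
    ((h (\<phi> \<xi>) - c) * (z \<xi> / D (\<phi> \<xi>)) - g (\<phi> \<xi>)) - (h (\<phi> \<xi>) - c) * (z \<xi> / D (\<phi> \<xi>))) (at \<xi>)"
    by (intro DERIV_diff z_deriv assms DERIV_chain2[where f = F] F_deriv \<phi>_deriv)
      (use \<phi>_front[OF True] in auto)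
  then show ?thesis by simp
next
  case False
  obtain \<eta> where \<eta>: "\<xi> < \<eta>" "\<And>x. x < \<eta> \<Longrightarrow> x \<notin> front" using const_nbhd[OF assms(1) False assms(2)] by metis
  have "((\<lambda>_. - F R) has_real_derivative - g (\<phi> \<xi>)) (at \<xi>)"
    using False by (simp add: \<phi>_outside g_R)
  then show ?thesis
    by (rule has_field_derivative_transform_within_open[of _ _ _ "{..<\<eta>}"])
      (use \<eta> in \<open>auto simp: z_def \<phi>_outside\<close>)
qed

lemma P\<phi>_deriv:
  assumes "\<xi> < \<omega>" "\<xi> \<notin> contact" shows "((\<lambda>\<xi>. P (\<phi> \<xi>)) has_real_derivative z \<xi>) (at \<xi>)"
proof (cases "\<xi> \<in> front")
  case True
  have "((\<lambda>\<xi>. P (\<phi> \<xi>)) has_real_derivative D (\<phi> \<xi>) * (z \<xi> / D (\<phi> \<xi>))) (at \<xi>)"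
    by (intro DERIV_chain2[where f = P] P_deriv \<phi>_deriv assms) (use \<phi>_front[OF True] in auto)
  then show ?thesis using D_pos[of "\<phi> \<xi>"] \<phi>_front[OF True] by simp
next
  case False
  obtain \<eta> where \<eta>: "\<xi> < \<eta>" "\<And>x. x < \<eta> \<Longrightarrow> x \<notin> front" using const_nbhd[OF assms(1) False assms(2)] by metis
  have "((\<lambda>_. P R) has_real_derivative z \<xi>) (at \<xi>)" using False by (simp add: z_def)
  then show ?thesis
    by (rule has_field_derivative_transform_within_open[of _ _ _ "{..<\<eta>}"])
      (use \<eta> in \<open>auto simp: \<phi>_outside\<close>)
qed

lemma P\<phi>_loc_abs_continuous: "loc_abs_continuous_on {..<\<omega>} (\<lambda>\<xi>. P (\<phi> \<xi>))"
  unfolding loc_abs_continuous_on_def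
proof (intro allI impI)
  fix a b assume ab: "{a..b} \<subseteq> {..<\<omega>}"
  show "abs_continuous_on {a..b} (\<lambda>\<xi>. P (\<phi> \<xi>))"
  proof (rule abs_continuous_on_dominated[of "\<lambda>\<xi>. \<bar>z \<xi>\<bar>"])
    show "(\<lambda>\<xi>. \<bar>z \<xi>\<bar>) integrable_on {a..b}"
      by (intro integrable_continuous_real continuous_intros z_cont ab)
    fix s t assume st: "a \<le> s" "s \<le> t" "t \<le> b"
    then have sub: "{s..t} \<subseteq> {..<\<omega>}" by (intro order_trans[OF _ ab]) auto
    have I: "(z has_integral P (\<phi> t) - P (\<phi> s)) {s..t}"
      by (rule ftc_real_strong[OF contact_finite st(2) P\<phi>_cont[OF sub] P\<phi>_deriv])
        (use subsetD[OF sub] in auto)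
    have "norm (integral {s..t} z) \<le> integral {s..t} (\<lambda>\<xi>. \<bar>z \<xi>\<bar>)"
      by (rule integral_norm_bound_integral)
        (use I in \<open>auto intro!: integrable_continuous_real continuous_intros z_cont sub\<close>)
    then show "\<bar>P (\<phi> t) - P (\<phi> s)\<bar> \<le> integral {s..t} (\<lambda>\<xi>. \<bar>z \<xi>\<bar>)"
      using integral_unique[OF I] by simp
  qed auto
qed

text \<open>The derivative of \<open>z\<close> contains \<open>\<phi>' = z / D(\<phi>)\<close>,
  which may be unbounded near the contact point. Writing
  \<open>z = (z - F(\<phi>)) + F(\<phi>)\<close>, the increments of the two parts are controlled by
  the integrals of the nonnegative functions \<open>g(\<phi>)\<close> and
  \<open>- K \<phi>'\<close>; the latter is integrable by the fundamental theorem with a finite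
  exceptional set.\<close>

lemma z_loc_abs_continuous: "loc_abs_continuous_on {..<\<omega>} z"
  unfolding loc_abs_continuous_on_def
proof (intro allI impI)
  fix a b assume ab: "{a..b} \<subseteq> {..<\<omega>}"
  obtain K where K0: "0 \<le> K" and K: "\<And>x. x \<in> {0..R} \<Longrightarrow> \<bar>h x - c\<bar> \<le> K"
    using h_bounded by metis
  have F_lip: "\<bar>F p - F q\<bar> \<le> K * \<bar>p - q\<bar>" if pq: "p \<in> {0..R}" "q \<in> {0..R}" for p q
  proof -
    have *: "\<bar>F b - F a\<bar> \<le> K * (b - a)" if "a < b" "a \<in> {0..R}" "b \<in> {0..R}" for a b
    proof -
      have "F differentiable (at x)" if "a < x" "x < b" for x
        using F_deriv[of x] that \<open>a \<in> {0..R}\<close> \<open>b \<in> {0..R}\<close> unfolding real_differentiable_def by auto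
      moreover have "continuous_on {a..b} F" by (rule continuous_on_subset[OF F_cont]) (use that in auto)
      ultimately have "\<exists>l w. a < w \<and> w < b \<and> (F has_real_derivative l) (at w) \<and> F b - F a = (b - a) * l"
        using that(1) by (intro MVT) auto
      then obtain l w where w: "a < w" "w < b" "(F has_real_derivative l) (at w)" "F b - F a = (b - a) * l" by blast
      have "l = h w - c" using w that by (intro DERIV_unique[OF w(3)] F_deriv) auto
      then show ?thesis using w K[of w] that by (simp add: abs_mult mult.commute mult_left_mono)
    qed
    show ?thesis using *[of p q] *[of q p] pq by (cases p q rule: linorder_cases) (auto simp: abs_minus_commute)
  qed
  define w where "w = (\<lambda>\<xi>. - (- g (\<phi> \<xi>)) + K * (- (z \<xi> / D (\<phi> \<xi>))))"
  have I: "(w has_integral - ((z t - F (\<phi> t)) - (z s - F (\<phi> s))) + K * (- (\<phi> t - \<phi> s))) {s..t}"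
    if st: "s \<le> t" "{s..t} \<subseteq> {..<\<omega>}" for s t
  proof -
    have "((\<lambda>\<xi>. - g (\<phi> \<xi>)) has_integral (z t - F (\<phi> t)) - (z s - F (\<phi> s))) {s..t}"
      by (rule ftc_real_strong[OF contact_finite st(1) _ Z_deriv])
        (use st subsetD[OF st(2)] in \<open>auto intro!: continuous_intros z_cont F\<phi>_cont\<close>)
    then have "((\<lambda>\<xi>. - (- g (\<phi> \<xi>))) has_integral - ((z t - F (\<phi> t)) - (z s - F (\<phi> s)))) {s..t}"
      by (rule has_integral_neg)
    moreover have "((\<lambda>\<xi>. z \<xi> / D (\<phi> \<xi>)) has_integral \<phi> t - \<phi> s) {s..t}"
      by (rule ftc_real_strong[OF contact_finite st(1) \<phi>_cont[OF st(2)] \<phi>_deriv])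
        (use subsetD[OF st(2)] in auto)
    then have "((\<lambda>\<xi>. K * (- (z \<xi> / D (\<phi> \<xi>)))) has_integral K * (- (\<phi> t - \<phi> s))) {s..t}"
      by (intro has_integral_mult_right has_integral_neg)
    ultimately have "((\<lambda>\<xi>. - (- g (\<phi> \<xi>)) + K * (- (z \<xi> / D (\<phi> \<xi>)))) has_integral
        - ((z t - F (\<phi> t)) - (z s - F (\<phi> s))) + K * (- (\<phi> t - \<phi> s))) {s..t}"
      by (rule has_integral_add)
    then show ?thesis by (simp only: w_def)
  qed
  show "abs_continuous_on {a..b} z"
  proof (rule abs_continuous_on_dominated)
      show "w integrable_on {a..b}" using I[OF _ ab] by (cases "a \<le> b") auto
      show "0 \<le> w x" if "x \<in> {a..b}" for x
      proof -
        have "z x / D (\<phi> x) \<le> 0" using D_nonneg[of "\<phi> x"] \<phi>_in[of x] z_nonpos[of x]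
          by (intro divide_nonpos_nonneg) auto
        then have "0 \<le> K * (- (z x / D (\<phi> x)))" using K0 by (intro mult_nonneg_nonneg) auto
        then show ?thesis unfolding w_def using g_nonneg[of "\<phi> x"] \<phi>_in[of x] by simp
      qed
      fix s t assume st: "a \<le> s" "s \<le> t" "t \<le> b"
      then have sub: "{s..t} \<subseteq> {..<\<omega>}" by (intro order_trans[OF _ ab]) auto
      have tw: "t < \<omega>" using sub st by auto
      have gi: "((\<lambda>\<xi>. - g (\<phi> \<xi>)) has_integral (z t - F (\<phi> t)) - (z s - F (\<phi> s))) {s..t}"
        by (rule ftc_real_strong[OF contact_finite st(2) _ Z_deriv])
          (use sub subsetD[OF sub] in \<open>auto intro!: continuous_intros z_cont F\<phi>_cont\<close>)
      have "0 \<le> - ((z t - F (\<phi> t)) - (z s - F (\<phi> s)))"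
        by (rule has_integral_nonneg[OF has_integral_neg[OF gi]]) (use g_nonneg \<phi>_in in auto)
      moreover have "\<bar>F (\<phi> t) - F (\<phi> s)\<bar> \<le> K * \<bar>\<phi> t - \<phi> s\<bar>"
        by (intro F_lip \<phi>_in)
      moreover have "\<phi> t \<le> \<phi> s" by (rule \<phi>_anti[OF st(2) tw])
      ultimately have "\<bar>z t - z s\<bar> \<le> - ((z t - F (\<phi> t)) - (z s - F (\<phi> s))) + K * (- (\<phi> t - \<phi> s))"
        by (simp add: abs_if split: if_splits)
      then show "\<bar>z t - z s\<bar> \<le> integral {s..t} w" using integral_unique[OF I[OF st(2) sub]] by simp
  qed
qed

lemma H_front: "0 < x \<Longrightarrow> x < R \<Longrightarrow> H x \<in> front" by (auto simp: front_def)

lemma R2: "0 < R/2" "R/2 < R" using R_pos by auto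

text \<open>\<open>z - F(\<phi>)\<close> is continuous across the contact point and has derivative
  \<open>- g(\<phi>)\<close> elsewhere, so its product with \<open>\<psi>\<close> can be integrated
  over an interval enclosing the support, with boundary terms \<open>0\<close>.\<close>

lemma weak_equation:
  assumes \<psi>: "test_function {..<\<omega>} \<psi>"
  shows "(LINT \<xi>:{..<\<omega>}|lebesgue. (D (\<phi> \<xi>) * deriv \<phi> \<xi> - f (\<phi> \<xi>) + c * \<phi> \<xi>) * deriv \<psi> \<xi> - g (\<phi> \<xi>) * \<psi> \<xi>) = 0"
proof -
  obtain K where K: "compact K" "K \<subseteq> {..<\<omega>}" "\<And>x. x \<notin> K \<Longrightarrow> \<psi> x = 0"
    and diff: "\<And>n x. ((deriv ^^ n) \<psi>) differentiable (at x)"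
    using \<psi> unfolding test_function_def by blast
  obtain a b where ab: "a < b" "b < \<omega>" "K \<subseteq> {a<..<b}"
  proof (cases "K = {}")
    case True
    then show ?thesis using that[of "\<omega> - 2" "\<omega> - 1"] by simp
  next
    case False
    have K': "Inf K \<in> K" "Sup K \<in> K" "bdd_below K" "bdd_above K"
      using K(1) False by (auto intro!: closed_contains_Inf closed_contains_Sup
          dest: compact_imp_closed compact_imp_bounded bounded_imp_bdd_below bounded_imp_bdd_above)
    then have "Sup K < \<omega>" using K(2) by auto
    moreover have "Inf K \<le> Sup K" using K' by (meson cInf_lower cSup_upper order_trans)
    moreover have "K \<subseteq> {Inf K - 1<..<(Sup K + \<omega>) / 2}"
    proof
      fix x assume "x \<in> K"
      then have "Inf K \<le> x" "x \<le> Sup K" using K' by (auto intro: cInf_lower cSup_upper)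
      then show "x \<in> {Inf K - 1<..<(Sup K + \<omega>) / 2}" using \<open>Sup K < \<omega>\<close> by (auto simp: field_simps)
    qed
    ultimately show ?thesis by (intro that[of "Inf K - 1" "(Sup K + \<omega>) / 2"]) (auto simp: field_simps)
  qed
  have sub: "{a..b} \<subseteq> {..<\<omega>}" using ab by auto
  have d\<psi>: "(\<psi> has_real_derivative deriv \<psi> x) (at x)" for x
    using diff[of 0 x] by (simp add: DERIV_deriv_iff_real_differentiable)
  have out: "\<psi> x = 0 \<and> deriv \<psi> x = 0" if "x \<notin> {a<..<b}" for x
  proof -
    have xK: "x \<in> - K" using that ab by auto
    have "open (- K)" by (intro open_Compl compact_imp_closed K(1))
    have "((\<lambda>_. 0) has_real_derivative 0) (at x)" by simp
    then have "(\<psi> has_real_derivative 0) (at x)"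
      by (rule has_field_derivative_transform_within_open[OF _ \<open>open (- K)\<close> xK]) (use K(3) in auto)
    then show ?thesis using K(3) xK by (auto intro: DERIV_imp_deriv)
  qed
  have cd: "continuous_on S (deriv \<psi>)" "continuous_on S \<psi>" for S
    using diff[of 1] diff[of 0] by (auto intro!: continuous_at_imp_continuous_on differentiable_imp_continuous_within)
  define q where "q = (\<lambda>\<xi>. (z \<xi> - F (\<phi> \<xi>)) * deriv \<psi> \<xi> - g (\<phi> \<xi>) * \<psi> \<xi>)"
  have Zc: "continuous_on {a..b} (\<lambda>\<xi>. z \<xi> - F (\<phi> \<xi>))" by (intro continuous_intros z_cont F\<phi>_cont sub)
  have "continuous_on {a..b} q" unfolding q_def by (intro continuous_intros z_cont F\<phi>_cont g\<phi>_cont sub cd)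
  then have qabs: "q absolutely_integrable_on {a..b}" by (rule absolutely_integrable_continuous_real)
  have "(q has_integral (z b - F (\<phi> b)) * \<psi> b - (z a - F (\<phi> a)) * \<psi> a) {a..b}"
  proof (rule ftc_real_strong[OF contact_finite less_imp_le[OF ab(1)]])
    show "continuous_on {a..b} (\<lambda>\<xi>. (z \<xi> - F (\<phi> \<xi>)) * \<psi> \<xi>)" by (intro continuous_on_mult Zc cd)
    fix x assume "x \<in> {a<..<b} - contact"
    then have x: "x < \<omega>" "x \<notin> contact" using ab by auto
    have "((\<lambda>\<xi>. (z \<xi> - F (\<phi> \<xi>)) * \<psi> \<xi>) has_real_derivative
        - g (\<phi> x) * \<psi> x + deriv \<psi> x * (z x - F (\<phi> x))) (at x)"
      by (rule DERIV_mult[OF Z_deriv[OF x] d\<psi>])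
    then show "((\<lambda>\<xi>. (z \<xi> - F (\<phi> \<xi>)) * \<psi> \<xi>) has_real_derivative q x) (at x)"
      by (simp add: q_def algebra_simps)
  qed
  then have "integral {a..b} q = 0" using out[of a] out[of b] by (simp add: integral_unique)
  then have "(LINT \<xi>:{a..b}|lebesgue. q \<xi>) = 0" using set_lebesgue_integral_eq_integral(2)[OF qabs] by simp
  moreover have "(LINT \<xi>:{..<\<omega>}|lebesgue. (D (\<phi> \<xi>) * deriv \<phi> \<xi> - f (\<phi> \<xi>) + c * \<phi> \<xi>) * deriv \<psi> \<xi> - g (\<phi> \<xi>) * \<psi> \<xi>)
      = (LINT \<xi>:{a..b}|lebesgue. q \<xi>)"
    unfolding set_lebesgue_integral_def
  proof (rule Bochner_Integration.integral_cong[OF refl])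
    fix x :: real
    show "indicat_real {..<\<omega>} x *\<^sub>R ((D (\<phi> x) * deriv \<phi> x - f (\<phi> x) + c * \<phi> x) * deriv \<psi> x - g (\<phi> x) * \<psi> x)
      = indicat_real {a..b} x *\<^sub>R q x"
    proof (cases "x \<in> {a<..<b}")
      case True
      then have x: "x < \<omega>" "x \<in> {a..b}" using ab by auto
      show ?thesis using x by (simp add: q_def z_eq F_def)
    next
      case False
      then show ?thesis using out[OF False] by (simp add: q_def)
    qed
  qed
  ultimately show ?thesis by simp
qed

lemma \<phi>_profile: "tw_profile R f D g c {..<\<omega>} \<phi>"
  unfolding tw_profile_def
proof (intro conjI allI impI)
  show "is_interval {..<\<omega>}" by (rule is_interval_io)
  show "{..<\<omega>} \<noteq> {}" by (metis lessThan_iff empty_iff gt_ex lt_ex)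
  show "\<phi> ` {..<\<omega>} \<subseteq> {0..R}" using \<phi>_in by auto
  show "continuous_on {..<\<omega>} \<phi>" by (rule \<phi>_cont) simp
  have "contact \<in> null_sets lebesgue"
    using contact_finite by (simp add: negligible_iff_null_sets[symmetric] negligible_finite)
  then show "AE \<xi> in lebesgue. \<xi> \<in> {..<\<omega>} \<longrightarrow> \<phi> differentiable at \<xi>"
    by (rule AE_I') (use \<phi>_deriv in \<open>auto simp: real_differentiable_def\<close>)
  show "(\<lambda>\<xi>. D (\<phi> \<xi>) * deriv \<phi> \<xi>) absolutely_integrable_on {a..b}" if ab: "{a..b} \<subseteq> {..<\<omega>}" for a b
  proof (rule absolutely_integrable_continuous_real, rule continuous_on_eq[OF z_cont[OF ab]])
    show "z \<xi> = D (\<phi> \<xi>) * deriv \<phi> \<xi>" if "\<xi> \<in> {a..b}" for \<xi> using z_eq[of \<xi>] that ab by (auto simp: subset_iff)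
  qed
  show "loc_abs_continuous_on {..<\<omega>} (\<lambda>\<xi>. integral {0..\<phi> \<xi>} D)"
    using P\<phi>_loc_abs_continuous by (simp add: P_def)
qed (use weak_equation in auto)

lemma \<phi>_tendsto_R: "(\<phi> \<longlongrightarrow> R) at_bot"
proof (rule order_tendstoI)
  fix a assume a: "a < R"
  define x where "x = min (R - a) (R / 2)"
  have x: "0 < x" "x < R" "a \<le> R - x" using a R_pos by (auto simp: x_def)
  have "\<forall>\<^sub>F y in at_bot. y < H x" by (auto simp: eventually_at_bot_dense)
  then show "\<forall>\<^sub>F y in at_bot. a < \<phi> y"
    by eventually_elim (use \<phi>_near_R x in fastforce)
next
  fix a assume "R < a"
  then show "\<forall>\<^sub>F y in at_bot. \<phi> y < a" using \<phi>_range by (intro always_eventually) (meson le_less_trans)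
qed

lemma \<phi>_antimono: "antimono_on {..<\<omega>} \<phi>"
  using \<phi>_anti by (auto simp: monotone_on_def)

lemma \<phi>_semi_wavefront: "semi_wavefront_from R f D g c R \<omega> \<phi>"
proof -
  have "\<not> \<phi> constant_on {..<\<omega>}"
  proof
    assume "\<phi> constant_on {..<\<omega>}"
    then have "\<phi> (H (R/2)) = \<phi> (H (R/4))"
      using H_less_\<omega>[of "R/2"] H_less_\<omega>[of "R/4"] R_pos unfolding constant_on_def by force
    then show False using R_pos by (simp add: \<phi>_H)
  qed
  then show ?thesis
    unfolding semi_wavefront_from_def
    using \<phi>_profile \<phi>_antimono \<phi>_tendsto_R R_pos g_R by auto
qed

section \<open>Classical or sharp behaviour at the contact point\<close>

lemma classical_off_contact: "T \<subseteq> {..<\<omega>} \<Longrightarrow> (\<And>\<xi>. \<xi> \<in> T \<Longrightarrow> \<phi> differentiable (at \<xi>)) \<Longrightarrow> classical_on h D g c T \<phi>"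
  unfolding classical_on_def
proof (intro conjI ballI)
  assume T: "T \<subseteq> {..<\<omega>}"
  show "loc_abs_continuous_on T (\<lambda>\<xi>. D (\<phi> \<xi>) * deriv \<phi> \<xi>)"
    unfolding loc_abs_continuous_on_def
  proof (intro allI impI)
    fix a b assume ab: "{a..b} \<subseteq> T"
    have "abs_continuous_on {a..b} z"
      using z_loc_abs_continuous ab T unfolding loc_abs_continuous_on_def by blast
    then show "abs_continuous_on {a..b} (\<lambda>\<xi>. D (\<phi> \<xi>) * deriv \<phi> \<xi>)"
      by (rule abs_continuous_on_cong) (use z_eq ab T in \<open>auto simp: subset_iff\<close>)
  qed
  have "contact \<in> null_sets lebesgue"
    using contact_finite by (simp add: negligible_iff_null_sets[symmetric] negligible_finite)
  then show "AE \<xi> in lebesgue. \<xi> \<in> T \<longrightarrow> (\<exists>v. ((\<lambda>\<xi>. D (\<phi> \<xi>) * deriv \<phi> \<xi>) has_real_derivative v) (at \<xi>) \<and>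
      v + (c - h (\<phi> \<xi>)) * deriv \<phi> \<xi> + g (\<phi> \<xi>) = 0)"
  proof (rule AE_I', intro subsetI)
    fix \<xi> assume "\<xi> \<in> {\<xi> \<in> space lebesgue. \<not> (\<xi> \<in> T \<longrightarrow>
      (\<exists>v. ((\<lambda>\<xi>. D (\<phi> \<xi>) * deriv \<phi> \<xi>) has_real_derivative v) (at \<xi>) \<and>
      v + (c - h (\<phi> \<xi>)) * deriv \<phi> \<xi> + g (\<phi> \<xi>) = 0))}"
    then have \<xi>: "\<xi> < \<omega>" and no: "\<not> (\<exists>v. ((\<lambda>\<xi>. D (\<phi> \<xi>) * deriv \<phi> \<xi>) has_real_derivative v) (at \<xi>) \<and>
      v + (c - h (\<phi> \<xi>)) * deriv \<phi> \<xi> + g (\<phi> \<xi>) = 0)"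
      using T by auto
    show "\<xi> \<in> contact"
    proof (rule ccontr)
      assume nc: "\<xi> \<notin> contact"
      have "((\<lambda>\<xi>. D (\<phi> \<xi>) * deriv \<phi> \<xi>) has_real_derivative
          (h (\<phi> \<xi>) - c) * (z \<xi> / D (\<phi> \<xi>)) - g (\<phi> \<xi>)) (at \<xi>)"
        by (rule has_field_derivative_transform_within_open[OF z_deriv[OF \<xi> nc], of "{..<\<omega>}"])
          (use \<xi> z_eq in auto)
      moreover have d: "deriv \<phi> \<xi> = z \<xi> / D (\<phi> \<xi>)" using \<phi>_deriv[OF \<xi> nc] by (rule DERIV_imp_deriv)
      have "((h (\<phi> \<xi>) - c) * (z \<xi> / D (\<phi> \<xi>)) - g (\<phi> \<xi>)) + (c - h (\<phi> \<xi>)) * deriv \<phi> \<xi> + g (\<phi> \<xi>) = 0"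
        unfolding d by (simp only: left_diff_distrib)
      ultimately show False using no by blast
    qed
  qed
qed

lemma classical_if:
  assumes "\<And>\<alpha>. \<alpha> \<in> contact \<Longrightarrow> \<phi> differentiable (at \<alpha>)"
  shows "classical_on h D g c {..<\<omega>} \<phi>"
proof (rule classical_off_contact)
  fix \<xi> assume "\<xi> \<in> {..<\<omega>}"
  then show "\<phi> differentiable (at \<xi>)"
    using \<phi>_deriv[of \<xi>] assms[of \<xi>] unfolding real_differentiable_def by (cases "\<xi> \<in> contact") auto
qed simp

lemma sharp_if:
  assumes "\<alpha> \<in> contact" "\<not> \<phi> differentiable (at \<alpha>)"
  shows "sharp_at h D g c {..<\<omega>} \<phi> R"
  unfolding sharp_at_def
proof (intro conjI bexI[of _ \<alpha>])
  show "classical_on h D g c ({..<\<omega>} - {\<alpha>}) \<phi>"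
  proof (rule classical_off_contact)
    fix \<xi> assume \<xi>: "\<xi> \<in> {..<\<omega>} - {\<alpha>}"
    then have "\<xi> \<notin> contact" using contact_unique[OF _ assms(1)] by auto
    then show "\<phi> differentiable (at \<xi>)" using \<phi>_deriv[of \<xi>] \<xi> unfolding real_differentiable_def by auto
  qed auto
qed (use assms contact_outside g_R in auto)

lemma \<phi>_classical_or_sharp: "classical_or_sharp R h D g c {..<\<omega>} \<phi>"
proof (cases "\<forall>\<alpha>\<in>contact. \<phi> differentiable (at \<alpha>)")
  case True
  then show ?thesis using classical_if by (simp add: classical_or_sharp_def)
next
  case False
  then obtain \<alpha> where "\<alpha> \<in> contact" "\<not> \<phi> differentiable (at \<alpha>)" by blast
  then have "sharp_at h D g c {..<\<omega>} \<phi> R" by (rule sharp_if)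
  then show ?thesis using R_pos unfolding classical_or_sharp_def by (intro disjI2 bexI[of _ R]) auto
qed

text \<open>Near \<open>0\<close> one has \<open>H' = D / u <= 1 / \<sigma>\<close>, so the
  departure from \<open>R\<close> takes finite time and the infimum \<open>\<alpha>\<close> of the
  range is a contact point. Shortly after \<open>\<alpha>\<close> the profile has dropped by at
  least \<open>\<sigma>\<close> times the elapsed time, whereas a derivative at the maximum
  \<open>\<phi> \<alpha> = R\<close> could only be \<open>0\<close>.\<close>

lemma sharp_criterion:
  assumes \<sigma>: "0 < \<sigma>" and x0: "0 < x0" "x0 < R" and le: "\<And>x. 0 < x \<Longrightarrow> x \<le> x0 \<Longrightarrow> \<sigma> * D (R - x) \<le> u x"
  shows "sharp_at h D g c {..<\<omega>} \<phi> R"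
proof -
  have slope: "H x - H y \<le> x / \<sigma>" if xy: "0 < y" "y < x" "x \<le> x0" for x y
  proof -
    have "\<exists>t. y < t \<and> t < x \<and> H x - H y = (x - y) * (D (R - t) / u t)"
      by (rule MVT2[OF xy(2)], rule H_deriv) (use xy x0 in auto)
    then obtain t where t: "y < t" "t < x" "H x - H y = (x - y) * (D (R - t) / u t)" by blast
    then have tr: "0 < t" "t < R" "t \<le> x0" using xy x0 by auto
    have "D (R - t) / u t \<le> 1 / \<sigma>"
      using le[OF tr(1,3)] u_pos[OF tr(1,2)] \<sigma> by (simp add: field_simps)
    then have "(x - y) * (D (R - t) / u t) \<le> (x - y) * (1 / \<sigma>)" using xy by (intro mult_left_mono) auto
    also have "\<dots> \<le> x * (1 / \<sigma>)" using xy \<sigma> by (intro mult_right_mono) auto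
    finally show ?thesis using t by simp
  qed
  have low: "H x - x / \<sigma> \<le> H y" if "0 < x" "x \<le> x0" "0 < y" "y < R" for x y
  proof (cases "y < x")
    case True
    then show ?thesis using slope[of y x] that by simp
  next
    case False
    then have "H x \<le> H y" using H_less[of x y] that x0 by (cases "x = y") auto
    moreover have "0 \<le> x / \<sigma>" using that \<sigma> by simp
    ultimately show ?thesis by linarith
  qed
  have bdd: "bdd_below front"
    using low[OF x0(1) order_refl] by (intro bdd_belowI[of _ "H x0 - x0 / \<sigma>"]) (auto simp: front_def)
  have ne: "front \<noteq> {}" using H_front[OF x0] by auto
  define \<alpha> where "\<alpha> = Inf front"
  have \<alpha>_le: "\<alpha> \<le> H x" if "0 < x" "x < R" for x
    unfolding \<alpha>_def using bdd H_front[OF that] by (rule cInf_lower[rotated])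
  have \<alpha>_ge: "H x - x / \<sigma> \<le> \<alpha>" if "0 < x" "x \<le> x0" for x
    unfolding \<alpha>_def using ne low[OF that] by (intro cInf_greatest) (auto simp: front_def)
  have \<alpha>_less: "\<alpha> < H x" if "0 < x" "x < R" for x
    using \<alpha>_le[of "x/2"] H_less[of "x/2" x] that by simp
  have contact: "\<alpha> \<in> contact"
    unfolding contact_def
  proof (intro CollectI conjI allI impI)
    show "\<alpha> < \<omega>" using \<alpha>_less[OF x0] H_less_\<omega>[OF x0] by simp
    show "\<alpha> \<notin> front"
    proof
      assume "\<alpha> \<in> front"
      then obtain x where x: "0 < x" "x < R" "\<alpha> = H x" by (rule frontE)
      then show False using \<alpha>_less[OF x(1,2)] by simp
    qed
    fix \<eta> assume \<eta>: "\<alpha> < \<eta>" "\<eta> < \<omega>"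
    then obtain t where "t \<in> front" "t < \<eta>" using cInf_lessD[OF ne] unfolding \<alpha>_def by blast
    then show "\<eta> \<in> front" using front_upward \<eta> by auto
  qed
  have "\<not> \<phi> differentiable (at \<alpha>)"
  proof
    assume "\<phi> differentiable (at \<alpha>)"
    then obtain d where d: "(\<phi> has_real_derivative d) (at \<alpha>)" by (auto simp: real_differentiable_def)
    have \<phi>\<alpha>: "\<phi> \<alpha> = R" using contact_outside contact by blast
    have "d = 0"
      by (rule DERIV_local_max[OF d zero_less_one]) (use \<phi>_range \<phi>\<alpha> in auto)
    then have "((\<lambda>y. (\<phi> y - \<phi> \<alpha>) / (y - \<alpha>)) \<longlongrightarrow> 0) (at \<alpha>)"
      using d by (simp add: has_field_derivative_iff)
    then have "\<forall>\<^sub>F y in at \<alpha>. - \<sigma> < (\<phi> y - \<phi> \<alpha>) / (y - \<alpha>)"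
      by (rule order_tendstoD) (use \<sigma> in simp)
    then obtain e where e: "0 < e" "\<And>y. y \<noteq> \<alpha> \<Longrightarrow> dist y \<alpha> < e \<Longrightarrow> - \<sigma> < (\<phi> y - \<phi> \<alpha>) / (y - \<alpha>)"
      unfolding eventually_at by auto
    define y where "y = min (\<alpha> + e / 2) (H x0)"
    have y: "\<alpha> < y" "dist y \<alpha> < e" "y \<le> H x0" using e(1) \<alpha>_less[OF x0] by (auto simp: y_def dist_real_def min_def)
    have "y < \<omega>" using y H_less_\<omega>[OF x0] by simp
    then have "y \<in> front" using contact y by (auto simp: contact_def)
    then obtain x where x: "0 < x" "x < R" "y = H x" "\<phi> y = R - x" by (rule frontE)
    have "x \<le> x0" using H_less_iff[OF x0 x(1,2)] y x by (cases "x0 < x") auto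
    then have "y - \<alpha> \<le> x / \<sigma>" using \<alpha>_ge[of x] x by auto
    then have "(\<phi> y - \<phi> \<alpha>) / (y - \<alpha>) \<le> - \<sigma>"
      using y x \<sigma> \<phi>\<alpha> by (simp add: field_simps)
    then show False using e(2)[of y] y by auto
  qed
  then show ?thesis using sharp_if contact by blast
qed

text \<open>Near \<open>0\<close> the inequality \<open>H' >= 1 / e\<close> limits the drop after a
  contact point to \<open>e\<close> times the elapsed time; as \<open>e\<close> is arbitrary, the
  slope there is \<open>0\<close>. If there is no contact point, differentiability is already
  known.\<close>

lemma classical_criterion:
  assumes "\<And>e. 0 < e \<Longrightarrow> \<exists>x0>0. x0 < R \<and> (\<forall>x. 0 < x \<longrightarrow> x \<le> x0 \<longrightarrow> u x \<le> e * D (R - x))"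
  shows "classical_on h D g c {..<\<omega>} \<phi>"
proof (rule classical_if)
  fix \<alpha> assume contact: "\<alpha> \<in> contact"
  have \<phi>\<alpha>: "\<phi> \<alpha> = R" and out: "\<alpha> \<notin> front" "\<alpha> < \<omega>" using contact_outside contact by auto
  have "((\<lambda>y. (\<phi> y - \<phi> \<alpha>) / (y - \<alpha>)) \<longlongrightarrow> 0) (at \<alpha>)"
  proof (rule tendstoI)
    fix \<epsilon> :: real assume \<epsilon>: "0 < \<epsilon>"
    define e where "e = \<epsilon> / 2"
    have e: "0 < e" "e < \<epsilon>" using \<epsilon> by (auto simp: e_def)
    obtain x0 where x0: "0 < x0" "x0 < R" and le: "\<And>x. 0 < x \<Longrightarrow> x \<le> x0 \<Longrightarrow> u x \<le> e * D (R - x)"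
      using assms[OF e(1)] by blast
    have slope: "(x - y) / e \<le> H x - H y" if xy: "0 < y" "y < x" "x \<le> x0" for x y
    proof -
      have "\<exists>t. y < t \<and> t < x \<and> H x - H y = (x - y) * (D (R - t) / u t)"
        by (rule MVT2[OF xy(2)], rule H_deriv) (use xy x0 in auto)
      then obtain t where t: "y < t" "t < x" "H x - H y = (x - y) * (D (R - t) / u t)" by blast
      then have tr: "0 < t" "t < R" "t \<le> x0" using xy x0 by auto
      have "1 / e \<le> D (R - t) / u t"
        using le[OF tr(1,3)] u_pos[OF tr(1,2)] e by (simp add: field_simps)
      then have "(x - y) * (1 / e) \<le> (x - y) * (D (R - t) / u t)" using xy by (intro mult_left_mono) auto
      then show ?thesis using t by simp
    qed
    \<comment> \<open>The estimate \<open>slope\<close> cannot start at \<open>0\<close>, where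
      \<open>H\<close> is not controlled. Instead \<open>y\<close> tends to \<open>0\<close> while
      \<open>H y\<close> stays above \<open>\<alpha>\<close>.\<close>
    have small: "x \<le> e * (H x - \<alpha>)" if x: "0 < x" "x \<le> x0" for x
    proof (rule field_le_epsilon)
      fix d :: real assume d: "0 < d"
      define y where "y = min d x / 2"
      have y: "0 < y" "y < x" "y \<le> d" using d x by (auto simp: y_def)
      have "x - y \<le> e * (H x - H y)" using slope[OF y(1,2) x(2)] e by (simp add: field_simps)
      also have "\<dots> \<le> e * (H x - \<alpha>)"
        using outside_less[OF out, of y] y x x0 e by (intro mult_left_mono) auto
      finally show "x \<le> e * (H x - \<alpha>) + d" using y by simp
    qed
    have "\<forall>\<^sub>F y in at \<alpha>. y \<in> {..<H x0}"
      using outside_less[OF out x0] by (intro eventually_at_in_open') auto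
    moreover have "\<forall>\<^sub>F y in at \<alpha>. y \<noteq> \<alpha>" by (simp add: eventually_at_filter)
    ultimately show "\<forall>\<^sub>F y in at \<alpha>. dist ((\<phi> y - \<phi> \<alpha>) / (y - \<alpha>)) 0 < \<epsilon>"
    proof eventually_elim
      case (elim y)
      show ?case
      proof (cases "y \<in> front")
        case True
        then obtain x where x: "0 < x" "x < R" "y = H x" "\<phi> y = R - x" by (rule frontE)
        have xx: "x \<le> x0" using H_less_iff[OF x(1,2) x0] elim x by auto
        have "\<alpha> < y" using outside_less[OF out x(1,2)] x by simp
        then have "\<bar>(\<phi> y - \<phi> \<alpha>) / (y - \<alpha>)\<bar> \<le> e"
          using small[OF x(1) xx] x \<phi>\<alpha> by (simp add: abs_if field_simps)
        then show ?thesis using e by simp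
      next
        case False
        then show ?thesis using \<phi>\<alpha> \<epsilon> by (simp add: \<phi>_outside)
      qed
    qed
  qed
  then have "(\<phi> has_real_derivative 0) (at \<alpha>)" by (simp add: has_field_derivative_iff)
  then show "\<phi> differentiable (at \<alpha>)" by (auto simp: real_differentiable_def)
qed

section \<open>Maximality, strictness and uniqueness\<close>

lemma \<phi>_maximal: "maximal_profile R f D g c {..<\<omega>} \<phi>"
  unfolding maximal_profile_def
proof (intro conjI allI impI \<phi>_profile)
  fix J \<theta> assume A: "tw_profile R f D g c J \<theta> \<and> {..<\<omega>} \<subseteq> J \<and> (\<forall>\<xi>\<in>{..<\<omega>}. \<theta> \<xi> = \<phi> \<xi>)"
  show "J = {..<\<omega>}"
  proof (rule ccontr)
    assume "J \<noteq> {..<\<omega>}"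
    then obtain j where j: "j \<in> J" "\<omega> \<le> j" using A by (metis lessThan_iff not_le subset_antisym subsetI)
    have J: "open J" "is_interval J" using A by (auto simp: tw_profile_def)
    have "\<omega> - 1 \<in> J" using A by auto
    \<comment> \<open>Any larger interval contains \<open>\<omega>\<close>, where continuity forces
      the value \<open>0\<close>; this is the situation excluded by
      \<open>no_extension_past_zero\<close>.\<close>
    then have \<omega>J: "\<omega> \<in> J" using open_interval_Icc_subset[OF J(2) _ j(1), of "\<omega> - 1"] j(2) by auto
    obtain Y where Y: "\<And>\<xi>. \<xi> \<in> J \<Longrightarrow> ((\<lambda>\<xi>. P (\<theta> \<xi>)) has_real_derivative Y \<xi>) (at \<xi>)"
      "\<And>\<xi>. \<xi> \<in> J \<Longrightarrow> ((\<lambda>\<xi>. Y \<xi> - F (\<theta> \<xi>)) has_real_derivative - g (\<theta> \<xi>)) (at \<xi>)"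
      using weak_profile_flux A by metis
    interpret fp: flux_profile R c f h D g J \<theta> Y
      by unfold_locales (use A Y J in \<open>auto simp: tw_profile_def\<close>)
    have "\<theta> \<omega> \<le> e" if e: "0 < e" for e
    proof (rule ccontr)
      assume "\<not> \<theta> \<omega> \<le> e"
      then have "\<forall>\<^sub>F y in at \<omega>. e < \<theta> y"
        using fp.\<theta>_isCont[OF \<omega>J] by (intro order_tendstoD(1)[of \<theta> "\<theta> \<omega>"]) (auto simp: isCont_def)
      then obtain d where d: "0 < d" "\<And>y. y \<noteq> \<omega> \<Longrightarrow> dist y \<omega> < d \<Longrightarrow> e < \<theta> y" unfolding eventually_at by auto
      define x where "x = max (R - e) (R / 2)"
      have x: "0 < x" "x < R" "R - x \<le> e" using e R_pos by (auto simp: x_def)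
      define y where "y = max (\<omega> - d / 2) (H x)"
      have y: "y < \<omega>" "dist y \<omega> < d" "H x \<le> y" using d(1) H_less_\<omega>[OF x(1,2)] by (auto simp: y_def dist_real_def max_def)
      have "\<phi> y \<le> \<phi> (H x)" by (rule \<phi>_anti[OF y(3,1)])
      then have "\<theta> y \<le> e" using A y x \<phi>_H[OF x(1,2)] by auto
      then show False using d(2)[of y] y by auto
    qed
    then have "\<theta> \<omega> \<le> 0" using field_le_epsilon[of "\<theta> \<omega>" 0] by simp
    then have "\<theta> \<omega> = 0" using fp.\<theta>_range[OF \<omega>J] by auto
    moreover have "antimono_on (J \<inter> {..<\<omega>}) \<theta>"
      using \<phi>_anti A by (auto simp: monotone_on_def)
    moreover have "H (R/2) \<in> J" "H (R/2) < \<omega>" "0 < \<theta> (H (R/2))"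
      using H_less_\<omega>[OF R2] A \<phi>_range by auto
    ultimately show False using fp.no_extension_past_zero[OF \<omega>J] by blast
  qed
qed

lemma \<phi>_strict: "strict_profile R f D g c {..<\<omega>} \<phi>"
proof -
  have ne: "{..<\<omega>} \<noteq> UNIV" by (metis UNIV_I lessThan_iff less_irrefl)
  moreover have False if "tw_profile R f D g c UNIV \<theta>" "\<forall>\<xi>\<in>{..<\<omega>}. \<theta> \<xi> = \<phi> \<xi>" for \<theta>
    using \<phi>_maximal that ne unfolding maximal_profile_def by (metis subset_UNIV)
  ultimately show ?thesis unfolding strict_profile_def by blast
qed

lemma \<phi>_unique: "unique_from R f h D g c R \<omega> \<phi>"
  unfolding unique_from_def
proof (intro allI impI)
  fix w \<theta> assume "semi_wavefront_from R f D g c R w \<theta> \<and> classical_or_sharp R h D g c {..<w} \<theta>"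
  then have tw: "tw_profile R f D g c {..<w} \<theta>" and mono: "mono_on {..<w} \<theta> \<or> antimono_on {..<w} \<theta>"
    and nonconst: "\<not> \<theta> constant_on {..<w}" and lim: "(\<theta> \<longlongrightarrow> R) at_bot"
    by (auto simp: semi_wavefront_from_def)
  have range: "\<theta> \<xi> \<in> {0..R}" if "\<xi> < w" for \<xi> using tw that by (auto simp: tw_profile_def)
  \<comment> \<open>An increasing function with values at most \<open>R\<close> and limit
    \<open>R\<close> at minus infinity is constant, which rules out the increasing
    alternative.\<close>
  have anti: "antimono_on {..<w} \<theta>"
  proof (rule ccontr)
    assume "\<not> antimono_on {..<w} \<theta>"
    then have m: "mono_on {..<w} \<theta>" using mono by blast
    have "\<theta> \<xi> = R" if \<xi>: "\<xi> < w" for \<xi>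
    proof -
      have "\<forall>\<^sub>F y in at_bot. \<theta> y \<le> \<theta> \<xi>"
        using eventually_le_at_bot[of \<xi>] by eventually_elim (use m \<xi> in \<open>auto simp: monotone_on_def\<close>)
      then have "R \<le> \<theta> \<xi>" by (rule tendsto_upperbound[OF lim]) simp
      then show ?thesis using range[OF \<xi>] by auto
    qed
    then show False using nonconst by (auto simp: constant_on_def)
  qed
  obtain Y where Y: "\<And>\<xi>. \<xi> \<in> {..<w} \<Longrightarrow> ((\<lambda>\<xi>. P (\<theta> \<xi>)) has_real_derivative Y \<xi>) (at \<xi>)"
    "\<And>\<xi>. \<xi> \<in> {..<w} \<Longrightarrow> ((\<lambda>\<xi>. Y \<xi> - F (\<theta> \<xi>)) has_real_derivative - g (\<theta> \<xi>)) (at \<xi>)"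
    using weak_profile_flux[OF tw] by metis
  interpret wv: wavefront R c f h D g w \<theta> Y u
    by unfold_locales (use tw Y range anti lim in \<open>auto simp: tw_profile_def\<close>)
  obtain s where s: "\<And>\<xi>. \<xi> < w \<Longrightarrow> \<theta> \<xi> < R \<Longrightarrow> H (R - \<theta> \<xi>) = \<xi> + s"
    using wv.profile_is_shift[OF H_deriv nonconst] by blast
  have s_front: "\<xi> + s \<in> front \<and> \<phi> (\<xi> + s) = \<theta> \<xi>" if \<xi>: "\<xi> < w" "\<theta> \<xi> < R" for \<xi>
    using s[OF \<xi>] wv.\<theta>_pos[OF \<xi>(1)] \<xi>(2) H_front[of "R - \<theta> \<xi>"] \<phi>_H[of "R - \<theta> \<xi>"] by auto
  obtain p where p: "p < w" "\<theta> p < R"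
  proof -
    have "\<exists>p<w. \<theta> p \<noteq> R" using nonconst by (auto simp: constant_on_def)
    then show ?thesis using that range by force
  qed
  \<comment> \<open>Times near \<open>w\<close> are shifted into the range of \<open>H\<close>,
    which lies below \<open>\<omega>\<close>.\<close>
  have "w + s \<le> \<omega>"
  proof (rule ccontr)
    assume "\<not> w + s \<le> \<omega>"
    then have *: "max p (\<omega> - s) < w" using p by auto
    then have "\<theta> (max p (\<omega> - s)) < R" using wv.antiD[of p "max p (\<omega> - s)"] p by auto
    then have "max p (\<omega> - s) + s < \<omega>" using s_front[OF *] front_less by auto
    then show False by auto
  qed
  moreover have "\<theta> \<xi> = \<phi> (\<xi> + s)" if \<xi>: "\<xi> < w" for \<xi>
  proof (cases "\<theta> \<xi> < R")
    case True
    then show ?thesis using s_front[OF \<xi>] by simp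
  next
    case False
    then have \<theta>R: "\<theta> \<xi> = R" using range[OF \<xi>] by auto
    \<comment> \<open>Otherwise \<open>\<phi>\<close> would already be down at \<open>R - x\<close>
      there. But \<open>\<theta>\<close> takes a value \<open>v\<close> between \<open>R - x\<close>
      and \<open>R\<close> at some time from \<open>\<xi>\<close> on, while the travel time of
      \<open>v\<close> is less than \<open>H x\<close>.\<close>
    have "\<xi> + s \<notin> front"
    proof
      assume "\<xi> + s \<in> front"
      then obtain x where x: "0 < x" "x < R" "\<xi> + s = H x" by (rule frontE)
      have \<xi>p: "\<xi> < p" using wv.antiD[of p \<xi>] p \<theta>R \<xi> by (cases "\<xi> < p") auto
      define v where "v = max (\<theta> p) (R - x / 2)"
      have v: "\<theta> p \<le> v" "v < R" "R - x < v" using p x by (auto simp: v_def)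
      have "continuous_on {\<xi>..p} \<theta>" by (rule continuous_on_subset[OF wv.\<theta>_cont]) (use p in auto)
      then obtain \<eta> where \<eta>: "\<xi> \<le> \<eta>" "\<eta> \<le> p" "\<theta> \<eta> = v"
        using IVT2'[of \<theta> p v \<xi>] v \<theta>R \<xi>p by auto
      have "H (R - v) = \<eta> + s" using s[of \<eta>] \<eta> v p by auto
      moreover have "H (R - v) < H x" using v x by (intro H_less) auto
      ultimately show False using \<eta> x by auto
    qed
    then show ?thesis using \<theta>R by (simp add: \<phi>_outside)
  qed
  ultimately show "\<exists>s. w + s \<le> \<omega> \<and> (\<forall>\<xi><w. \<theta> \<xi> = \<phi> (\<xi> + s))" by blast
qed

end

subsection \<open>Behaviour of the trajectory at the degenerate state\<close>

context trajectory
begin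

text \<open>Extension of \<open>u\<close> by its limit at the singular endpoint, so that barriers
  can start at \<open>x = 0\<close>, where they touch \<open>u\<close>.\<close>

definition u0 :: "real \<Rightarrow> real" where "u0 x = (if x \<le> 0 then 0 else u x)"

lemma u0_deriv:
  assumes "0 < x" "x < R"
  shows "(u0 has_real_derivative h (R - x) - c + D (R - x) * g (R - x) / u x) (at x)"
  by (rule has_field_derivative_transform_within_open[OF u_deriv[OF assms], of "{0<..}"])
    (use assms in \<open>auto simp: u0_def\<close>)

lemma u0_cont: assumes "0 < b" "b < R" shows "continuous_on {0..b} u0"
proof -
  have "continuous (at x within {0..b}) u0" if x: "x \<in> {0..b}" for x
  proof (cases "x = 0")
    case True
    have "(u0 \<longlongrightarrow> 0) (at_right 0)"
      by (rule Lim_transform_eventually[OF u_0])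
        (auto simp: eventually_at_right_field u0_def intro!: exI[of _ 1])
    then show ?thesis using True assms by (simp add: continuous_within at_within_Icc_at_right u0_def)
  next
    case False
    then have "isCont u0 x" using u0_deriv[of x] x assms by (intro DERIV_isCont) auto
    then show ?thesis by (rule continuous_at_imp_continuous_at_within)
  qed
  then show ?thesis by (simp add: continuous_on_eq_continuous_within)
qed

lemma near_0_gt:
  assumes "continuous_on {0..R} (m :: real \<Rightarrow> real)" "k < m R"
  obtains b where "0 < b" "b < R" "\<And>x. 0 \<le> x \<Longrightarrow> x \<le> b \<Longrightarrow> k < m (R - x)"
proof -
  have "continuous (at R within {0..R}) m"
    using assms(1) R_pos by (auto simp: continuous_on_eq_continuous_within)
  then have "\<forall>\<^sub>F y in at R within {0..R}. k < m y"
    using assms(2) by (intro order_tendstoD(1)[of m "m R"]) (auto simp: continuous_within)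
  then obtain d where d: "0 < d" "\<And>y. y \<in> {0..R} \<Longrightarrow> y \<noteq> R \<Longrightarrow> dist y R < d \<Longrightarrow> k < m y"
    unfolding eventually_at by auto
  define b where "b = min (d / 2) (R / 2)"
  have b: "0 < b" "b < R" "b < d" using d(1) R_pos by (auto simp: b_def)
  show ?thesis
  proof (rule that[OF b(1,2)])
    fix x assume x: "0 \<le> x" "x \<le> b"
    show "k < m (R - x)"
      using d(2)[of "R - x"] x b assms(2) by (cases "x = 0") (auto simp: dist_real_def)
  qed
qed

lemma D_lipschitz_at_R:
  assumes "C1_on {0..R} D dD"
  obtains L where "0 < L" "\<And>x. 0 < x \<Longrightarrow> x < R \<Longrightarrow> D (R - x) \<le> L * x"
proof -
  have dc: "continuous_on {0..R} dD"
    and dd: "\<And>x. x \<in> {0..R} \<Longrightarrow> (D has_real_derivative dD x) (at x within {0..R})"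
    using assms by (auto simp: C1_on_def)
  obtain L where L: "\<And>x. x \<in> {0..R} \<Longrightarrow> \<bar>dD x\<bar> \<le> L" using abs_bounded_on_Icc[OF dc] by metis
  have "D (R - x) \<le> (L + 1) * x" if x: "0 < x" "x < R" for x
  proof -
    have "\<exists>l w. R - x < w \<and> w < R \<and> (D has_real_derivative l) (at w) \<and> D R - D (R - x) = (R - (R - x)) * l"
    proof (rule MVT)
      show "continuous_on {R - x..R} D" by (rule continuous_on_subset[OF D_cont]) (use x in auto)
      show "D differentiable (at w)" if "R - x < w" "w < R" for w
        using dd[of w] that x unfolding real_differentiable_def by (auto simp: at_within_Icc_at)
    qed (use x in simp)
    then obtain l w where w: "R - x < w" "w < R" "(D has_real_derivative l) (at w)" "D R - D (R - x) = x * l" by auto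
    have "(D has_real_derivative dD w) (at w)" using dd[of w] w x by (simp add: at_within_Icc_at)
    then have "l = dD w" using w(3) by (intro DERIV_unique)
    then have "D (R - x) = x * (- dD w)" using w(4) D_R by simp
    also have "\<dots> \<le> x * (L + 1)" using L[of w] w x by (intro mult_left_mono) auto
    finally show ?thesis by (simp add: mult.commute)
  qed
  moreover have "0 < L + 1" using L[of 0] R_pos by auto
  ultimately show ?thesis by (intro that[of "L + 1"]) auto
qed

text \<open>Dropping the nonnegative singular term leaves \<open>u' >= h - c\<close>, which near the
  degenerate state exceeds half of the gap \<open>h R - c\<close>.\<close>

lemma u_ge_linear:
  assumes "c < h R"
  obtains \<kappa> b where "0 < \<kappa>" "0 < b" "b < R" "\<And>x. 0 < x \<Longrightarrow> x \<le> b \<Longrightarrow> \<kappa> * x \<le> u x"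
proof -
  define \<kappa> where "\<kappa> = (h R - c) / 2"
  have \<kappa>: "0 < \<kappa>" using assms by (simp add: \<kappa>_def)
  have "c + \<kappa> < h R" using assms by (simp add: \<kappa>_def field_simps)
  then obtain b where b: "0 < b" "b < R" "\<And>x. 0 \<le> x \<Longrightarrow> x \<le> b \<Longrightarrow> c + \<kappa> < h (R - x)"
    using near_0_gt[OF h_cont] by metis
  have ge: "0 \<le> u0 x - \<kappa> * x" if x: "x \<in> {0..b}" for x
  proof (rule nonneg_of_deriv_nonneg_where_neg[of 0 b "\<lambda>x. u0 x - \<kappa> * x"])
    show "continuous_on {0..b} (\<lambda>x. u0 x - \<kappa> * x)" by (intro continuous_intros u0_cont b)
    fix y assume y: "0 < y" "y < b"
    then have yR: "y < R" using b by simp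
    have "((\<lambda>x. u0 x - \<kappa> * x) has_real_derivative
        (h (R - y) - c + D (R - y) * g (R - y) / u y) - \<kappa> * 1) (at y)"
      by (intro DERIV_diff u0_deriv y yR DERIV_cmult DERIV_ident)
    moreover have "0 \<le> D (R - y) * g (R - y) / u y"
      using D_nonneg[of "R - y"] g_nonneg[of "R - y"] u_pos[OF y(1) yR] y yR by simp
    then have "0 \<le> (h (R - y) - c + D (R - y) * g (R - y) / u y) - \<kappa> * 1"
      using b(3)[of y] y by simp
    ultimately show "\<exists>d\<ge>0. ((\<lambda>x. u0 x - \<kappa> * x) has_real_derivative d) (at y)" by blast
  qed (use x in \<open>auto simp: u0_def\<close>)
  have "\<kappa> * x \<le> u x" if "0 < x" "x \<le> b" for x using ge[of x] that by (simp add: u0_def)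
  then show ?thesis using that \<kappa> b by blast
qed

text \<open>\<open>e D(R - x)\<close> is a supersolution. Where \<open>u\<close> lies above it, the
  singular term is at most \<open>g / e\<close>, so it suffices that
  \<open>- e dD - (h - c) - g / e\<close> be positive at \<open>R - x\<close>. At \<open>R\<close>
  this equals \<open>c - h R - e dD R\<close>, positive in both cases because
  \<open>dD R <= 0\<close>; continuity does the rest.\<close>

lemma u_le_small_multiple_of_D:
  assumes D: "C1_on {0..R} D dD" and slope: "h R < c \<or> c = h R \<and> dD R < 0" and e: "0 < e"
  shows "\<exists>x0>0. x0 < R \<and> (\<forall>x. 0 < x \<longrightarrow> x \<le> x0 \<longrightarrow> u x \<le> e * D (R - x))"
proof -
  have dc: "continuous_on {0..R} dD"
    and dd: "\<And>x. x \<in> {0..R} \<Longrightarrow> (D has_real_derivative dD x) (at x within {0..R})"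
    using D by (auto simp: C1_on_def)
  have dDR: "dD R \<le> 0"
  proof (rule ccontr)
    assume "\<not> dD R \<le> 0"
    then obtain d where d: "0 < d" "\<And>k. 0 < k \<Longrightarrow> R - k \<in> {0..R} \<Longrightarrow> k < d \<Longrightarrow> D (R - k) < D R"
      using has_real_derivative_pos_inc_left[OF dd[of R]] R_pos by auto
    define k where "k = min (d / 2) (R / 2)"
    have "0 < k" "k < d" "k < R" using d(1) R_pos by (auto simp: k_def)
    then show False using d(2)[of k] D_R D_nonneg[of "R - k"] by auto
  qed
  define m where "m = (\<lambda>y. - e * dD y - (h y - c) - g y / e)"
  have mR: "0 < m R"
    using slope dDR e mult_nonneg_nonpos[of e "dD R"] mult_pos_neg[of e "dD R"] g_R by (auto simp: m_def)
  have "continuous_on {0..R} m" unfolding m_def by (intro continuous_intros dc h_cont g_cont) (use e in auto)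
  then obtain b where b: "0 < b" "b < R" "\<And>x. 0 \<le> x \<Longrightarrow> x \<le> b \<Longrightarrow> 0 < m (R - x)"
    using near_0_gt mR by metis
  have ge: "0 \<le> e * D (R - x) - u0 x" if x: "x \<in> {0..b}" for x
  proof (rule nonneg_of_deriv_nonneg_where_neg[of 0 b "\<lambda>x. e * D (R - x) - u0 x"])
    have "continuous_on {0..b} (\<lambda>x. D (R - x))"
      by (rule continuous_on_compose2[OF D_cont]) (use b in \<open>auto intro!: continuous_intros\<close>)
    then show "continuous_on {0..b} (\<lambda>x. e * D (R - x) - u0 x)" by (intro continuous_intros u0_cont b)
    fix y assume y: "0 < y" "y < b" "e * D (R - y) - u0 y < 0"
    then have yR: "y < R" using b by simp
    have pos: "0 < D (R - y)" "0 < u y" using D_pos[of "R - y"] u_pos[of y] y yR by auto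
    have "(D has_real_derivative dD (R - y)) (at (R - y))" using dd[of "R - y"] y yR by (simp add: at_within_Icc_at)
    moreover have "((\<lambda>x. R - x) has_real_derivative 0 - 1) (at y)" by (intro DERIV_diff DERIV_const DERIV_ident)
    ultimately have "((\<lambda>x. D (R - x)) has_real_derivative dD (R - y) * (0 - 1)) (at y)" by (rule DERIV_chain2)
    then have "((\<lambda>x. e * D (R - x) - u0 x) has_real_derivative
        e * (dD (R - y) * (0 - 1)) - (h (R - y) - c + D (R - y) * g (R - y) / u y)) (at y)"
      by (intro DERIV_diff DERIV_cmult u0_deriv y yR)
    moreover have "0 \<le> e * (dD (R - y) * (0 - 1)) - (h (R - y) - c + D (R - y) * g (R - y) / u y)"
    proof -
      have "e * D (R - y) \<le> u y" using y by (simp add: u0_def)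
      then have "D (R - y) * g (R - y) / u y \<le> D (R - y) * g (R - y) / (e * D (R - y))"
        using pos e g_nonneg[of "R - y"] y yR by (intro divide_left_mono) auto
      also have "\<dots> = g (R - y) / e" using pos by simp
      finally show ?thesis using b(3)[of y] y by (simp add: m_def)
    qed
    ultimately show "\<exists>d\<ge>0. ((\<lambda>x. e * D (R - x) - u0 x) has_real_derivative d) (at y)" by blast
  qed (use x D_R in \<open>auto simp: u0_def\<close>)
  have "u x \<le> e * D (R - x)" if "0 < x" "x \<le> b" for x using ge[of x] that by (simp add: u0_def)
  then show ?thesis using b by blast
qed

text \<open>The assumed limit bounds \<open>D g\<close> at \<open>R - x\<close> by
  \<open>(1 - L) x\<close> near \<open>x = 0\<close>. Above the line \<open>K x\<close> with
  \<open>K >= 1\<close> one has \<open>u >= x\<close>, so the singular term is at most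
  \<open>1 - L\<close>; the choice \<open>K = A + (1 - L)\<close> absorbs it together with the bound
  \<open>A\<close> on \<open>h - c\<close>.\<close>

lemma u_le_linear:
  assumes L: "L \<le> 0" "((\<lambda>\<rho>. D \<rho> * g \<rho> / (\<rho> - R)) \<longlongrightarrow> L) (at_left R)"
  obtains K b where "0 < K" "0 < b" "b < R" "\<And>x. 0 < x \<Longrightarrow> x \<le> b \<Longrightarrow> u x \<le> K * x"
proof -
  have "\<forall>\<^sub>F \<rho> in at_left R. L - 1 < D \<rho> * g \<rho> / (\<rho> - R)" by (rule order_tendstoD(1)[OF L(2)]) simp
  then obtain r where r: "r < R" "\<And>\<rho>. r < \<rho> \<Longrightarrow> \<rho> < R \<Longrightarrow> L - 1 < D \<rho> * g \<rho> / (\<rho> - R)"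
    unfolding eventually_at_left_field by auto
  define b where "b = min ((R - r) / 2) (R / 2)"
  have "b \<le> (R - r) / 2" "b \<le> R / 2"
    unfolding b_def by (rule min.cobounded1 min.cobounded2)+
  moreover have "0 < b" using r(1) R_pos by (simp add: b_def)
  ultimately have b: "0 < b" "b < R" "b < R - r" using r(1) R_pos by auto
  have kx: "D (R - x) * g (R - x) \<le> (1 - L) * x" if "0 < x" "x \<le> b" for x
    using r(2)[of "R - x"] that b by (simp add: field_simps)
  obtain A where A0: "0 \<le> A" and A: "\<And>x. x \<in> {0..R} \<Longrightarrow> \<bar>h x - c\<bar> \<le> A"
    using h_bounded by metis
  define K where "K = A + (1 - L)"
  have K: "1 \<le> K" using A0 L by (simp add: K_def)
  have ge: "0 \<le> K * x - u0 x" if x: "x \<in> {0..b}" for x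
  proof (rule nonneg_of_deriv_nonneg_where_neg[of 0 b "\<lambda>x. K * x - u0 x"])
    show "continuous_on {0..b} (\<lambda>x. K * x - u0 x)" by (intro continuous_intros u0_cont b)
    fix y assume y: "0 < y" "y < b" "K * y - u0 y < 0"
    then have yR: "y < R" using b by simp
    have "((\<lambda>x. K * x - u0 x) has_real_derivative
        K * 1 - (h (R - y) - c + D (R - y) * g (R - y) / u y)) (at y)"
      by (intro DERIV_diff DERIV_cmult u0_deriv y yR DERIV_ident)
    moreover have "0 \<le> K * 1 - (h (R - y) - c + D (R - y) * g (R - y) / u y)"
    proof -
      have "K * y < u y" using y by (simp add: u0_def)
      moreover have "y \<le> K * y" using mult_right_mono[OF K, of y] y by simp
      ultimately have "y \<le> u y" by linarith
      then have "D (R - y) * g (R - y) / u y \<le> (1 - L) * y / y"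
        using kx[of y] y L by (intro frac_le) auto
      then show ?thesis using A[of "R - y"] y yR by (auto simp: K_def)
    qed
    ultimately show "\<exists>d\<ge>0. ((\<lambda>x. K * x - u0 x) has_real_derivative d) (at y)" by blast
  qed (use x in \<open>auto simp: u0_def\<close>)
  have "u x \<le> K * x" if "0 < x" "x \<le> b" for x using ge[of x] that by (simp add: u0_def)
  then show ?thesis using that K b by (meson less_le_trans zero_less_one)
qed

text \<open>The infinite slope of \<open>D\<close> at \<open>R\<close> means that
  \<open>D(R - x) / x\<close> tends to infinity, so every positive multiple of \<open>D\<close>
  eventually beats a linear bound for \<open>u\<close>, at any speed.\<close>

lemma u_le_small_multiple_of_D_tilde:
  assumes "cond_D_tilde R D g" and e: "0 < e"
  shows "\<exists>x0>0. x0 < R \<and> (\<forall>x. 0 < x \<longrightarrow> x \<le> x0 \<longrightarrow> u x \<le> e * D (R - x))"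
proof -
  obtain L where L: "L \<le> 0" "((\<lambda>\<rho>. D \<rho> * g \<rho> / (\<rho> - R)) \<longlongrightarrow> L) (at_left R)"
    using assms(1) by (auto simp: cond_D_tilde_def)
  obtain K b where K: "0 < K" "0 < b" "b < R" "\<And>x. 0 < x \<Longrightarrow> x \<le> b \<Longrightarrow> u x \<le> K * x"
    by (rule u_le_linear[OF L]) (rule that)
  have "filterlim (\<lambda>\<rho>. (D \<rho> - D R) / (\<rho> - R)) at_bot (at_left R)"
    using assms(1) by (auto simp: cond_D_tilde_def)
  then have "\<forall>\<^sub>F \<rho> in at_left R. (D \<rho> - D R) / (\<rho> - R) \<le> - (K / e)"
    by (simp add: filterlim_at_bot)
  then obtain r where r: "r < R" "\<And>\<rho>. r < \<rho> \<Longrightarrow> \<rho> < R \<Longrightarrow> (D \<rho> - D R) / (\<rho> - R) \<le> - (K / e)"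
    unfolding eventually_at_left_field by auto
  define x0 where "x0 = min ((R - r) / 2) b"
  have "x0 \<le> (R - r) / 2" "x0 \<le> b"
    unfolding x0_def by (rule min.cobounded1 min.cobounded2)+
  moreover have "0 < x0" using r(1) K(2) by (simp add: x0_def)
  ultimately have x0: "0 < x0" "x0 < R" "x0 \<le> b" "x0 < R - r" using r(1) K(3) by auto
  have "u x \<le> e * D (R - x)" if x: "0 < x" "x \<le> x0" for x
  proof -
    have "K * x \<le> e * D (R - x)" using r(2)[of "R - x"] x x0 e D_R by (simp add: field_simps)
    then show ?thesis using K(4)[of x] x x0 by simp
  qed
  then show ?thesis using x0 by blast
qed

end

section \<open>Existence of the wavefront from the degenerate state\<close>

context rd_data
begin

lemma hodograph_exists:
  assumes "trajectory R c f h D g u" "\<And>x. 0 < x \<Longrightarrow> x < R \<Longrightarrow> u x \<le> B"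
  obtains H where "hodograph R c f h D g u H B"
proof -
  interpret tr: trajectory R c f h D g u by fact
  have ucont: "continuous_on {0<..<R} u"
  proof (rule continuous_at_imp_continuous_on, rule ballI)
    show "isCont u x" if "x \<in> {0<..<R}" for x
      using tr.u_deriv[of x] that by (auto intro: DERIV_isCont[of u])
  qed
  have "continuous_on {0<..<R} (\<lambda>x. D (R - x))"
    by (rule continuous_on_compose2[OF D_cont]) (auto intro!: continuous_intros)
  moreover have "\<forall>x\<in>{0<..<R}. u x \<noteq> 0" using tr.u_pos by force
  ultimately have "continuous_on {0<..<R} (\<lambda>x. D (R - x) / u x)"
    using ucont by (intro continuous_on_divide)
  then obtain H where "\<And>x. x \<in> {0<..<R} \<Longrightarrow> (H has_real_derivative D (R - x) / u x) (at x)"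
    using continuous_on_open_interval_primitive[OF open_greaterThanLessThan is_interval_oo] by blast
  then have "hodograph R c f h D g u H B"
    by unfold_locales (use assms(2) in auto)
  then show ?thesis by (rule that)
qed

lemma wavefront_from_exists:
  "\<exists>\<omega> \<phi>. semi_wavefront_from R f D g c R \<omega> \<phi> \<and>
        maximal_profile R f D g c {..<\<omega>} \<phi> \<and>
        strict_profile R f D g c {..<\<omega>} \<phi> \<and>
        classical_or_sharp R h D g c {..<\<omega>} \<phi> \<and>
        unique_from R f h D g c R \<omega> \<phi> \<and>
        (cond_D R D dD \<longrightarrow>
           (c < h R \<longrightarrow> sharp_at h D g c {..<\<omega>} \<phi> R) \<and>
           (h R < c \<longrightarrow> classical_on h D g c {..<\<omega>} \<phi>) \<and>
           (c = h R \<and> dD R < 0 \<longrightarrow> classical_on h D g c {..<\<omega>} \<phi>)) \<and>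
        (cond_D_tilde R D g \<longrightarrow> classical_on h D g c {..<\<omega>} \<phi>)"
proof -
  have refl_cont: "continuous_on {0..R} (\<lambda>x. p (R - x))" if "continuous_on {0..R} p" for p :: "real \<Rightarrow> real"
    by (rule continuous_on_compose2[OF that]) (auto intro!: continuous_intros)
  obtain u B where u: "\<And>x. 0 < x \<Longrightarrow> x < R \<Longrightarrow> 0 < u x \<and> u x \<le> B"
    "\<And>x. 0 < x \<Longrightarrow> x < R \<Longrightarrow> (u has_real_derivative (h (R - x) - c) + D (R - x) * g (R - x) / u x) (at x)"
    "(u \<longlongrightarrow> 0) (at_right 0)"
  proof (rule singular_trajectory_exists[of R "\<lambda>x. h (R - x) - c" "\<lambda>x. D (R - x) * g (R - x)"])
    show "continuous_on {0..R} (\<lambda>x. h (R - x) - c)" "continuous_on {0..R} (\<lambda>x. D (R - x) * g (R - x))"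
      by (intro continuous_intros refl_cont h_cont D_cont g_cont)+
  qed (use R_pos D_nonneg g_nonneg D_pos g_pos in auto)
  have tr: "trajectory R c f h D g u" by unfold_locales (use u in auto)
  obtain H where "hodograph R c f h D g u H B" using hodograph_exists[OF tr] u(1) by blast
  then interpret hodograph R c f h D g u H B .
  have 1: "sharp_at h D g c {..<\<omega>} \<phi> R" if t: "cond_D R D dD" "c < h R"
  proof -
    obtain L where L: "0 < L" "\<And>x. 0 < x \<Longrightarrow> x < R \<Longrightarrow> D (R - x) \<le> L * x"
      using D_lipschitz_at_R[of dD] t(1) unfolding cond_D_def by metis
    obtain \<kappa> b where \<kappa>: "0 < \<kappa>" "0 < b" "b < R" "\<And>x. 0 < x \<Longrightarrow> x \<le> b \<Longrightarrow> \<kappa> * x \<le> u x"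
      using u_ge_linear[OF t(2)] by metis
    \<comment> \<open>Near \<open>0\<close>, \<open>u\<close> grows at least like
      \<open>\<kappa> x\<close> and \<open>D\<close> at most like \<open>L x\<close>; the quotient
      of the two rates bounds the slope away from \<open>0\<close>.\<close>
    show ?thesis
    proof (rule sharp_criterion[of "\<kappa> / L" b])
      fix x assume x: "0 < x" "x \<le> b"
      have "\<kappa> / L * D (R - x) \<le> \<kappa> / L * (L * x)"
        using L(2)[of x] x \<kappa> L(1) by (intro mult_left_mono) auto
      then show "\<kappa> / L * D (R - x) \<le> u x" using \<kappa>(4)[OF x] L(1) by simp
    qed (use \<kappa> L in auto)
  qed
  have 2: "classical_on h D g c {..<\<omega>} \<phi>" if "cond_D R D dD" "h R < c \<or> c = h R \<and> dD R < 0"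
    by (rule classical_criterion, rule u_le_small_multiple_of_D) (use that in \<open>auto simp: cond_D_def\<close>)
  have 3: "classical_on h D g c {..<\<omega>} \<phi>" if "cond_D_tilde R D g"
    by (rule classical_criterion, rule u_le_small_multiple_of_D_tilde[OF that])
  show ?thesis
    by (intro exI[of _ \<omega>] exI[of _ \<phi>] conjI impI \<phi>_semi_wavefront \<phi>_maximal \<phi>_strict
        \<phi>_classical_or_sharp \<phi>_unique 1 2 3) auto
qed

end

subsection \<open>Reflection\<close>

text \<open>The outer minus sign matches the flux \<open>D(\<phi>) \<phi>'\<close>, which changes
  sign when the profile is reflected.\<close>

lemma abs_continuous_on_reflect:
  assumes "abs_continuous_on {a..b} F"
  shows "abs_continuous_on {-b..-a} (\<lambda>x. - F (- x))"
  unfolding abs_continuous_on_def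
proof (intro allI impI)
  fix e :: real assume "0 < e"
  then obtain d where d: "0 < d" "\<forall>(n::nat) s t. (\<forall>i<n. s i \<le> t i \<and> {s i..t i} \<subseteq> {a..b}) \<and>
      disjoint_family_on (\<lambda>i. {s i<..<t i}) {..<n} \<and> (\<Sum>i<n. t i - s i) < d
      \<longrightarrow> (\<Sum>i<n. \<bar>F (t i) - F (s i)\<bar>) < e"
    using assms unfolding abs_continuous_on_def by blast
  show "\<exists>\<delta>>0. \<forall>(n::nat) (s::nat \<Rightarrow> real) (t::nat \<Rightarrow> real).
      (\<forall>i<n. s i \<le> t i \<and> {s i..t i} \<subseteq> {-b..-a}) \<and>
      disjoint_family_on (\<lambda>i. {s i<..<t i}) {..<n} \<and> (\<Sum>i<n. t i - s i) < \<delta>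
      \<longrightarrow> (\<Sum>i<n. \<bar>- F (- t i) - - F (- s i)\<bar>) < e"
  proof (intro exI[of _ d] conjI d allI impI)
    fix n :: nat and s t :: "nat \<Rightarrow> real"
    assume A: "(\<forall>i<n. s i \<le> t i \<and> {s i..t i} \<subseteq> {-b..-a}) \<and>
      disjoint_family_on (\<lambda>i. {s i<..<t i}) {..<n} \<and> (\<Sum>i<n. t i - s i) < d"
    have 1: "disjoint_family_on (\<lambda>i. {- t i<..<- s i}) {..<n}"
      unfolding disjoint_family_on_def
    proof (intro ballI impI)
      fix i j assume "i \<in> {..<n}" "j \<in> {..<n}" "i \<noteq> j"
      then have *: "{s i<..<t i} \<inter> {s j<..<t j} = {}" using A unfolding disjoint_family_on_def by blast
      show "{- t i<..<- s i} \<inter> {- t j<..<- s j} = {}"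
      proof (rule equals0I)
        fix x assume "x \<in> {- t i<..<- s i} \<inter> {- t j<..<- s j}"
        then have "- x \<in> {s i<..<t i} \<inter> {s j<..<t j}" by auto
        then show False using * by blast
      qed
    qed
    have 2: "\<forall>i<n. - t i \<le> - s i \<and> {- t i..- s i} \<subseteq> {a..b}"
    proof (intro allI impI)
      fix i assume "i < n"
      then have "s i \<le> t i" "- b \<le> s i" "t i \<le> - a" using A by auto
      then show "- t i \<le> - s i \<and> {- t i..- s i} \<subseteq> {a..b}" by auto
    qed
    have 3: "(\<Sum>i<n. - s i - - t i) < d" using A by simp
    have "(\<Sum>i<n. \<bar>F (- s i) - F (- t i)\<bar>) < e"
      by (rule d(2)[THEN spec[of _ n], THEN spec[of _ "\<lambda>i. - t i"], THEN spec[of _ "\<lambda>i. - s i"], THEN mp])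
        (intro conjI 1 2 3)
    then show "(\<Sum>i<n. \<bar>- F (- t i) - - F (- s i)\<bar>) < e" by simp
  qed
qed

lemma loc_abs_continuous_on_reflect:
  assumes F: "loc_abs_continuous_on S F" and G: "\<And>x. - x \<in> S \<Longrightarrow> G x = - F (- x)"
  shows "loc_abs_continuous_on (uminus ` S) G"
  unfolding loc_abs_continuous_on_def
proof (intro allI impI)
  fix a b assume ab: "{a..b} \<subseteq> uminus ` S"
  have S: "- x \<in> S" if "x \<in> {a..b}" for x
  proof -
    have "x \<in> uminus ` S" using ab that by (rule subsetD)
    then show ?thesis by (rule imageE) simp
  qed
  have "{-b..-a} \<subseteq> S"
  proof
    fix x assume "x \<in> {-b..-a}"
    then show "x \<in> S" using S[of "- x"] by auto
  qed
  then have "abs_continuous_on {-b..-a} F" using F by (simp add: loc_abs_continuous_on_def)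
  then have "abs_continuous_on {a..b} (\<lambda>x. - F (- x))" using abs_continuous_on_reflect[of "- b" "- a" F] by simp
  then show "abs_continuous_on {a..b} G" by (rule abs_continuous_on_cong) (use G S in simp)
qed

lemma differentiable_reflect:
  fixes f :: "real \<Rightarrow> real"
  shows "(\<lambda>x. f (- x)) differentiable (at x) \<longleftrightarrow> f differentiable (at (- x))"
proof
  assume "(\<lambda>x. f (- x)) differentiable (at x)"
  then obtain d where "((\<lambda>x. f (- x)) has_real_derivative - (- d)) (at x)"
    unfolding real_differentiable_def by auto
  then show "f differentiable (at (- x))"
    unfolding real_differentiable_def by (intro exI[of _ "- d"] iffD2[OF DERIV_mirror])
next
  assume "f differentiable (at (- x))"
  then obtain d where "(f has_real_derivative d) (at (- x))" unfolding real_differentiable_def by blast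
  then show "(\<lambda>x. f (- x)) differentiable (at x)"
    unfolding real_differentiable_def by (intro exI[of _ "- d"] iffD1[OF DERIV_mirror])
qed

lemma deriv_reflect:
  fixes f :: "real \<Rightarrow> real"
  assumes "f differentiable (at (- x))" shows "deriv (\<lambda>x. f (- x)) x = - deriv f (- x)"
  by (rule DERIV_imp_deriv, rule iffD1[OF DERIV_mirror])
    (use assms in \<open>simp add: DERIV_deriv_iff_real_differentiable\<close>)

lemma test_function_reflect:
  assumes "test_function I \<psi>" shows "test_function (uminus ` I) (\<lambda>x. \<psi> (- x))"
proof -
  have diff: "((deriv ^^ n) \<psi>) differentiable (at x)" for n x
    using assms by (auto simp: test_function_def)
  have "(deriv ^^ n) (\<lambda>x. \<psi> (- x)) = (\<lambda>x. (-1) ^ n * (deriv ^^ n) \<psi> (- x))" for n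
  proof (induction n)
    case (Suc n)
    have "deriv (\<lambda>x. (-1) ^ n * (deriv ^^ n) \<psi> (- x)) x = (-1) ^ n * - deriv ((deriv ^^ n) \<psi>) (- x)" for x
    proof (rule DERIV_imp_deriv, rule DERIV_cmult)
      show "((\<lambda>x. (deriv ^^ n) \<psi> (- x)) has_real_derivative - deriv ((deriv ^^ n) \<psi>) (- x)) (at x)"
        using diff[of n "- x"] unfolding DERIV_mirror[symmetric] DERIV_deriv_iff_real_differentiable .
    qed
    then show ?case using Suc.IH by auto
  qed simp
  moreover have "(\<lambda>x. (-1) ^ n * (deriv ^^ n) \<psi> (- x)) differentiable (at x)" for n x
    using diff[of n "- x"] by (intro differentiable_mult differentiable_const) (simp add: differentiable_reflect)
  moreover obtain K where K: "compact K" "K \<subseteq> I" "\<forall>x. x \<notin> K \<longrightarrow> \<psi> x = 0"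
    using assms by (auto simp: test_function_def)
  have "compact (uminus ` K)" "uminus ` K \<subseteq> uminus ` I" "\<forall>x. x \<notin> uminus ` K \<longrightarrow> \<psi> (- x) = 0"
    using K compact_negations[OF K(1)] by force+
  ultimately show ?thesis unfolding test_function_def by metis
qed

text \<open>Lebesgue measure is complete, so \<open>p\<close> and \<open>q\<close> are measurable
  together; if neither is, both integrals take the default value \<open>0\<close>. The weak equation
  can thus be reflected without a measurability proof.\<close>

lemma lebesgue_integral_cong_AE:
  fixes p q :: "real \<Rightarrow> real"
  assumes "AE x in lebesgue. p x = q x"
  shows "integral\<^sup>L lebesgue p = integral\<^sup>L lebesgue q"
proof -
  have meas: "g \<in> borel_measurable lebesgue" if f: "f \<in> borel_measurable lebesgue" and eq: "AE x in lebesgue. f x = g x"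
    for f g :: "real \<Rightarrow> real"
  proof (rule measurableI)
    fix A :: "real set" assume A: "A \<in> sets borel"
    show "g -` A \<inter> space lebesgue \<in> sets lebesgue"
    proof (rule completion.in_sets_AE)
      show "AE x in lebesgue. x \<in> f -` A \<inter> space lebesgue \<longleftrightarrow> x \<in> g -` A \<inter> space lebesgue"
        using eq by eventually_elim auto
      show "f -` A \<inter> space lebesgue \<in> sets lebesgue" using f A by (rule measurable_sets)
    qed auto
  qed simp
  have sym: "AE x in lebesgue. q x = p x" using assms by eventually_elim simp
  show ?thesis
  proof (cases "p \<in> borel_measurable lebesgue")
    case True
    then show ?thesis using meas[OF True assms] assms by (intro integral_cong_AE)
  next
    case False
    then have "q \<notin> borel_measurable lebesgue" using meas sym by blast
    then show ?thesis using False borel_measurable_integrable not_integrable_integral_eq by metis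
  qed
qed

text \<open>Under reflection the bracket \<open>D(\<phi>) \<phi>' - f + c \<phi>\<close> and the
  factor \<open>\<psi>'\<close> both change sign, so their product is preserved, as is the source
  term.\<close>

lemma tw_profile_reflect:
  assumes "tw_profile R f D g c I \<phi>"
  shows "tw_profile R (\<lambda>s. - f s) D g (- c) (uminus ` I) (\<lambda>\<xi>. \<phi> (- \<xi>))"
proof -
  have I: "open I" "is_interval I" "I \<noteq> {}" and r: "\<phi> ` I \<subseteq> {0..R}" and c: "continuous_on I \<phi>"
    and ae: "AE \<xi> in lebesgue. \<xi> \<in> I \<longrightarrow> \<phi> differentiable (at \<xi>)"
    and ai: "\<And>a b. {a..b} \<subseteq> I \<Longrightarrow> (\<lambda>\<xi>. D (\<phi> \<xi>) * deriv \<phi> \<xi>) absolutely_integrable_on {a..b}"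
    and lac: "loc_abs_continuous_on I (\<lambda>\<xi>. integral {0..\<phi> \<xi>} D)"
    and weak: "\<And>\<psi>. test_function I \<psi> \<Longrightarrow> (LINT \<xi>:I|lebesgue.
      (D (\<phi> \<xi>) * deriv \<phi> \<xi> - f (\<phi> \<xi>) + c * \<phi> \<xi>) * deriv \<psi> \<xi> - g (\<phi> \<xi>) * \<psi> \<xi>) = 0"
    using assms by (auto simp: tw_profile_def)
  \<comment> \<open>The chain rule for \<open>deriv\<close> fails where the profile has no
    derivative, so the reflected expressions are compared only off this null set.\<close>
  define N where "N = {\<xi>. \<xi> \<in> I \<and> \<not> \<phi> differentiable (at \<xi>)}"
  have "negligible N" using negligible_if_AE[OF ae] by (simp add: N_def)
  then have N': "negligible (uminus ` N)"
    by (rule negligible_differentiable_image_negligible[OF order_refl])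
      (intro derivative_intros)
  have inI: "x \<in> uminus ` I \<longleftrightarrow> - x \<in> I" for x by force
  have dr: "deriv (\<lambda>\<xi>. \<phi> (- \<xi>)) x = - deriv \<phi> (- x)" if "- x \<in> I" "x \<notin> uminus ` N" for x
  proof (rule deriv_reflect)
    show "\<phi> differentiable (at (- x))" using that by (force simp: N_def)
  qed
  have aeN: "AE x in lebesgue. x \<notin> uminus ` N"
    using N' by (simp add: negligible_iff_null_sets AE_not_in)
  show ?thesis
    unfolding tw_profile_def
  proof (intro conjI allI impI)
    show "open (uminus ` I)" using I(1) by (rule open_negations)
    show "is_interval (uminus ` I)"
      unfolding is_interval_1 using I(2)[unfolded is_interval_1] inI by (meson neg_le_iff_le)
    show "uminus ` I \<noteq> {}" using I(3) by simp
    show "(\<lambda>\<xi>. \<phi> (- \<xi>)) ` uminus ` I \<subseteq> {0..R}" using r by auto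
    show "continuous_on (uminus ` I) (\<lambda>\<xi>. \<phi> (- \<xi>))"
      by (rule continuous_on_compose2[OF c]) (auto intro!: continuous_intros)
    show "AE \<xi> in lebesgue. \<xi> \<in> uminus ` I \<longrightarrow> (\<lambda>\<xi>. \<phi> (- \<xi>)) differentiable at \<xi>"
      using aeN
    proof eventually_elim
      case (elim x)
      then show ?case unfolding differentiable_reflect inI by (force simp: N_def)
    qed
    show "(\<lambda>\<xi>. D (\<phi> (- \<xi>)) * deriv (\<lambda>\<xi>. \<phi> (- \<xi>)) \<xi>) absolutely_integrable_on {a..b}"
      if ab: "{a..b} \<subseteq> uminus ` I" for a b
    proof -
      have S: "- x \<in> I" if "x \<in> {a..b}" for x using ab that inI by blast
      have "{-b..-a} \<subseteq> I"
      proof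
        fix x assume "x \<in> {-b..-a}"
        then show "x \<in> I" using S[of "- x"] by auto
      qed
      then have "(\<lambda>\<xi>. D (\<phi> \<xi>) * deriv \<phi> \<xi>) absolutely_integrable_on {-b..-a}" by (rule ai)
      then have "(\<lambda>\<xi>. D (\<phi> (- \<xi>)) * deriv \<phi> (- \<xi>)) absolutely_integrable_on {a..b}"
        using absolutely_integrable_reflect_real[where f = "\<lambda>\<xi>. D (\<phi> \<xi>) * deriv \<phi> \<xi>" and a = "- b" and b = "- a"] by simp
      then have "(\<lambda>\<xi>. - (D (\<phi> (- \<xi>)) * deriv \<phi> (- \<xi>))) absolutely_integrable_on {a..b}"
        by (simp add: set_integrable_def)
      then show ?thesis
        by (rule absolutely_integrable_spike[OF _ N']) (use dr S in auto)
    qed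
    \<comment> \<open>\<open>loc_abs_continuous_on_reflect\<close> introduces a sign; negating the
      primitive beforehand absorbs it.\<close>
    have "loc_abs_continuous_on I (\<lambda>\<xi>. - integral {0..\<phi> \<xi>} D)"
      using lac unfolding loc_abs_continuous_on_def abs_continuous_on_def by (simp add: abs_minus_commute)
    then show "loc_abs_continuous_on (uminus ` I) (\<lambda>\<xi>. integral {0..\<phi> (- \<xi>)} D)"
      by (rule loc_abs_continuous_on_reflect) simp
    fix \<psi> assume \<psi>: "test_function (uminus ` I) \<psi>"
    have \<psi>': "test_function I (\<lambda>x. \<psi> (- x))" using test_function_reflect[OF \<psi>] by (simp add: image_image)
    have d\<psi>: "deriv (\<lambda>x. \<psi> (- x)) (- x) = - deriv \<psi> x" for x
      using \<psi> deriv_reflect[of \<psi> "- x"] unfolding test_function_def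
      by (metis funpow_0 minus_minus)
    define q where "q = (\<lambda>\<xi>. indicat_real I \<xi> *\<^sub>R ((D (\<phi> \<xi>) * deriv \<phi> \<xi> - f (\<phi> \<xi>) + c * \<phi> \<xi>) * deriv (\<lambda>x. \<psi> (- x)) \<xi> - g (\<phi> \<xi>) * \<psi> (- \<xi>)))"
    have "0 = integral\<^sup>L lebesgue q" using weak[OF \<psi>'] unfolding q_def set_lebesgue_integral_def by simp
    also have "\<dots> = integral\<^sup>L lebesgue (\<lambda>x. q (- x))"
      using lebesgue_integral_real_affine[of "-1" q 0] by simp
    also have "\<dots> = (LINT \<xi>:uminus ` I|lebesgue. (D (\<phi> (- \<xi>)) * deriv (\<lambda>\<xi>. \<phi> (- \<xi>)) \<xi> - - f (\<phi> (- \<xi>)) + - c * \<phi> (- \<xi>)) * deriv \<psi> \<xi> - g (\<phi> (- \<xi>)) * \<psi> \<xi>)"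
      unfolding set_lebesgue_integral_def
    proof (rule lebesgue_integral_cong_AE)
      show "AE x in lebesgue. q (- x) = indicat_real (uminus ` I) x *\<^sub>R
        ((D (\<phi> (- x)) * deriv (\<lambda>\<xi>. \<phi> (- \<xi>)) x - - f (\<phi> (- x)) + - c * \<phi> (- x)) * deriv \<psi> x - g (\<phi> (- x)) * \<psi> x)"
        using aeN
      proof eventually_elim
        case (elim x)
        show ?case
        proof (cases "- x \<in> I")
          case True
          then have "indicat_real I (- x) = 1" "indicat_real (uminus ` I) x = 1" using inI by (auto simp: indicator_def)
          then show ?thesis unfolding q_def dr[OF True elim] d\<psi> by (simp add: algebra_simps)
        next
          case False
          then have "indicat_real I (- x) = 0" "indicat_real (uminus ` I) x = 0" using inI by (auto simp: indicator_def)
          then show ?thesis unfolding q_def by simp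
        qed
      qed
    qed
    finally show "(LINT \<xi>:uminus ` I|lebesgue. (D (\<phi> (- \<xi>)) * deriv (\<lambda>\<xi>. \<phi> (- \<xi>)) \<xi> - - f (\<phi> (- \<xi>)) + - c * \<phi> (- \<xi>)) * deriv \<psi> \<xi> - g (\<phi> (- \<xi>)) * \<psi> \<xi>) = 0"
      by simp
  qed
qed

lemma classical_on_reflect:
  assumes S: "open S" and cl: "classical_on h D g c S \<phi>"
  shows "classical_on (\<lambda>s. - h s) D g (- c) (uminus ` S) (\<lambda>\<xi>. \<phi> (- \<xi>))"
proof -
  have diff: "\<And>\<xi>. \<xi> \<in> S \<Longrightarrow> \<phi> differentiable (at \<xi>)"
    and lac: "loc_abs_continuous_on S (\<lambda>\<xi>. D (\<phi> \<xi>) * deriv \<phi> \<xi>)"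
    and ae: "AE \<xi> in lebesgue. \<xi> \<in> S \<longrightarrow> (\<exists>v. ((\<lambda>\<xi>. D (\<phi> \<xi>) * deriv \<phi> \<xi>) has_real_derivative v) (at \<xi>) \<and>
             v + (c - h (\<phi> \<xi>)) * deriv \<phi> \<xi> + g (\<phi> \<xi>) = 0)"
    using cl by (auto simp: classical_on_def)
  have inS: "x \<in> uminus ` S \<longleftrightarrow> - x \<in> S" for x by force
  have dr: "deriv (\<lambda>\<xi>. \<phi> (- \<xi>)) x = - deriv \<phi> (- x)" if "- x \<in> S" for x
    by (rule deriv_reflect[OF diff[OF that]])
  define N where "N = {\<xi>. \<not> (\<xi> \<in> S \<longrightarrow> (\<exists>v. ((\<lambda>\<xi>. D (\<phi> \<xi>) * deriv \<phi> \<xi>) has_real_derivative v) (at \<xi>) \<and>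
             v + (c - h (\<phi> \<xi>)) * deriv \<phi> \<xi> + g (\<phi> \<xi>) = 0))}"
  have "negligible N" unfolding N_def by (rule negligible_if_AE[OF ae])
  then have N': "negligible (uminus ` N)"
    by (rule negligible_differentiable_image_negligible[OF order_refl])
      (intro derivative_intros)
  have aeN: "AE x in lebesgue. x \<notin> uminus ` N"
    using N' by (simp add: negligible_iff_null_sets AE_not_in)
  show ?thesis
    unfolding classical_on_def
  proof (intro conjI ballI)
    show "(\<lambda>\<xi>. \<phi> (- \<xi>)) differentiable at x" if "x \<in> uminus ` S" for x
      using that diff unfolding differentiable_reflect inS by blast
    show "loc_abs_continuous_on (uminus ` S) (\<lambda>\<xi>. D (\<phi> (- \<xi>)) * deriv (\<lambda>\<xi>. \<phi> (- \<xi>)) \<xi>)"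
      by (rule loc_abs_continuous_on_reflect[OF lac]) (simp add: dr)
    show "AE \<xi> in lebesgue. \<xi> \<in> uminus ` S \<longrightarrow> (\<exists>v. ((\<lambda>\<xi>. D (\<phi> (- \<xi>)) * deriv (\<lambda>\<xi>. \<phi> (- \<xi>)) \<xi>) has_real_derivative v) (at \<xi>) \<and>
             v + (- c - - h (\<phi> (- \<xi>))) * deriv (\<lambda>\<xi>. \<phi> (- \<xi>)) \<xi> + g (\<phi> (- \<xi>)) = 0)"
      using aeN
    proof eventually_elim
      case (elim x)
      show ?case
      proof
        assume x: "x \<in> uminus ` S"
        then have xS: "- x \<in> S" using inS by blast
        moreover have "- x \<notin> N" using elim by force
        ultimately obtain v where v: "((\<lambda>\<xi>. D (\<phi> \<xi>) * deriv \<phi> \<xi>) has_real_derivative v) (at (- x))"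
          "v + (c - h (\<phi> (- x))) * deriv \<phi> (- x) + g (\<phi> (- x)) = 0"
          unfolding N_def by blast
        have "((\<lambda>\<xi>. D (\<phi> (- \<xi>)) * deriv \<phi> (- \<xi>)) has_real_derivative - v) (at x)"
          using v(1) unfolding DERIV_mirror[of "\<lambda>\<xi>. D (\<phi> \<xi>) * deriv \<phi> \<xi>"] .
        then have "((\<lambda>\<xi>. - (D (\<phi> (- \<xi>)) * deriv \<phi> (- \<xi>))) has_real_derivative - (- v)) (at x)"
          by (rule DERIV_minus)
        then have "((\<lambda>\<xi>. D (\<phi> (- \<xi>)) * deriv (\<lambda>\<xi>. \<phi> (- \<xi>)) \<xi>) has_real_derivative - (- v)) (at x)"
          by (rule has_field_derivative_transform_within_open[OF _ open_negations[OF S] x]) (use dr in auto)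
        moreover have "- (- v) + (- c - - h (\<phi> (- x))) * deriv (\<lambda>\<xi>. \<phi> (- \<xi>)) x + g (\<phi> (- x)) = 0"
          unfolding dr[OF xS] using v(2) by (simp add: algebra_simps)
        ultimately show "\<exists>v. ((\<lambda>\<xi>. D (\<phi> (- \<xi>)) * deriv (\<lambda>\<xi>. \<phi> (- \<xi>)) \<xi>) has_real_derivative v) (at x) \<and>
             v + (- c - - h (\<phi> (- x))) * deriv (\<lambda>\<xi>. \<phi> (- \<xi>)) x + g (\<phi> (- x)) = 0" by blast
      qed
    qed
  qed
qed

lemma sharp_at_reflect:
  assumes I: "open I" and sh: "sharp_at h D g c I \<phi> l"
  shows "sharp_at (\<lambda>s. - h s) D g (- c) (uminus ` I) (\<lambda>\<xi>. \<phi> (- \<xi>)) l"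
proof -
  obtain \<xi>0 where \<xi>0: "\<xi>0 \<in> I" "\<phi> \<xi>0 = l" "classical_on h D g c (I - {\<xi>0}) \<phi>" "\<not> \<phi> differentiable (at \<xi>0)" "g l = 0"
    using sh by (auto simp: sharp_at_def)
  have "uminus ` (I - {\<xi>0}) = uminus ` I - {- \<xi>0}" by force
  moreover have "open (I - {\<xi>0})" using I by (simp add: open_delete)
  ultimately have "classical_on (\<lambda>s. - h s) D g (- c) (uminus ` I - {- \<xi>0}) (\<lambda>\<xi>. \<phi> (- \<xi>))"
    using classical_on_reflect[OF _ \<xi>0(3)] by simp
  then show ?thesis
    unfolding sharp_at_def using \<xi>0 by (intro conjI bexI[of _ "- \<xi>0"]) (auto simp: differentiable_reflect)
qed

lemma classical_or_sharp_reflect: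
  assumes "open I" "classical_or_sharp R h D g c I \<phi>"
  shows "classical_or_sharp R (\<lambda>s. - h s) D g (- c) (uminus ` I) (\<lambda>\<xi>. \<phi> (- \<xi>))"
  using assms(2) unfolding classical_or_sharp_def
proof (elim disjE bexE)
  assume "classical_on h D g c I \<phi>"
  from classical_on_reflect[OF assms(1) this]
  show "classical_on (\<lambda>s. - h s) D g (- c) (uminus ` I) (\<lambda>\<xi>. \<phi> (- \<xi>)) \<or>
    (\<exists>l\<in>{0..R}. sharp_at (\<lambda>s. - h s) D g (- c) (uminus ` I) (\<lambda>\<xi>. \<phi> (- \<xi>)) l)" by (rule disjI1)
next
  fix l assume l: "l \<in> {0..R}" "sharp_at h D g c I \<phi> l"
  from sharp_at_reflect[OF assms(1) l(2)] l(1)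
  show "classical_on (\<lambda>s. - h s) D g (- c) (uminus ` I) (\<lambda>\<xi>. \<phi> (- \<xi>)) \<or>
    (\<exists>l\<in>{0..R}. sharp_at (\<lambda>s. - h s) D g (- c) (uminus ` I) (\<lambda>\<xi>. \<phi> (- \<xi>)) l)"
    by (intro disjI2 bexI)
qed

text \<open>Reflection is an involution, so an extension of the reflected profile reflects back to
  an extension of the original one.\<close>

lemma maximal_profile_reflect:
  assumes "maximal_profile R f D g c I \<phi>"
  shows "maximal_profile R (\<lambda>s. - f s) D g (- c) (uminus ` I) (\<lambda>\<xi>. \<phi> (- \<xi>))"
  unfolding maximal_profile_def
proof (intro conjI allI impI)
  show "tw_profile R (\<lambda>s. - f s) D g (- c) (uminus ` I) (\<lambda>\<xi>. \<phi> (- \<xi>))"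
    using assms tw_profile_reflect by (auto simp: maximal_profile_def)
  fix J \<theta> assume A: "tw_profile R (\<lambda>s. - f s) D g (- c) J \<theta> \<and> uminus ` I \<subseteq> J \<and> (\<forall>\<xi>\<in>uminus ` I. \<theta> \<xi> = \<phi> (- \<xi>))"
  have "tw_profile R f D g c (uminus ` J) (\<lambda>\<xi>. \<theta> (- \<xi>))"
    using tw_profile_reflect[of R "\<lambda>s. - f s" D g "- c" J \<theta>] A by simp
  moreover have "I \<subseteq> uminus ` J"
  proof
    fix x assume "x \<in> I"
    then have "- x \<in> J" using A by blast
    then show "x \<in> uminus ` J" by (metis imageI minus_minus)
  qed
  moreover have "\<forall>\<xi>\<in>I. \<theta> (- \<xi>) = \<phi> \<xi>" using A by simp
  ultimately have "uminus ` J = I" using assms unfolding maximal_profile_def by blast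
  then show "J = uminus ` I" by (auto simp: image_image)
qed

lemma uminus_half_lines: "uminus ` {..<w} = {- w<..}" "uminus ` {w<..} = {..<- w :: real}"
  by (auto intro!: image_eqI[of _ uminus "- _"] simp: less_minus_iff minus_less_iff)

lemma monotone_reflect:
  fixes \<phi> :: "real \<Rightarrow> real"
  shows "mono_on S \<phi> \<Longrightarrow> antimono_on (uminus ` S) (\<lambda>\<xi>. \<phi> (- \<xi>))"
    "antimono_on S \<phi> \<Longrightarrow> mono_on (uminus ` S) (\<lambda>\<xi>. \<phi> (- \<xi>))"
  by (auto simp: monotone_on_def)

lemma constant_on_reflect: "(\<lambda>\<xi>. \<phi> (- \<xi>)) constant_on (uminus ` S) \<longleftrightarrow> \<phi> constant_on (S :: real set)"
  by (auto simp: constant_on_def)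

lemma semi_wavefront_to_reflect:
  assumes "semi_wavefront_from R f D g c l w \<phi>"
  shows "semi_wavefront_to R (\<lambda>s. - f s) D g (- c) l (- w) (\<lambda>\<xi>. \<phi> (- \<xi>))"
  using assms tw_profile_reflect[of R f D g c "{..<w}" \<phi>] monotone_reflect[of "{..<w}" \<phi>]
    constant_on_reflect[of \<phi> "{..<w}"]
  unfolding semi_wavefront_from_def semi_wavefront_to_def uminus_half_lines filterlim_at_bot_mirror[of \<phi>]
  by auto

lemma semi_wavefront_from_reflect:
  assumes "semi_wavefront_to R f D g c l w \<phi>"
  shows "semi_wavefront_from R (\<lambda>s. - f s) D g (- c) l (- w) (\<lambda>\<xi>. \<phi> (- \<xi>))"
  using assms tw_profile_reflect[of R f D g c "{w<..}" \<phi>] monotone_reflect[of "{w<..}" \<phi>]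
    constant_on_reflect[of \<phi> "{w<..}"]
  unfolding semi_wavefront_from_def semi_wavefront_to_def uminus_half_lines filterlim_at_top_mirror[of \<phi>]
  by auto

text \<open>The involution also carries competitors back to the half-line at minus infinity; the
  shift changes sign with them.\<close>

lemma unique_to_reflect:
  assumes "unique_from R f h D g c l w \<phi>"
  shows "unique_to R (\<lambda>s. - f s) (\<lambda>s. - h s) D g (- c) l (- w) (\<lambda>\<xi>. \<phi> (- \<xi>))"
  unfolding unique_to_def
proof (intro allI impI)
  fix v \<theta> assume A: "semi_wavefront_to R (\<lambda>s. - f s) D g (- c) l v \<theta> \<and>
    classical_or_sharp R (\<lambda>s. - h s) D g (- c) {v<..} \<theta>"
  have "semi_wavefront_from R f D g c l (- v) (\<lambda>\<xi>. \<theta> (- \<xi>))"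
    using semi_wavefront_from_reflect[of R "\<lambda>s. - f s" D g "- c" l v \<theta>] A by simp
  moreover have "classical_or_sharp R h D g c {..<- v} (\<lambda>\<xi>. \<theta> (- \<xi>))"
    using classical_or_sharp_reflect[of "{v<..}" R "\<lambda>s. - h s" D g "- c" \<theta>] A by (simp add: uminus_half_lines)
  ultimately obtain s where s: "- v + s \<le> w" "\<And>\<xi>. \<xi> < - v \<Longrightarrow> \<theta> (- \<xi>) = \<phi> (\<xi> + s)"
    using assms unfolding unique_from_def by blast
  have "\<theta> \<xi> = \<phi> (- (\<xi> + - s))" if "v < \<xi>" for \<xi> using s(2)[of "- \<xi>"] that by simp
  then show "\<exists>s. - w \<le> v + s \<and> (\<forall>\<xi>>v. \<theta> \<xi> = \<phi> (- (\<xi> + s)))" using s(1) by (intro exI[of _ "- s"]) auto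
qed

lemma strict_profile_reflect:
  assumes "strict_profile R f D g c I \<phi>"
  shows "strict_profile R (\<lambda>s. - f s) D g (- c) (uminus ` I) (\<lambda>\<xi>. \<phi> (- \<xi>))"
proof -
  have "uminus ` I \<noteq> UNIV"
  proof
    assume U: "uminus ` I = UNIV"
    have "I = uminus ` uminus ` I" by (simp add: image_image)
    also have "\<dots> = UNIV" unfolding U by (auto intro: image_eqI[of _ uminus "- _"])
    finally show False using assms by (simp add: strict_profile_def)
  qed
  moreover have False if "tw_profile R (\<lambda>s. - f s) D g (- c) UNIV \<theta>" "\<forall>\<xi>\<in>uminus ` I. \<theta> \<xi> = \<phi> (- \<xi>)" for \<theta>
  proof -
    have U: "uminus ` UNIV = (UNIV :: real set)" by (auto intro: image_eqI[of _ uminus "- _"])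
    have "tw_profile R f D g c UNIV (\<lambda>\<xi>. \<theta> (- \<xi>))"
      using tw_profile_reflect[OF that(1)] by (simp add: U)
    then show False using assms that(2) unfolding strict_profile_def by auto
  qed
  ultimately show ?thesis unfolding strict_profile_def by blast
qed

subsection \<open>Semi-wavefronts to the degenerate state and examples\<close>

lemma C1_on_uminus: "C1_on S F F' \<Longrightarrow> C1_on S (\<lambda>x. - F x) (\<lambda>x. - F' x)"
  by (auto simp: C1_on_def intro: DERIV_minus continuous_on_minus)

lemma flux_source_data_uminus:
  "flux_source_data R f h g \<Longrightarrow> flux_source_data R (\<lambda>s. - f s) (\<lambda>s. - h s) g"
  by (auto simp: flux_source_data_def intro: C1_on_uminus)

text \<open>The reflected data have speed \<open>- c\<close> and characteristic speed
  \<open>- h R\<close>, which reverses their order; this exchanges the sharp and the classical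
  case.\<close>

lemma (in rd_data) wavefront_to_exists:
  "\<exists>\<omega> \<phi>. semi_wavefront_to R f D g c R \<omega> \<phi> \<and>
        maximal_profile R f D g c {\<omega><..} \<phi> \<and>
        strict_profile R f D g c {\<omega><..} \<phi> \<and>
        classical_or_sharp R h D g c {\<omega><..} \<phi> \<and>
        unique_to R f h D g c R \<omega> \<phi> \<and>
        (cond_D R D dD \<longrightarrow>
           (c < h R \<longrightarrow> classical_on h D g c {\<omega><..} \<phi>) \<and>
           (h R < c \<longrightarrow> sharp_at h D g c {\<omega><..} \<phi> R) \<and>
           (c = h R \<and> dD R < 0 \<longrightarrow> classical_on h D g c {\<omega><..} \<phi>)) \<and>
        (cond_D_tilde R D g \<longrightarrow> classical_on h D g c {\<omega><..} \<phi>)"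
proof -
  interpret r: rd_data R "- c" "\<lambda>s. - f s" "\<lambda>s. - h s" D g
    by unfold_locales (use R_pos D_cont D_R D_pos flux_source_data_uminus[OF data] in auto)
  obtain \<omega> \<phi> where \<phi>: "semi_wavefront_from R (\<lambda>s. - f s) D g (- c) R \<omega> \<phi>"
    "maximal_profile R (\<lambda>s. - f s) D g (- c) {..<\<omega>} \<phi>"
    "strict_profile R (\<lambda>s. - f s) D g (- c) {..<\<omega>} \<phi>"
    "classical_or_sharp R (\<lambda>s. - h s) D g (- c) {..<\<omega>} \<phi>"
    "unique_from R (\<lambda>s. - f s) (\<lambda>s. - h s) D g (- c) R \<omega> \<phi>"
    "cond_D R D dD \<longrightarrow>
           (- c < - h R \<longrightarrow> sharp_at (\<lambda>s. - h s) D g (- c) {..<\<omega>} \<phi> R) \<and>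
           (- h R < - c \<longrightarrow> classical_on (\<lambda>s. - h s) D g (- c) {..<\<omega>} \<phi>) \<and>
           (- c = - h R \<and> dD R < 0 \<longrightarrow> classical_on (\<lambda>s. - h s) D g (- c) {..<\<omega>} \<phi>)"
    "cond_D_tilde R D g \<longrightarrow> classical_on (\<lambda>s. - h s) D g (- c) {..<\<omega>} \<phi>"
    using r.wavefront_from_exists[of dD] by (elim exE conjE)
  have cl: "classical_on h D g c {- \<omega><..} (\<lambda>\<xi>. \<phi> (- \<xi>))" if "classical_on (\<lambda>s. - h s) D g (- c) {..<\<omega>} \<phi>"
    using classical_on_reflect[OF open_lessThan that] by (simp add: uminus_half_lines)
  have sh: "sharp_at h D g c {- \<omega><..} (\<lambda>\<xi>. \<phi> (- \<xi>)) R" if "sharp_at (\<lambda>s. - h s) D g (- c) {..<\<omega>} \<phi> R"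
    using sharp_at_reflect[OF open_lessThan that] by (simp add: uminus_half_lines)
  show ?thesis
  proof (intro exI[of _ "- \<omega>"] exI[of _ "\<lambda>\<xi>. \<phi> (- \<xi>)"] conjI)
    show "semi_wavefront_to R f D g c R (- \<omega>) (\<lambda>\<xi>. \<phi> (- \<xi>))"
      using semi_wavefront_to_reflect[OF \<phi>(1)] by simp
    show "maximal_profile R f D g c {- \<omega><..} (\<lambda>\<xi>. \<phi> (- \<xi>))"
      using maximal_profile_reflect[OF \<phi>(2)] by (simp add: uminus_half_lines)
    show "strict_profile R f D g c {- \<omega><..} (\<lambda>\<xi>. \<phi> (- \<xi>))"
      using strict_profile_reflect[OF \<phi>(3)] by (simp add: uminus_half_lines)
    show "classical_or_sharp R h D g c {- \<omega><..} (\<lambda>\<xi>. \<phi> (- \<xi>))"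
      using classical_or_sharp_reflect[OF open_lessThan \<phi>(4)] by (simp add: uminus_half_lines)
    show "unique_to R f h D g c R (- \<omega>) (\<lambda>\<xi>. \<phi> (- \<xi>))"
      using unique_to_reflect[OF \<phi>(5)] by simp
    show "cond_D R D dD \<longrightarrow>
           (c < h R \<longrightarrow> classical_on h D g c {- \<omega><..} (\<lambda>\<xi>. \<phi> (- \<xi>))) \<and>
           (h R < c \<longrightarrow> sharp_at h D g c {- \<omega><..} (\<lambda>\<xi>. \<phi> (- \<xi>)) R) \<and>
           (c = h R \<and> dD R < 0 \<longrightarrow> classical_on h D g c {- \<omega><..} (\<lambda>\<xi>. \<phi> (- \<xi>)))"
      using \<phi>(6) cl sh by auto
    show "cond_D_tilde R D g \<longrightarrow> classical_on h D g c {- \<omega><..} (\<lambda>\<xi>. \<phi> (- \<xi>))"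
      using \<phi>(7) cl by blast
  qed
qed

section \<open>Explicit examples at the borderline speed\<close>

lemma quadratic_diffusion_data:
  fixes R c :: real
  assumes R: "0 < R" and g: "continuous_on {0..R} g" "\<And>\<rho>. 0 \<le> \<rho> \<Longrightarrow> \<rho> < R \<Longrightarrow> 0 < g \<rho>" "g R = 0"
  shows "flux_source_data R (\<lambda>s. c * s) (\<lambda>_. c) g"
    "cond_D R (\<lambda>s. (R - s)\<^sup>2) (\<lambda>s. - 2 * (R - s))"
    "rd_data R (\<lambda>s. c * s) (\<lambda>_. c) (\<lambda>s. (R - s)\<^sup>2) g"
proof -
  show fs: "flux_source_data R (\<lambda>s. c * s) (\<lambda>_. c) g"
    unfolding flux_source_data_def C1_on_def
    using g by (auto intro!: derivative_eq_intros continuous_intros)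
  show "cond_D R (\<lambda>s. (R - s)\<^sup>2) (\<lambda>s. - 2 * (R - s))"
    unfolding cond_D_def C1_on_def
    by (auto intro!: derivative_eq_intros continuous_intros)
  show "rd_data R (\<lambda>s. c * s) (\<lambda>_. c) (\<lambda>s. (R - s)\<^sup>2) g"
    by unfold_locales (use R fs in \<open>auto intro!: continuous_intros\<close>)
qed

text \<open>With \<open>h \<equiv> c\<close> and \<open>D(\<phi>) = (R - \<phi>)\<^sup>2\<close> the trajectory is explicit: \<open>g(\<phi>) = (R - \<phi>)\<^sup>3\<close> gives
  \<open>u(x) = x\<^sup>3 / sqrt 3\<close> and an exponential profile, \<open>g(\<phi>) = R - \<phi>\<close> gives \<open>u(x) = x\<^sup>2 / sqrt 2\<close> and a
  profile that is linear below \<open>R\<close>.\<close>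

lemma classical_example_from:
  fixes R c :: real
  assumes R: "0 < R"
  shows "\<exists>\<omega> \<phi>. semi_wavefront_from R (\<lambda>s. c * s) (\<lambda>s. (R - s)\<^sup>2) (\<lambda>s. (R - s) ^ 3) c R \<omega> \<phi> \<and>
    maximal_profile R (\<lambda>s. c * s) (\<lambda>s. (R - s)\<^sup>2) (\<lambda>s. (R - s) ^ 3) c {..<\<omega>} \<phi> \<and>
    classical_on (\<lambda>_. c) (\<lambda>s. (R - s)\<^sup>2) (\<lambda>s. (R - s) ^ 3) c {..<\<omega>} \<phi>"
proof -
  \<comment> \<open>Inserting \<open>u = \<sigma> x^3\<close> into \<open>u' = D g / u\<close> gives
    \<open>3 \<sigma> x^2 = x^2 / \<sigma>\<close>, hence \<open>3 \<sigma>^2 = 1\<close>.\<close>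
  define \<sigma> :: real where "\<sigma> = 1 / sqrt 3"
  have \<sigma>: "0 < \<sigma>" "3 * \<sigma> = 1 / \<sigma>" by (auto simp: \<sigma>_def real_div_sqrt)
  interpret rd_data R c "\<lambda>s. c * s" "\<lambda>_. c" "\<lambda>s. (R - s)\<^sup>2" "\<lambda>s. (R - s) ^ 3"
    by (rule quadratic_diffusion_data(3)) (use R in \<open>auto intro!: continuous_intros\<close>)
  have "trajectory R c (\<lambda>s. c * s) (\<lambda>_. c) (\<lambda>s. (R - s)\<^sup>2) (\<lambda>s. (R - s) ^ 3) (\<lambda>x. \<sigma> * x ^ 3)"
  proof unfold_locales
    show "0 < \<sigma> * x ^ 3" if "0 < x" for x using that \<sigma> by simp
    show "((\<lambda>x. \<sigma> * x ^ 3) has_real_derivative c - c + (R - (R - x))\<^sup>2 * (R - (R - x)) ^ 3 / (\<sigma> * x ^ 3)) (at x)"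
      if "0 < x" for x
    proof -
      have "((\<lambda>x. \<sigma> * x ^ 3) has_real_derivative (3 * \<sigma>) * x\<^sup>2) (at x)"
        by (auto intro!: derivative_eq_intros)
      moreover have "x\<^sup>2 * x ^ 3 / (\<sigma> * x ^ 3) = x\<^sup>2 / \<sigma>"
        by (rule nonzero_mult_divide_mult_cancel_right) (use that in simp)
      then have "c - c + (R - (R - x))\<^sup>2 * (R - (R - x)) ^ 3 / (\<sigma> * x ^ 3) = (1 / \<sigma>) * x\<^sup>2"
        by (simp only: diff_self diff_diff_eq2 add_diff_cancel_left' add_0) simp
      ultimately show ?thesis using \<sigma>(2) by simp
    qed
    have "((\<lambda>x. \<sigma> * x ^ 3) \<longlongrightarrow> \<sigma> * 0 ^ 3) (at_right 0)" by (intro tendsto_intros)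
    then show "((\<lambda>x. \<sigma> * x ^ 3) \<longlongrightarrow> 0) (at_right 0)" by simp
  qed
  moreover have "\<sigma> * x ^ 3 \<le> \<sigma> * R ^ 3" if "0 < x" "x < R" for x
    using that \<sigma> by (intro mult_left_mono power_mono) auto
  ultimately obtain H where "hodograph R c (\<lambda>s. c * s) (\<lambda>_. c) (\<lambda>s. (R - s)\<^sup>2) (\<lambda>s. (R - s) ^ 3) (\<lambda>x. \<sigma> * x ^ 3) H (\<sigma> * R ^ 3)"
    using hodograph_exists by blast
  then interpret hodograph R c "\<lambda>s. c * s" "\<lambda>_. c" "\<lambda>s. (R - s)\<^sup>2" "\<lambda>s. (R - s) ^ 3" "\<lambda>x. \<sigma> * x ^ 3" H "\<sigma> * R ^ 3" .
  have "classical_on (\<lambda>_. c) (\<lambda>s. (R - s)\<^sup>2) (\<lambda>s. (R - s) ^ 3) c {..<\<omega>} \<phi>"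
  proof (rule classical_criterion)
    fix e :: real assume e: "0 < e"
    \<comment> \<open>Here \<open>u / D = \<sigma> x\<close>, which is at most \<open>e\<close> for
      \<open>x <= e / \<sigma>\<close>; the bound \<open>R / 2\<close> keeps \<open>b\<close> inside
      the interval.\<close>
    define b where "b = min (R / 2) (e / \<sigma>)"
    have b: "0 < b" "b < R" "b \<le> e / \<sigma>" using R e \<sigma> by (auto simp: b_def)
    have "\<sigma> * x ^ 3 \<le> e * (R - (R - x))\<^sup>2" if x: "0 < x" "x \<le> b" for x
    proof -
      have "x \<le> e / \<sigma>" using x b by linarith
      then have "\<sigma> * x \<le> e" using \<sigma> by (simp add: field_simps)
      then have "\<sigma> * x * x\<^sup>2 \<le> e * x\<^sup>2" by (intro mult_right_mono) auto
      then show ?thesis by (simp add: power3_eq_cube power2_eq_square mult.assoc)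
    qed
    then show "\<exists>x0>0. x0 < R \<and> (\<forall>x. 0 < x \<longrightarrow> x \<le> x0 \<longrightarrow> \<sigma> * x ^ 3 \<le> e * (R - (R - x))\<^sup>2)"
      using b by blast
  qed
  then show ?thesis using \<phi>_semi_wavefront \<phi>_maximal by blast
qed

lemma sharp_example_from:
  fixes R c :: real
  assumes R: "0 < R"
  shows "\<exists>\<omega> \<phi>. semi_wavefront_from R (\<lambda>s. c * s) (\<lambda>s. (R - s)\<^sup>2) (\<lambda>s. R - s) c R \<omega> \<phi> \<and>
    maximal_profile R (\<lambda>s. c * s) (\<lambda>s. (R - s)\<^sup>2) (\<lambda>s. R - s) c {..<\<omega>} \<phi> \<and>
    sharp_at (\<lambda>_. c) (\<lambda>s. (R - s)\<^sup>2) (\<lambda>s. R - s) c {..<\<omega>} \<phi> R"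
proof -
  \<comment> \<open>Inserting \<open>u = \<sigma> x^2\<close> into \<open>u' = D g / u\<close> gives
    \<open>2 \<sigma> x = x / \<sigma>\<close>, hence \<open>2 \<sigma>^2 = 1\<close>.\<close>
  define \<sigma> :: real where "\<sigma> = 1 / sqrt 2"
  have \<sigma>: "0 < \<sigma>" "2 * \<sigma> = 1 / \<sigma>" by (auto simp: \<sigma>_def real_div_sqrt)
  interpret rd_data R c "\<lambda>s. c * s" "\<lambda>_. c" "\<lambda>s. (R - s)\<^sup>2" "\<lambda>s. R - s"
    by (rule quadratic_diffusion_data(3)) (use R in \<open>auto intro!: continuous_intros\<close>)
  have "trajectory R c (\<lambda>s. c * s) (\<lambda>_. c) (\<lambda>s. (R - s)\<^sup>2) (\<lambda>s. R - s) (\<lambda>x. \<sigma> * x\<^sup>2)"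
  proof unfold_locales
    show "0 < \<sigma> * x\<^sup>2" if "0 < x" for x using that \<sigma> by simp
    show "((\<lambda>x. \<sigma> * x\<^sup>2) has_real_derivative c - c + (R - (R - x))\<^sup>2 * (R - (R - x)) / (\<sigma> * x\<^sup>2)) (at x)"
      if "0 < x" for x
    proof -
      have "((\<lambda>x. \<sigma> * x\<^sup>2) has_real_derivative (2 * \<sigma>) * x) (at x)"
        by (auto intro!: derivative_eq_intros)
      moreover have "c - c + (R - (R - x))\<^sup>2 * (R - (R - x)) / (\<sigma> * x\<^sup>2) = (1 / \<sigma>) * x"
        using that by simp
      ultimately show ?thesis using \<sigma>(2) by simp
    qed
    have "((\<lambda>x. \<sigma> * x\<^sup>2) \<longlongrightarrow> \<sigma> * 0\<^sup>2) (at_right 0)" by (intro tendsto_intros)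
    then show "((\<lambda>x. \<sigma> * x\<^sup>2) \<longlongrightarrow> 0) (at_right 0)" by simp
  qed
  moreover have "\<sigma> * x\<^sup>2 \<le> \<sigma> * R\<^sup>2" if "0 < x" "x < R" for x
    using that \<sigma> by (intro mult_left_mono power_mono) auto
  ultimately obtain H where "hodograph R c (\<lambda>s. c * s) (\<lambda>_. c) (\<lambda>s. (R - s)\<^sup>2) (\<lambda>s. R - s) (\<lambda>x. \<sigma> * x\<^sup>2) H (\<sigma> * R\<^sup>2)"
    using hodograph_exists by blast
  then interpret hodograph R c "\<lambda>s. c * s" "\<lambda>_. c" "\<lambda>s. (R - s)\<^sup>2" "\<lambda>s. R - s" "\<lambda>x. \<sigma> * x\<^sup>2" H "\<sigma> * R\<^sup>2" .
  \<comment> \<open>Here \<open>u = \<sigma> D\<close> exactly, so the criterion holds with equality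
    on any initial interval; \<open>R / 2\<close> is one choice.\<close>
  have "sharp_at (\<lambda>_. c) (\<lambda>s. (R - s)\<^sup>2) (\<lambda>s. R - s) c {..<\<omega>} \<phi> R"
    by (rule sharp_criterion[of \<sigma> "R / 2"]) (use \<sigma> R in auto)
  then show ?thesis using \<phi>_semi_wavefront \<phi>_maximal by blast
qed

lemma classical_example_to:
  fixes R c :: real
  assumes "0 < R"
  shows "\<exists>\<omega> \<phi>. semi_wavefront_to R (\<lambda>s. c * s) (\<lambda>s. (R - s)\<^sup>2) (\<lambda>s. (R - s) ^ 3) c R \<omega> \<phi> \<and>
    maximal_profile R (\<lambda>s. c * s) (\<lambda>s. (R - s)\<^sup>2) (\<lambda>s. (R - s) ^ 3) c {\<omega><..} \<phi> \<and>
    classical_on (\<lambda>_. c) (\<lambda>s. (R - s)\<^sup>2) (\<lambda>s. (R - s) ^ 3) c {\<omega><..} \<phi>"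
proof -
  obtain \<omega> \<phi> where \<phi>: "semi_wavefront_from R (\<lambda>s. - c * s) (\<lambda>s. (R - s)\<^sup>2) (\<lambda>s. (R - s) ^ 3) (- c) R \<omega> \<phi>"
    "maximal_profile R (\<lambda>s. - c * s) (\<lambda>s. (R - s)\<^sup>2) (\<lambda>s. (R - s) ^ 3) (- c) {..<\<omega>} \<phi>"
    "classical_on (\<lambda>_. - c) (\<lambda>s. (R - s)\<^sup>2) (\<lambda>s. (R - s) ^ 3) (- c) {..<\<omega>} \<phi>"
    using classical_example_from[OF assms, of "- c"] by blast
  show ?thesis
    using semi_wavefront_to_reflect[OF \<phi>(1)] maximal_profile_reflect[OF \<phi>(2)]
      classical_on_reflect[OF open_lessThan \<phi>(3)]
    by (intro exI[of _ "- \<omega>"] exI[of _ "\<lambda>\<xi>. \<phi> (- \<xi>)"]) (simp add: uminus_half_lines)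
qed

lemma sharp_example_to:
  fixes R c :: real
  assumes "0 < R"
  shows "\<exists>\<omega> \<phi>. semi_wavefront_to R (\<lambda>s. c * s) (\<lambda>s. (R - s)\<^sup>2) (\<lambda>s. R - s) c R \<omega> \<phi> \<and>
    maximal_profile R (\<lambda>s. c * s) (\<lambda>s. (R - s)\<^sup>2) (\<lambda>s. R - s) c {\<omega><..} \<phi> \<and>
    sharp_at (\<lambda>_. c) (\<lambda>s. (R - s)\<^sup>2) (\<lambda>s. R - s) c {\<omega><..} \<phi> R"
proof -
  obtain \<omega> \<phi> where \<phi>: "semi_wavefront_from R (\<lambda>s. - c * s) (\<lambda>s. (R - s)\<^sup>2) (\<lambda>s. R - s) (- c) R \<omega> \<phi>"
    "maximal_profile R (\<lambda>s. - c * s) (\<lambda>s. (R - s)\<^sup>2) (\<lambda>s. R - s) (- c) {..<\<omega>} \<phi>"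
    "sharp_at (\<lambda>_. - c) (\<lambda>s. (R - s)\<^sup>2) (\<lambda>s. R - s) (- c) {..<\<omega>} \<phi> R"
    using sharp_example_from[OF assms, of "- c"] by blast
  show ?thesis
    using semi_wavefront_to_reflect[OF \<phi>(1)] maximal_profile_reflect[OF \<phi>(2)]
      sharp_at_reflect[OF open_lessThan \<phi>(3)]
    by (intro exI[of _ "- \<omega>"] exI[of _ "\<lambda>\<xi>. \<phi> (- \<xi>)"]) (simp add: uminus_half_lines)
qed

theorem theorem2p1:
  fixes R c :: real and f h D dD g :: "real \<Rightarrow> real"
  assumes "0 < R"
    and "flux_source_data R f h g"
    and "cond_D R D dD \<or> cond_D_tilde R D g"
  shows
    "(\<exists>\<omega> \<phi>. semi_wavefront_from R f D g c R \<omega> \<phi> \<and>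
        maximal_profile R f D g c {..<\<omega>} \<phi> \<and>
        strict_profile R f D g c {..<\<omega>} \<phi> \<and>
        classical_or_sharp R h D g c {..<\<omega>} \<phi> \<and>
        unique_from R f h D g c R \<omega> \<phi> \<and>
        (cond_D R D dD \<longrightarrow>
           (c < h R \<longrightarrow> sharp_at h D g c {..<\<omega>} \<phi> R) \<and>
           (h R < c \<longrightarrow> classical_on h D g c {..<\<omega>} \<phi>) \<and>
           (c = h R \<and> dD R < 0 \<longrightarrow> classical_on h D g c {..<\<omega>} \<phi>)) \<and>
        (cond_D_tilde R D g \<longrightarrow> classical_on h D g c {..<\<omega>} \<phi>))
     \<and>
     (\<exists>\<omega> \<phi>. semi_wavefront_to R f D g c R \<omega> \<phi> \<and>
        maximal_profile R f D g c {\<omega><..} \<phi> \<and>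
        strict_profile R f D g c {\<omega><..} \<phi> \<and>
        classical_or_sharp R h D g c {\<omega><..} \<phi> \<and>
        unique_to R f h D g c R \<omega> \<phi> \<and>
        (cond_D R D dD \<longrightarrow>
           (c < h R \<longrightarrow> classical_on h D g c {\<omega><..} \<phi>) \<and>
           (h R < c \<longrightarrow> sharp_at h D g c {\<omega><..} \<phi> R) \<and>
           (c = h R \<and> dD R < 0 \<longrightarrow> classical_on h D g c {\<omega><..} \<phi>)) \<and>
        (cond_D_tilde R D g \<longrightarrow> classical_on h D g c {\<omega><..} \<phi>))
     \<and>
     (\<exists>f\<^sub>1 h\<^sub>1 D\<^sub>1 dD\<^sub>1 g\<^sub>1.
        flux_source_data R f\<^sub>1 h\<^sub>1 g\<^sub>1 \<and> cond_D R D\<^sub>1 dD\<^sub>1 \<and> c = h\<^sub>1 R \<and> dD\<^sub>1 R = 0 \<and>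
        (\<exists>\<omega> \<phi>. semi_wavefront_from R f\<^sub>1 D\<^sub>1 g\<^sub>1 c R \<omega> \<phi> \<and>
           maximal_profile R f\<^sub>1 D\<^sub>1 g\<^sub>1 c {..<\<omega>} \<phi> \<and>
           classical_on h\<^sub>1 D\<^sub>1 g\<^sub>1 c {..<\<omega>} \<phi>) \<and>
        (\<exists>\<omega> \<phi>. semi_wavefront_to R f\<^sub>1 D\<^sub>1 g\<^sub>1 c R \<omega> \<phi> \<and>
           maximal_profile R f\<^sub>1 D\<^sub>1 g\<^sub>1 c {\<omega><..} \<phi> \<and>
           classical_on h\<^sub>1 D\<^sub>1 g\<^sub>1 c {\<omega><..} \<phi>))
     \<and>
     (\<exists>f\<^sub>2 h\<^sub>2 D\<^sub>2 dD\<^sub>2 g\<^sub>2.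
        flux_source_data R f\<^sub>2 h\<^sub>2 g\<^sub>2 \<and> cond_D R D\<^sub>2 dD\<^sub>2 \<and> c = h\<^sub>2 R \<and> dD\<^sub>2 R = 0 \<and>
        (\<exists>\<omega> \<phi>. semi_wavefront_from R f\<^sub>2 D\<^sub>2 g\<^sub>2 c R \<omega> \<phi> \<and>
           maximal_profile R f\<^sub>2 D\<^sub>2 g\<^sub>2 c {..<\<omega>} \<phi> \<and>
           sharp_at h\<^sub>2 D\<^sub>2 g\<^sub>2 c {..<\<omega>} \<phi> R) \<and>
        (\<exists>\<omega> \<phi>. semi_wavefront_to R f\<^sub>2 D\<^sub>2 g\<^sub>2 c R \<omega> \<phi> \<and>
           maximal_profile R f\<^sub>2 D\<^sub>2 g\<^sub>2 c {\<omega><..} \<phi> \<and>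
           sharp_at h\<^sub>2 D\<^sub>2 g\<^sub>2 c {\<omega><..} \<phi> R))"
proof -
  have "continuous_on {0..R} D" "D R = 0" "\<forall>\<rho>\<in>{0<..<R}. 0 < D \<rho>"
    using assms(3) by (auto simp: cond_D_def cond_D_tilde_def C1_on_def intro: DERIV_continuous_on)
  then interpret rd_data R c f h D g
    by unfold_locales (use assms(1,2) in auto)
  \<comment> \<open>The linear flux \<open>c s\<close> puts every given speed at the borderline
    \<open>h R\<close>, and the double zero of \<open>(R - s)^2\<close> makes the derivative of
    \<open>D\<close> vanish there. The two source terms then decide the type.\<close>
  have cubic: "continuous_on {0..R} (\<lambda>s. (R - s) ^ 3)" "\<And>\<rho>. 0 \<le> \<rho> \<Longrightarrow> \<rho> < R \<Longrightarrow> 0 < (R - \<rho>) ^ 3" "(R - R) ^ 3 = 0"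
    and linear: "continuous_on {0..R} (\<lambda>s. R - s)" "\<And>\<rho>. 0 \<le> \<rho> \<Longrightarrow> \<rho> < R \<Longrightarrow> 0 < R - \<rho>" "R - R = 0"
    by (auto intro!: continuous_intros)
  show ?thesis
  proof (intro conjI, goal_cases)
    case 1
    show ?case by (rule wavefront_from_exists)
  next
    case 2
    show ?case by (rule wavefront_to_exists)
  next
    case 3
    show ?case
      by (rule exI[of _ "\<lambda>s. c * s"], rule exI[of _ "\<lambda>_. c"], rule exI[of _ "\<lambda>s. (R - s)\<^sup>2"],
          rule exI[of _ "\<lambda>s. - 2 * (R - s)"], rule exI[of _ "\<lambda>s. (R - s) ^ 3"])
        (intro conjI quadratic_diffusion_data(1,2)[OF assms(1) cubic] classical_example_from
          classical_example_to assms(1), auto)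
  next
    case 4
    show ?case
      by (rule exI[of _ "\<lambda>s. c * s"], rule exI[of _ "\<lambda>_. c"], rule exI[of _ "\<lambda>s. (R - s)\<^sup>2"],
          rule exI[of _ "\<lambda>s. - 2 * (R - s)"], rule exI[of _ "\<lambda>s. R - s"])
        (intro conjI quadratic_diffusion_data(1,2)[OF assms(1) linear] sharp_example_from
          sharp_example_to assms(1), auto)
  qed
qed

end
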